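(* Let $d\ge 1$, let $\Omega\subset\mathbb{R}^d$ be a bounded open set, let $\theta\in\mathbb{S}^{d-1}$ and let $u,v\in W_\theta(\Omega)$. Then $$\int_\Omega\Big(u(x)\,\partial_\theta v(x)+v(x)\,\partial_\theta u(x)\Big)\,dx=\int_{\partial\Omega}\frac{\gamma_\theta u(z)\,\gamma_\theta v(z)-\gamma_{-\theta}u(\Phi_{-\theta}(z))\,\gamma_{-\theta}v(\Phi_{-\theta}(z))}{\ell_{-\theta}(z)}\,d\mu_\theta(z).$$
   Context: $\partial\Omega=\overline{\Omega}\setminus\Omega$; $\mathbb{S}^{d-1}$ is the Euclidean unit sphere; $]a,b[$ denotes the open real interval. A function $u\in L^2(\Omega)$ has weak directional derivative $\partial_\theta u=v\in L^2(\Omega)$ if $\int_\Omega u\,(\theta\cdot\nabla\varphi)\,dx=-\int_\Omega v\varphi\,dx$ for all $\varphi\in C^\infty_c(\Omega)$. $W_\theta(\Omega)=\{u\in L^2(\Omega):\partial_\theta u\in L^2(\Omega)\}$ (so $W_{-\theta}(\Omega)=W_\theta(\Omega)$). $H_\theta=\{y\in\mathbb{R}^d: y\cdot\theta=0\}$; $\mathcal{P}_\theta(x)=x-(x\cdot\theta)\theta$; $\lambda^{d-1}$ is the $(d-1)$-dimensional Lebesgue measure on $H_\theta$ (identified isometrically with $\mathbb{R}^{d-1}$). For $y\in H_\theta$, $\omega_\theta(y)=\{s\in\mathbb{R}: s\theta+y\in\Omega\}$, and $\mathcal{I}_\theta(y)$ is the countable set of disjoint bounded open intervals (the connected components) whose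 union is $\omega_\theta(y)$. Directional trace: a function $g:\partial\Omega\to\mathbb{R}$ is a directional trace of $u\in W_\theta(\Omega)$ in the direction $\theta$ if there exist a representative of $u$ (still denoted $u$) and a set $A\subset\mathcal{P}_\theta(\Omega)$ such that (1) $\mathcal{P}_\theta(\Omega)\setminus A$ is $\lambda^{d-1}$-negligible; (2) for all $y\in A$, $u_{\theta,y}:s\mapsto u(s\theta+y)$ is an element of $H^1(\omega_\theta(y))$ and, for all $]\alpha,\beta[\,\in\mathcal{I}_\theta(y)$, taking the representative of $u_{\theta,y}$ which is continuous on $]\alpha,\beta]$, one has $g(\beta\theta+y)=u_{\theta,y}(\beta)$. Directional measure: for $x\in\Omega$, $\delta_\theta(x)=\sup\{s\ge 0:\forall t\in[0,s[,\ x+t\theta\in\Omega\}$, $\Phi_\theta(x)=x+\delta_\theta(x)\theta\in\partial\Omega$, and $\partial_\theta\Omega=\Phi_\theta(\Omega)\subset\partial\Omega$. The finite Borel measure $\mu_\theta$ on $\partial\Omega$ is $\mu_\theta(A)=\int_\Omega\chi_A(\Phi_\theta(x))\,dx$ for all Borel $A\subset\partial\Omega$; it is carried by $\partial_\theta\Omega$. $\gamma_\theta u$ denotes the set of all directional traces of $u$ in the direction $\theta$, which is an equivalence class of functions for equality $\mu_\theta$-a.e. Opposite points: for $z\in\partial_\theta\Omega$, with $y=\mathcal{P}_\theta(z)$ and $]\alpha,\beta[\,\in\mathcal{I}_\theta(y)$ the interval such that $z=y+\beta\theta$, one sets $\Phi_{-\theta}(z)=y+\alpha\theta\in\partial_{-\theta}\Omega$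 and $\ell_{-\theta}(z)=|z-\Phi_{-\theta}(z)|=\beta-\alpha$. The map $\Phi_{-\theta}:\partial_\theta\Omega\to\partial_{-\theta}\Omega$ is a bijection and $\mu_{-\theta}$ is the image of $\mu_\theta$ by it, so the integrand is well defined $\mu_\theta$-a.e. *)

theory Defs
  imports "HOL-Analysis.Analysis"
begin

section \<open>Test functions and weak directional derivatives\<close>

primrec Ck :: "nat \<Rightarrow> ('a::euclidean_space \<Rightarrow> real) \<Rightarrow> bool" where
  "Ck 0 f \<longleftrightarrow> continuous_on UNIV f"
| "Ck (Suc n) f \<longleftrightarrow> f differentiable_on UNIV \<and>
     (\<forall>b\<in>Basis. Ck n (\<lambda>x. frechet_derivative f (at x) b))"

text \<open>Elements of $C^\infty_c(\Omega)$ are represented by their extension by zero to the whole space.\<close>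

definition test_fun :: "'a::euclidean_space set \<Rightarrow> ('a \<Rightarrow> real) set" where
  "test_fun \<Omega> = {\<phi>. (\<forall>n. Ck n \<phi>) \<and> compact (closure {x. \<phi> x \<noteq> 0}) \<and> closure {x. \<phi> x \<noteq> 0} \<subseteq> \<Omega>}"

definition grad :: "('a::euclidean_space \<Rightarrow> real) \<Rightarrow> 'a \<Rightarrow> 'a" where
  "grad \<phi> x = (THE D. GDERIV \<phi> x :> D)"

text \<open>Elements of $L^2(\Omega)$, of $W_\theta(\Omega)$ and weak derivatives are functions, to be
  read as representatives of their classes for equality almost everywhere on $\Omega$; their values
  outside $\Omega$ are irrelevant.\<close>

definition L2 :: "'a::euclidean_space set \<Rightarrow> ('a \<Rightarrow> real) set" where
  "L2 \<Omega> = {u. u \<in> borel_measurable (lebesgue_on \<Omega>) \<and> integrable (lebesgue_on \<Omega>) (\<lambda>x. (u x)\<^sup>2)}"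

definition weak_dir_deriv ::
    "'a::euclidean_space set \<Rightarrow> 'a \<Rightarrow> ('a \<Rightarrow> real) \<Rightarrow> ('a \<Rightarrow> real) \<Rightarrow> bool" where
  "weak_dir_deriv \<Omega> \<theta> u v \<longleftrightarrow> u \<in> L2 \<Omega> \<and> v \<in> L2 \<Omega> \<and>
     (\<forall>\<phi>\<in>test_fun \<Omega>. (LINT x|lebesgue_on \<Omega>. u x * (\<theta> \<bullet> grad \<phi> x))
                     = - (LINT x|lebesgue_on \<Omega>. v x * \<phi> x))"

definition W_dir :: "'a::euclidean_space set \<Rightarrow> 'a \<Rightarrow> ('a \<Rightarrow> real) set" where
  "W_dir \<Omega> \<theta> = {u \<in> L2 \<Omega>. \<exists>v. weak_dir_deriv \<Omega> \<theta> u v}"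

text \<open>On the line, the weak derivative is the weak directional derivative in the direction $1$.\<close>

definition H1 :: "real set \<Rightarrow> (real \<Rightarrow> real) set" where
  "H1 \<omega> = W_dir \<omega> 1"


section \<open>Lines parallel to the direction\<close>

definition hyp :: "'a::euclidean_space \<Rightarrow> 'a set" where
  "hyp \<theta> = {y. y \<bullet> \<theta> = 0}"

definition proj :: "'a::euclidean_space \<Rightarrow> 'a \<Rightarrow> 'a" where
  "proj \<theta> x = x - (x \<bullet> \<theta>) *\<^sub>R \<theta>"

definition hyp_basis :: "'a::euclidean_space \<Rightarrow> 'a set" where
  "hyp_basis \<theta> = (SOME B. pairwise orthogonal B \<and> (\<forall>b\<in>B. norm b = 1) \<and> span B = hyp \<theta>)"

text \<open>The $(d-1)$-dimensional Lebesgue measure on the hyperplane, as the completed image of the product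
  Lebesgue measure under the isometry given by an orthonormal basis (cf. the definition of
  \<^const>\<open>lborel\<close>). By rotation invariance it does not depend on the basis chosen. For $d=1$ the basis
  is empty and the measure is the unit point mass at $0$.\<close>

definition hyp_lebesgue :: "'a::euclidean_space \<Rightarrow> 'a measure" where
  "hyp_lebesgue \<theta> = completion (distr (\<Pi>\<^sub>M b\<in>hyp_basis \<theta>. (lborel :: real measure))
     (restrict_space borel (hyp \<theta>)) (\<lambda>c. \<Sum>b\<in>hyp_basis \<theta>. c b *\<^sub>R b))"

definition line_section :: "'a::euclidean_space set \<Rightarrow> 'a \<Rightarrow> 'a \<Rightarrow> real set" where
  "line_section \<Omega> \<theta> y = {s. s *\<^sub>R \<theta> + y \<in> \<Omega>}"

definition line_intervals :: "'a::euclidean_space set \<Rightarrow> 'a \<Rightarrow> 'a \<Rightarrow> real set set" where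
  "line_intervals \<Omega> \<theta> y = components (line_section \<Omega> \<theta> y)"


section \<open>Directional traces\<close>

text \<open>A trace is a function on the boundary of $\Omega$; its values elsewhere are irrelevant. The
  function \<open>u'\<close> is the representative of \<open>u\<close>, and \<open>w\<close> is the representative of \<open>u'\<close> on the line
  that is continuous up to the right endpoint.\<close>

definition dir_traces :: "'a::euclidean_space set \<Rightarrow> 'a \<Rightarrow> ('a \<Rightarrow> real) \<Rightarrow> ('a \<Rightarrow> real) set" where
  "dir_traces \<Omega> \<theta> u = {g. \<exists>u' A.
     (AE x in lebesgue_on \<Omega>. u' x = u x) \<and>
     A \<subseteq> proj \<theta> ` \<Omega> \<and>
     proj \<theta> ` \<Omega> - A \<in> null_sets (hyp_lebesgue \<theta>) \<and>
     (\<forall>y\<in>A. (\<lambda>s. u' (s *\<^sub>R \<theta> + y)) \<in> H1 (line_section \<Omega> \<theta> y) \<and>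
        (\<forall>\<alpha> \<beta>. {\<alpha><..<\<beta>} \<in> line_intervals \<Omega> \<theta> y \<longrightarrow>
           (\<exists>w. continuous_on {\<alpha><..\<beta>} w \<and>
                (AE s in lebesgue_on {\<alpha><..<\<beta>}. w s = u' (s *\<^sub>R \<theta> + y)) \<and>
                g (\<beta> *\<^sub>R \<theta> + y) = w \<beta>)))}"


section \<open>The directional measure on the boundary\<close>

definition exit_time :: "'a::euclidean_space set \<Rightarrow> 'a \<Rightarrow> 'a \<Rightarrow> real" where
  "exit_time \<Omega> \<theta> x = Sup {s. 0 \<le> s \<and> (\<forall>t\<in>{0..<s}. x + t *\<^sub>R \<theta> \<in> \<Omega>)}"

definition exit_point :: "'a::euclidean_space set \<Rightarrow> 'a \<Rightarrow> 'a \<Rightarrow> 'a" where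
  "exit_point \<Omega> \<theta> x = x + exit_time \<Omega> \<theta> x *\<^sub>R \<theta>"

text \<open>The completion is harmless (it does not change the measure of Borel sets) and needed: a directional
  trace is determined only almost everywhere, so it need not be Borel measurable.\<close>

definition dir_measure :: "'a::euclidean_space set \<Rightarrow> 'a \<Rightarrow> 'a measure" where
  "dir_measure \<Omega> \<theta> = completion
     (distr (lebesgue_on \<Omega>) (restrict_space borel (closure \<Omega> - \<Omega>)) (exit_point \<Omega> \<theta>))"

text \<open>The point opposite to \<open>z\<close> is meaningful for \<open>z\<close> in \<open>exit_point \<Omega> \<theta> ` \<Omega>\<close>, which carries
  \<open>dir_measure \<Omega> \<theta>\<close>; for such \<open>z\<close> exactly one component of the line section has right
  endpoint \<open>z\<close>.\<close>

definition opposite :: "'a::euclidean_space set \<Rightarrow> 'a \<Rightarrow> 'a \<Rightarrow> 'a" where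
  "opposite \<Omega> \<theta> z = proj \<theta> z + (THE \<alpha>. \<exists>\<beta>. {\<alpha><..<\<beta>} \<in> line_intervals \<Omega> \<theta> (proj \<theta> z) \<and>
     z = proj \<theta> z + \<beta> *\<^sub>R \<theta>) *\<^sub>R \<theta>"

definition opp_dist :: "'a::euclidean_space set \<Rightarrow> 'a \<Rightarrow> 'a \<Rightarrow> real" where
  "opp_dist \<Omega> \<theta> z = norm (z - opposite \<Omega> \<theta> z)"

end

theory Submission
  imports Defs
begin

text \<open>
  Everything happens on the lines \<open>{s *\<^sub>R \<theta> + y | s}\<close> with \<open>y\<close> in the hyperplane orthogonal to \<open>\<theta>\<close>.
  By rotation invariance, Lebesgue measure is the product of the hyperplane measure and the
  one-dimensional Lebesgue measure (\<open>nn_integral_lborel_lines\<close>), so both sides of the formula can be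
  compared line by line, and on each line interval by interval.

  On almost every line, a function \<open>u\<close> with weak derivative \<open>du\<close> in the direction \<open>\<theta>\<close> agrees on each
  component \<open>]\<alpha>,\<beta>[\<close> of the section of \<open>\<Omega>\<close> with a primitive of \<open>du\<close>, continuous on \<open>[\<alpha>,\<beta>]\<close>
  (\<open>AE_line_primitive\<close>).  This is the lemma of du Bois-Reymond with parameter \<open>y\<close>: testing the weak
  derivative with products of smooth bumps, and passing to the limit in the bumps, compares the means of
  \<open>u\<close> over two intervals of a line; countably many rational choices suffice, so that one null set of
  lines is discarded.  The values of the primitive at \<open>\<beta>\<close> and at \<open>\<alpha>\<close> are the traces for \<open>\<theta>\<close> and \<open>-\<theta>\<close>:
  this yields the existence of traces (\<open>dir_traces_nonempty\<close>), and every trace has these values on almost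
  every line (\<open>AE_trace_value\<close>).  The product rule for primitives (\<open>is_primitive_product\<close>) then says that
  \<open>F = u dv + v du\<close> has the integral \<open>gu gv - hu hv\<close>, taken between the ends, over each component.

  On the boundary side, the directional measure is the image of Lebesgue measure under the exit map.
  That map is constant on each component, with value the right end \<open>z\<close>.  At \<open>z\<close> the integrand, the
  difference of the products of the traces divided by the length of the component, is thus the mean of
  \<open>F\<close> over the component, and replacing \<open>F\<close> by its mean on every component does not change its integral
  (\<open>integral_mean_behind\<close>).  What remains is measurability: a trace may be altered on null sets, and a
  function on the boundary with a Lebesgue measurable composition with the exit map is not evidently
  measurable.  The mean is therefore written as a Borel function on the whole space (\<open>mean_behind\<close>),
  with which the integrand agrees almost everywhere (\<open>AE_exit_distribution\<close>).
\<close>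

section \<open>Lebesgue measure along parallel lines\<close>

text \<open>Let \<open>B\<close> be the closed unit ball.  Integrating \<open>indicator A x * indicator B (y - x)\<close> for the product of
  \<open>M\<close> and Lebesgue measure in both orders, and using invariance of one factor each time, gives
  \<open>M A * lborel B = M (- B) * lborel A\<close>; as \<open>- B = B\<close>, the common mass of the ball cancels.\<close>

lemma translation_invariant_eq_lborel:
  fixes M :: "'a::euclidean_space measure"
  assumes M: "sets M = sets borel" "sigma_finite_measure M"
    and inv: "\<And>a. distr M borel ((+) a) = M"
    and ball: "emeasure M (cball 0 1) = emeasure lborel (cball 0 1 :: 'a set)"
  shows "M = lborel"
proof (rule measure_eqI)
  show "sets M = sets lborel" using M by simp
  fix A assume "A \<in> sets M"
  then have [measurable]: "A \<in> sets borel" using M by simp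
  have [measurable_cong]: "sets M = sets borel" by fact
  interpret M: sigma_finite_measure M by fact
  interpret P: pair_sigma_finite M "lborel :: 'a measure"
    by (simp add: pair_sigma_finite_def M sigma_finite_lborel)
  define B where "B = (cball 0 1 :: 'a set)"
  have [measurable]: "B \<in> sets borel" by (simp add: B_def)
  have shift_lborel: "(\<integral>\<^sup>+y. f (a + y) \<partial>lborel) = (\<integral>\<^sup>+y. f y \<partial>lborel)"
    if [measurable]: "f \<in> borel_measurable borel" for f :: "'a \<Rightarrow> ennreal" and a
    by (subst (2) lborel_distr_plus[of a, symmetric]) (simp add: nn_integral_distr)
  have shift_M: "(\<integral>\<^sup>+y. f (a + y) \<partial>M) = (\<integral>\<^sup>+y. f y \<partial>M)"
    if [measurable]: "f \<in> borel_measurable borel" for f :: "'a \<Rightarrow> ennreal" and a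
    by (subst (2) inv[of a, symmetric]) (simp add: nn_integral_distr)
  have "emeasure M A * emeasure lborel B = (\<integral>\<^sup>+x. indicator A x * emeasure lborel B \<partial>M)"
    by (simp add: nn_integral_multc)
  also have "\<dots> = (\<integral>\<^sup>+x. \<integral>\<^sup>+y. indicator A x * indicator B (y - x) \<partial>lborel \<partial>M)"
  proof (rule nn_integral_cong)
    fix x
    have "(\<integral>\<^sup>+y. indicator A x * indicator B (y - x) \<partial>lborel) =
        indicator A x * (\<integral>\<^sup>+y. indicator B (y - x) \<partial>lborel)"
      by (rule nn_integral_cmult) measurable
    also have "(\<integral>\<^sup>+y. indicator B (y - x) \<partial>lborel) = emeasure lborel B"
      using shift_lborel[of "indicator B" "- x"] by (simp add: algebra_simps)
    finally show "indicator A x * emeasure lborel B = (\<integral>\<^sup>+y. indicator A x * indicator B (y - x) \<partial>lborel)"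
      by simp
  qed
  also have "\<dots> = (\<integral>\<^sup>+y. \<integral>\<^sup>+x. indicator A x * indicator B (y - x) \<partial>M \<partial>lborel)"
    by (rule P.Fubini'[symmetric]) measurable
  also have "\<dots> = (\<integral>\<^sup>+y. \<integral>\<^sup>+x. indicator A (y + x) * indicator B (- x) \<partial>M \<partial>lborel)"
  proof (rule nn_integral_cong)
    fix y
    show "(\<integral>\<^sup>+x. indicator A x * indicator B (y - x) \<partial>M) =
        (\<integral>\<^sup>+x. indicator A (y + x) * indicator B (- x) \<partial>M)"
      by (subst shift_M[of "\<lambda>x. indicator A x * indicator B (y - x)" y, symmetric]) (auto simp: algebra_simps)
  qed
  also have "\<dots> = (\<integral>\<^sup>+x. \<integral>\<^sup>+y. indicator A (y + x) * indicator B (- x) \<partial>lborel \<partial>M)"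
    by (rule P.Fubini') measurable
  also have "\<dots> = (\<integral>\<^sup>+x. emeasure lborel A * indicator B x \<partial>M)"
  proof (rule nn_integral_cong)
    fix x
    have "(\<integral>\<^sup>+y. indicator A (y + x) * indicator B (- x) \<partial>lborel) =
        (\<integral>\<^sup>+y. indicator A (y + x) \<partial>lborel) * indicator B (- x)"
      by (rule nn_integral_multc) measurable
    also have "(\<integral>\<^sup>+y. indicator A (y + x) \<partial>lborel) = emeasure lborel A"
      using shift_lborel[of "indicator A" "x"] by (simp add: algebra_simps)
    finally show "(\<integral>\<^sup>+y. indicator A (y + x) * indicator B (- x) \<partial>lborel) = emeasure lborel A * indicator B x"
      by (simp add: B_def indicator_def)
  qed
  also have "\<dots> = emeasure lborel A * emeasure lborel B"
    by (simp add: nn_integral_cmult_indicator ball B_def)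
  finally have eq: "emeasure M A * emeasure lborel B = emeasure lborel A * emeasure lborel B" .
  have "0 < measure lborel B"
    unfolding B_def by (intro content_cball_pos) simp
  then have "emeasure lborel B \<noteq> 0" by (auto simp: measure_def)
  moreover have "emeasure lborel B < top"
    using emeasure_lborel_cball_finite[of "0::'a" 1] by (simp add: B_def)
  ultimately show "emeasure M A = emeasure lborel A"
    using eq by (auto simp: mult.commute[of _ "emeasure lborel B"] ennreal_mult_cancel_left)
qed

text \<open>The image measure is again translation invariant, and the unit ball keeps its mass because its
  preimage is the ball itself.\<close>

lemma distr_lborel_orthogonal:
  fixes T :: "'a::euclidean_space \<Rightarrow> 'a"
  assumes T: "orthogonal_transformation T"
  shows "distr lborel borel T = lborel"
proof (rule translation_invariant_eq_lborel)
  have lin: "linear T" using T by (simp add: orthogonal_transformation_def)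
  have [measurable]: "T \<in> borel_measurable borel"
    using lin by (intro borel_measurable_continuous_onI linear_continuous_on linear_conv_bounded_linear[THEN iffD1])
  have bij: "bij T" using T by (rule orthogonal_transformation_bij)
  have linv: "linear (inv T)" using orthogonal_transformation_inv[OF T] by (simp add: orthogonal_transformation_def)
  have [measurable]: "inv T \<in> borel_measurable borel"
    using linv by (intro borel_measurable_continuous_onI linear_continuous_on linear_conv_bounded_linear[THEN iffD1])
  show "sets (distr lborel borel T) = sets borel" by simp
  show "sigma_finite_measure (distr lborel borel T)"
  proof (rule sigma_finite_measure_distr[of _ borel "inv T"])
    have "distr (distr lborel borel T) borel (inv T) = distr lborel borel (inv T \<circ> T)"
      by (subst distr_distr) (auto simp: comp_def)
    also have "inv T \<circ> T = id" using bij by (simp add: bij_def)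
    finally have "distr (distr lborel borel T) borel (inv T) = (lborel :: 'a measure)"
      by (simp add: distr_id2)
    then show "sigma_finite_measure (distr (distr lborel borel T) borel (inv T))"
      by (simp add: sigma_finite_lborel)
  qed measurable
  show "distr (distr lborel borel T) borel ((+) a) = distr lborel borel T" for a
  proof -
    have "distr (distr lborel borel T) borel ((+) a) = distr lborel borel ((+) a \<circ> T)"
      by (subst distr_distr) (auto simp: comp_def)
    also have "(+) a \<circ> T = T \<circ> (+) (inv T a)"
      using bij lin by (auto simp: fun_eq_iff linear_add bij_def surj_f_inv_f)
    also have "distr lborel borel (T \<circ> (+) (inv T a)) = distr (distr lborel borel ((+) (inv T a))) borel T"
      by (subst distr_distr) (auto simp: comp_def)
    finally show ?thesis by (simp add: lborel_distr_plus)
  qed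
  have "T -` cball 0 1 = cball 0 1"
    using T by (auto simp: orthogonal_transformation_norm)
  then show "emeasure (distr lborel borel T) (cball 0 1) = emeasure lborel (cball 0 1 :: 'a set)"
    by (simp add: emeasure_distr)
qed


text \<open>The choice in the definition of the basis is legitimate because every subspace has an orthonormal
  basis.\<close>

lemma hyp_basis_orthonormal:
  fixes \<theta> :: "'a::euclidean_space"
  shows "pairwise orthogonal (hyp_basis \<theta>)" "\<And>b. b \<in> hyp_basis \<theta> \<Longrightarrow> norm b = 1"
    "span (hyp_basis \<theta>) = hyp \<theta>" "finite (hyp_basis \<theta>)"
    "norm \<theta> = 1 \<Longrightarrow> card (hyp_basis \<theta>) = DIM('a) - 1"
proof -
  have hyp: "hyp \<theta> = {y. \<theta> \<bullet> y = 0}" by (auto simp: hyp_def inner_commute)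
  have "subspace (hyp \<theta>)" unfolding hyp by (rule subspace_hyperplane)
  from orthonormal_basis_subspace[OF this] obtain B where
    "pairwise orthogonal B" "\<And>b. b \<in> B \<Longrightarrow> norm b = 1" "span B = hyp \<theta>" by metis
  then have ex: "\<exists>B. pairwise orthogonal B \<and> (\<forall>b\<in>B. norm b = 1) \<and> span B = hyp \<theta>" by blast
  note B = someI_ex[OF ex, folded hyp_basis_def]
  then show 1: "pairwise orthogonal (hyp_basis \<theta>)" "\<And>b. b \<in> hyp_basis \<theta> \<Longrightarrow> norm b = 1"
    "span (hyp_basis \<theta>) = hyp \<theta>" by auto
  have ind: "independent (hyp_basis \<theta>)"
    using 1 by (intro pairwise_orthogonal_independent) force+
  then show "finite (hyp_basis \<theta>)" by (rule independent_imp_finite)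
  show "card (hyp_basis \<theta>) = DIM('a) - 1" if "norm \<theta> = 1"
  proof -
    have "\<theta> \<noteq> 0" using that by auto
    have "card (hyp_basis \<theta>) = dim (span (hyp_basis \<theta>))"
      using ind by (simp add: dim_eq_card_independent)
    then show ?thesis using dim_hyperplane[OF \<open>\<theta> \<noteq> 0\<close>] by (simp add: 1 hyp)
  qed
qed

lemma hyp_basis_inner:
  assumes "b \<in> hyp_basis \<theta>" "c \<in> hyp_basis \<theta>"
  shows "b \<bullet> c = (if b = c then 1 else 0)"
  using hyp_basis_orthonormal(1)[of \<theta>] hyp_basis_orthonormal(2)[of b \<theta>] assms
  by (auto simp: pairwise_def orthogonal_def norm_eq_1)

lemma hyp_basis_inner_direction: "b \<in> hyp_basis \<theta> \<Longrightarrow> b \<bullet> \<theta> = 0"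
  using hyp_basis_orthonormal(3)[of \<theta>] span_base[of b "hyp_basis \<theta>"] by (auto simp: hyp_def)

definition hyp_sum :: "'a::euclidean_space \<Rightarrow> ('a \<Rightarrow> real) \<Rightarrow> 'a" where
  "hyp_sum \<theta> c = (\<Sum>b\<in>hyp_basis \<theta>. c b *\<^sub>R b)"

lemma hyp_sum_in_hyp: "hyp_sum \<theta> c \<in> hyp \<theta>"
  unfolding hyp_sum_def hyp_basis_orthonormal(3)[symmetric] by (intro span_sum span_scale span_base)

lemma measurable_hyp_sum [measurable]:
  "hyp_sum \<theta> \<in> borel_measurable (\<Pi>\<^sub>M b\<in>hyp_basis \<theta>. (lborel :: real measure))"
  unfolding hyp_sum_def
  by (intro borel_measurable_sum borel_measurable_scaleR borel_measurable_const) simp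

text \<open>The hyperplane measure before completion, carried over to the whole space: functions on the space
  can be integrated against it directly, and exceptional sets of lines become statements \<open>AE y\<close>.\<close>

definition hyp_borel :: "'a::euclidean_space \<Rightarrow> 'a measure" where
  "hyp_borel \<theta> = distr (\<Pi>\<^sub>M b\<in>hyp_basis \<theta>. (lborel :: real measure)) borel (hyp_sum \<theta>)"

lemma sets_hyp_borel [measurable_cong, simp]: "sets (hyp_borel \<theta>) = sets borel"
  and space_hyp_borel [simp]: "space (hyp_borel \<theta>) = UNIV"
  by (simp_all add: hyp_borel_def)

lemma hyp_borel_uminus: "hyp_borel (- \<theta>) = hyp_borel \<theta>"
proof -
  have "hyp_basis (- \<theta>) = hyp_basis \<theta>" by (simp add: hyp_basis_def hyp_def)
  then show ?thesis by (simp add: hyp_borel_def hyp_sum_def[abs_def])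
qed

lemma hyp_lebesgue_eq:
  "hyp_lebesgue \<theta> = completion (distr (\<Pi>\<^sub>M b\<in>hyp_basis \<theta>. (lborel :: real measure))
     (restrict_space borel (hyp \<theta>)) (hyp_sum \<theta>))"
  by (simp add: hyp_lebesgue_def hyp_sum_def[abs_def])

lemma closed_hyp: "closed (hyp \<theta>)"
  unfolding hyp_def using closed_hyperplane[of \<theta> 0] by (simp add: inner_commute[of \<theta>])

lemma sets_hyp [measurable]: "hyp \<theta> \<in> sets borel"
  by (rule borel_closed[OF closed_hyp])

lemma AE_hyp_borel_in_hyp: "AE y in hyp_borel \<theta>. y \<in> hyp \<theta>"
  unfolding hyp_borel_def by (subst AE_distr_iff) (auto simp: hyp_sum_in_hyp)

interpretation lborel_family: product_sigma_finite "\<lambda>_. (lborel :: real measure)"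
  by standard

text \<open>Taking coordinates inverts \<open>hyp_sum\<close>, so that a product of Lebesgue measures is an image of this
  measure.\<close>

lemma sigma_finite_hyp_borel: "sigma_finite_measure (hyp_borel \<theta>)"
proof (rule sigma_finite_measure_distr)
  let ?P = "\<Pi>\<^sub>M b\<in>hyp_basis \<theta>. (lborel :: real measure)"
  let ?h = "\<lambda>y. \<lambda>b\<in>hyp_basis \<theta>. y \<bullet> b"
  show [measurable]: "?h \<in> measurable (hyp_borel \<theta>) ?P"
    by (intro measurable_restrict) simp
  have inv: "?h (hyp_sum \<theta> c) = c" if "c \<in> space ?P" for c
  proof -
    have "hyp_sum \<theta> c \<bullet> b = c b" if "b \<in> hyp_basis \<theta>" for b
    proof -
      have "hyp_sum \<theta> c \<bullet> b = (\<Sum>a\<in>hyp_basis \<theta>. if a = b then c b else 0)"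
        unfolding hyp_sum_def inner_sum_left
        by (intro sum.cong) (auto simp: hyp_basis_inner that)
      then show ?thesis using that hyp_basis_orthonormal(4)[of \<theta>] by simp
    qed
    then show ?thesis using that by (auto simp: space_PiM fun_eq_iff PiE_def extensional_def)
  qed
  have "distr (hyp_borel \<theta>) ?P ?h = distr ?P ?P (\<lambda>c. ?h (hyp_sum \<theta> c))"
    unfolding hyp_borel_def by (subst distr_distr) (auto simp: comp_def)
  also have "\<dots> = distr ?P ?P (\<lambda>c. c)"
    by (intro distr_cong inv) auto
  also have "\<dots> = ?P" by (simp add: distr_id2)
  finally show "sigma_finite_measure (distr (hyp_borel \<theta>) ?P ?h)"
    using lborel_family.sigma_finite[OF hyp_basis_orthonormal(4)] by simp
qed

text \<open>Fubini in the orthonormal frame \<open>E\<close> consisting of \<open>\<theta>\<close> and the basis of the hyperplane.  The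
  orthogonal map \<open>T\<close> that sends the standard basis to \<open>E\<close> preserves Lebesgue measure, which on standard
  coordinates is a product measure; renaming the coordinates by \<open>E\<close> and splitting off \<open>\<theta>\<close> leaves the
  hyperplane measure and one real variable.\<close>

lemma nn_integral_lborel_lines:
  fixes \<theta> :: "'a::euclidean_space" and f :: "'a \<Rightarrow> ennreal"
  assumes \<theta>: "norm \<theta> = 1" and f [measurable]: "f \<in> borel_measurable borel"
  shows "(\<integral>\<^sup>+x. f x \<partial>lborel) = (\<integral>\<^sup>+y. \<integral>\<^sup>+s. f (s *\<^sub>R \<theta> + y) \<partial>lborel \<partial>hyp_borel \<theta>)"
proof -
  define B where "B = hyp_basis \<theta>"
  define E where "E = insert \<theta> B"
  have fin: "finite B" "finite E" by (auto simp: B_def E_def hyp_basis_orthonormal)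
  have notin: "\<theta> \<notin> B" using \<theta> hyp_basis_inner_direction[of \<theta> \<theta>] by (auto simp: B_def norm_eq_1)
  have E_inner: "a \<bullet> b = (if a = b then 1 else 0)" if "a \<in> E" "b \<in> E" for a b
  proof -
    have "\<theta> \<bullet> \<theta> = 1" using \<theta> by (simp add: norm_eq_1)
    moreover have "b \<bullet> \<theta> = 0 \<and> \<theta> \<bullet> b = 0 \<and> b \<noteq> \<theta>" if "b \<in> B" for b
      using that notin hyp_basis_inner_direction[of b \<theta>] by (auto simp: B_def inner_commute)
    ultimately show ?thesis
      using that unfolding E_def by (auto simp: B_def hyp_basis_inner)
  qed
  have "card E = DIM('a)"
    using hyp_basis_orthonormal(5)[OF \<theta>] fin notin DIM_positive[where 'a='a] by (simp add: E_def B_def)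
  then obtain \<sigma> where \<sigma>: "bij_betw \<sigma> (Basis :: 'a set) E"
    using finite_same_card_bij[of "Basis :: 'a set" E] fin by auto
  \<comment> \<open>The rotation from the standard basis to the frame.\<close>
  define T where "T x = (\<Sum>i\<in>Basis. (x \<bullet> i) *\<^sub>R \<sigma> i)" for x :: 'a
  have "linear T"
    unfolding T_def by (intro linearI) (simp_all add: inner_add_left scaleR_add_left sum.distrib scaleR_sum_right)
  moreover have "T x \<bullet> T y = x \<bullet> y" for x y
  proof -
    have "T x \<bullet> T y = (\<Sum>i\<in>Basis. \<Sum>j\<in>Basis. (x \<bullet> i) * (y \<bullet> j) * (\<sigma> i \<bullet> \<sigma> j))"
      by (simp add: T_def inner_sum_left inner_sum_right sum_distrib_left mult_ac, rule sum.swap)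
    also have "\<dots> = (\<Sum>i\<in>Basis. \<Sum>j\<in>Basis. if i = j then (x \<bullet> i) * (y \<bullet> i) else 0)"
      using \<sigma> by (intro sum.cong refl, subst E_inner) (auto simp: bij_betw_def inj_on_eq_iff)
    also have "\<dots> = x \<bullet> y" by (simp add: euclidean_inner[of x y])
    finally show ?thesis .
  qed
  ultimately have T: "orthogonal_transformation T" by (auto simp: orthogonal_transformation_def)
  have [measurable]: "T \<in> borel_measurable borel"
    using T unfolding orthogonal_transformation_def
    by (intro borel_measurable_continuous_onI linear_continuous_on linear_conv_bounded_linear[THEN iffD1]) simp
  let ?P = "\<lambda>I. \<Pi>\<^sub>M b\<in>I. (lborel :: real measure)"
  let ?r = "\<lambda>c. \<lambda>i\<in>Basis. c (\<sigma> i)"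
  have r_meas [measurable]: "?r \<in> measurable (?P E) (?P (Basis :: 'a set))"
    using \<sigma> by (intro measurable_restrict measurable_component_singleton) (auto simp: bij_betw_def)
  have reindex: "distr (?P E) (?P (Basis :: 'a set)) ?r = ?P (Basis :: 'a set)"
  proof (rule lborel_family.PiM_eqI)
    fix A :: "'a \<Rightarrow> real set" assume A: "\<And>i. i \<in> Basis \<Longrightarrow> A i \<in> sets lborel"
    define \<tau> where "\<tau> = inv_into Basis \<sigma>"
    have \<tau>: "\<tau> e \<in> Basis" "\<sigma> (\<tau> e) = e" if "e \<in> E" for e
      using \<sigma> that by (auto simp: \<tau>_def bij_betw_def inv_into_into f_inv_into_f)
    have \<tau>\<sigma>: "\<tau> (\<sigma> i) = i" if "i \<in> Basis" for i
      using \<sigma> that by (auto simp: \<tau>_def bij_betw_def)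
    have \<sigma>E: "\<sigma> i \<in> E" if "i \<in> Basis" for i using \<sigma> that by (auto simp: bij_betw_def)
    have "emeasure (distr (?P E) (?P (Basis :: 'a set)) ?r) (Pi\<^sub>E Basis A) =
        emeasure (?P E) (?r -` (Pi\<^sub>E Basis A) \<inter> space (?P E))"
      using A by (intro emeasure_distr r_meas sets_PiM_I_finite) auto
    also have "?r -` (Pi\<^sub>E Basis A) \<inter> space (?P E) = Pi\<^sub>E E (\<lambda>e. A (\<tau> e))"
    proof (intro set_eqI iffI)
      fix c assume c: "c \<in> ?r -` (Pi\<^sub>E Basis A) \<inter> space (?P E)"
      have "c e \<in> A (\<tau> e)" if "e \<in> E" for e
      proof -
        have "?r c (\<tau> e) \<in> A (\<tau> e)" using c \<tau>(1)[OF that] by (intro PiE_mem[of _ Basis A]) auto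
        then show ?thesis using \<tau>[OF that] by simp
      qed
      then show "c \<in> Pi\<^sub>E E (\<lambda>e. A (\<tau> e))" using c by (simp add: space_PiM PiE_iff)
    next
      fix c assume c: "c \<in> Pi\<^sub>E E (\<lambda>e. A (\<tau> e))"
      have "c (\<sigma> i) \<in> A i" if "i \<in> Basis" for i
        using PiE_mem[OF c \<sigma>E[OF that]] \<tau>\<sigma>[OF that] by simp
      then show "c \<in> ?r -` (Pi\<^sub>E Basis A) \<inter> space (?P E)"
        using c by (simp add: space_PiM PiE_iff)
    qed
    also have "emeasure (?P E) \<dots> = (\<Prod>e\<in>E. emeasure lborel (A (\<tau> e)))"
      using fin A \<tau> by (intro lborel_family.emeasure_PiM) auto
    also have "\<dots> = (\<Prod>i\<in>Basis. emeasure lborel (A i))"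
      using prod.reindex_bij_betw[OF \<sigma>, of "\<lambda>e. emeasure lborel (A (\<tau> e))"] \<tau>\<sigma> by simp
    finally show "emeasure (distr (?P E) (?P (Basis :: 'a set)) ?r) (Pi\<^sub>E Basis A) =
        (\<Prod>i\<in>Basis. emeasure lborel (A i))" .
  qed auto
  have "(\<integral>\<^sup>+x. f x \<partial>lborel) = (\<integral>\<^sup>+x. f (T x) \<partial>lborel)"
    by (subst (1) distr_lborel_orthogonal[OF T, symmetric]) (simp add: nn_integral_distr)
  also have "\<dots> = (\<integral>\<^sup>+c. f (T (\<Sum>i\<in>Basis. c i *\<^sub>R i)) \<partial>?P (Basis :: 'a set))"
    by (subst lborel_eq) (simp add: nn_integral_distr)
  also have "\<dots> = (\<integral>\<^sup>+c. f (T (\<Sum>i\<in>Basis. ?r c i *\<^sub>R i)) \<partial>?P E)"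
    by (subst reindex[symmetric], subst nn_integral_distr) measurable
  also have "\<dots> = (\<integral>\<^sup>+c. f (\<Sum>e\<in>E. c e *\<^sub>R e) \<partial>?P E)"
  proof (rule nn_integral_cong)
    fix c :: "'a \<Rightarrow> real"
    have "T (\<Sum>i\<in>Basis. ?r c i *\<^sub>R i) = (\<Sum>i\<in>Basis. c (\<sigma> i) *\<^sub>R \<sigma> i)"
      unfolding T_def by (intro sum.cong) simp_all
    also have "\<dots> = (\<Sum>e\<in>E. c e *\<^sub>R e)"
      by (rule sum.reindex_bij_betw[OF \<sigma>])
    finally show "f (T (\<Sum>i\<in>Basis. ?r c i *\<^sub>R i)) = f (\<Sum>e\<in>E. c e *\<^sub>R e)" by simp
  qed
  also have "\<dots> = (\<integral>\<^sup>+c. \<integral>\<^sup>+s. f (\<Sum>e\<in>E. (c(\<theta> := s)) e *\<^sub>R e) \<partial>lborel \<partial>?P B)"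
    unfolding E_def using fin notin by (subst lborel_family.product_nn_integral_insert) auto
  also have "\<dots> = (\<integral>\<^sup>+c. \<integral>\<^sup>+s. f (s *\<^sub>R \<theta> + hyp_sum \<theta> c) \<partial>lborel \<partial>?P B)"
  proof -
    have "(\<Sum>e\<in>E. (c(\<theta> := s)) e *\<^sub>R e) = s *\<^sub>R \<theta> + hyp_sum \<theta> c" for c s
    proof -
      have "(\<Sum>e\<in>B. (c(\<theta> := s)) e *\<^sub>R e) = (\<Sum>e\<in>B. c e *\<^sub>R e)"
        using notin by (intro sum.cong) auto
      then show ?thesis using fin notin by (simp add: E_def hyp_sum_def B_def)
    qed
    then show ?thesis by (simp only:)
  qed
  also have "\<dots> = (\<integral>\<^sup>+y. \<integral>\<^sup>+s. f (s *\<^sub>R \<theta> + y) \<partial>lborel \<partial>hyp_borel \<theta>)"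
    unfolding hyp_borel_def B_def by (subst nn_integral_distr) auto
  finally show ?thesis .
qed

lemma lborel_eq_distr_lines:
  fixes \<theta> :: "'a::euclidean_space"
  assumes \<theta>: "norm \<theta> = 1"
  shows "lborel = distr (hyp_borel \<theta> \<Otimes>\<^sub>M lborel) borel (\<lambda>(y, s). s *\<^sub>R \<theta> + y)"
proof (rule measure_eqI)
  interpret S: sigma_finite_measure "hyp_borel \<theta>" by (rule sigma_finite_hyp_borel)
  interpret pair_sigma_finite "hyp_borel \<theta>" "lborel :: real measure" ..
  fix A assume "A \<in> sets (lborel :: 'a measure)"
  then have [measurable]: "A \<in> sets borel" by simp
  have "emeasure lborel A = (\<integral>\<^sup>+y. \<integral>\<^sup>+s. indicator A (s *\<^sub>R \<theta> + y) \<partial>lborel \<partial>hyp_borel \<theta>)"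
    using nn_integral_lborel_lines[OF \<theta>, of "indicator A"] by simp
  also have "\<dots> = (\<integral>\<^sup>+z. indicator A (snd z *\<^sub>R \<theta> + fst z) \<partial>(hyp_borel \<theta> \<Otimes>\<^sub>M lborel))"
    by (subst lborel.nn_integral_fst[symmetric]) (auto simp: split_beta' comp_def)
  also have "\<dots> = (\<integral>\<^sup>+x. indicator A x \<partial>distr (hyp_borel \<theta> \<Otimes>\<^sub>M lborel) borel (\<lambda>(y, s). s *\<^sub>R \<theta> + y))"
    by (subst nn_integral_distr) (auto simp: split_beta' comp_def)
  finally show "emeasure lborel A = emeasure (distr (hyp_borel \<theta> \<Otimes>\<^sub>M lborel) borel (\<lambda>(y, s). s *\<^sub>R \<theta> + y)) A"
    by simp
qed simp

lemma integral_lborel_lines: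
  fixes \<theta> :: "'a::euclidean_space" and f :: "'a \<Rightarrow> real"
  assumes \<theta>: "norm \<theta> = 1" and f: "integrable lborel f"
  shows "AE y in hyp_borel \<theta>. integrable lborel (\<lambda>s. f (s *\<^sub>R \<theta> + y))"
    and "integrable (hyp_borel \<theta>) (\<lambda>y. (LBINT s. f (s *\<^sub>R \<theta> + y)))"
    and "(LBINT x. f x) = (\<integral>y. (LBINT s. f (s *\<^sub>R \<theta> + y)) \<partial>hyp_borel \<theta>)"
proof -
  interpret S: sigma_finite_measure "hyp_borel \<theta>" by (rule sigma_finite_hyp_borel)
  interpret pair_sigma_finite "hyp_borel \<theta>" "lborel :: real measure" ..
  have [measurable]: "f \<in> borel_measurable borel" using f by simp
  have int: "integrable (hyp_borel \<theta> \<Otimes>\<^sub>M lborel) (\<lambda>(y, s). f (s *\<^sub>R \<theta> + y))"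
    using f by (subst (asm) lborel_eq_distr_lines[OF \<theta>], subst (asm) integrable_distr_eq) (auto simp: split_beta' comp_def)
  show "AE y in hyp_borel \<theta>. integrable lborel (\<lambda>s. f (s *\<^sub>R \<theta> + y))"
    "integrable (hyp_borel \<theta>) (\<lambda>y. (LBINT s. f (s *\<^sub>R \<theta> + y)))"
    using AE_integrable_fst[OF int] integrable_fst[OF int] by auto
  show "(LBINT x. f x) = (\<integral>y. (LBINT s. f (s *\<^sub>R \<theta> + y)) \<partial>hyp_borel \<theta>)"
    unfolding integral_fst[OF int]
    by (subst lborel_eq_distr_lines[OF \<theta>], subst integral_distr) (auto simp: split_beta' comp_def)
qed

lemma AE_lborel_lines:
  fixes \<theta> :: "'a::euclidean_space"
  assumes \<theta>: "norm \<theta> = 1" and P: "AE x in lborel. P x"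
  shows "AE y in hyp_borel \<theta>. AE s in lborel. P (s *\<^sub>R \<theta> + y)"
proof -
  interpret S: sigma_finite_measure "hyp_borel \<theta>" by (rule sigma_finite_hyp_borel)
  interpret pair_sigma_finite "hyp_borel \<theta>" "lborel :: real measure" ..
  have "AE x in distr (hyp_borel \<theta> \<Otimes>\<^sub>M lborel) borel (\<lambda>(y, s). s *\<^sub>R \<theta> + y). P x"
    using P by (subst lborel_eq_distr_lines[OF \<theta>, symmetric])
  moreover have "(\<lambda>(y, s). s *\<^sub>R \<theta> + y) \<in> measurable (hyp_borel \<theta> \<Otimes>\<^sub>M lborel) borel"
    by (simp add: split_beta')
  ultimately have "AE z in hyp_borel \<theta> \<Otimes>\<^sub>M lborel. P (case z of (y, s) \<Rightarrow> s *\<^sub>R \<theta> + y)"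
    by (rule AE_distrD[rotated])
  from AE_pair[OF this] show ?thesis by simp
qed


text \<open>This and the next lemma translate between null sets of the completed hyperplane measure, in which
  traces are defined, and statements about almost every line.\<close>

lemma AE_not_null_hyp_lebesgue:
  assumes "N \<in> null_sets (hyp_lebesgue \<theta>)"
  shows "AE y in hyp_borel \<theta>. y \<notin> N"
proof -
  let ?P = "\<Pi>\<^sub>M b\<in>hyp_basis \<theta>. (lborel :: real measure)"
  let ?R = "restrict_space borel (hyp \<theta>)"
  have m: "hyp_sum \<theta> \<in> measurable ?P ?R"
    by (intro measurable_restrict_space2) (auto simp: hyp_sum_in_hyp)
  obtain N' where N': "N' \<in> null_sets (distr ?P ?R (hyp_sum \<theta>))" "N \<subseteq> N'"
    using assms unfolding hyp_lebesgue_eq null_sets_completion_iff2 by auto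
  then have "N' \<in> sets ?R" by auto
  then have [measurable]: "N' \<in> sets borel" by (simp add: sets_restrict_space_iff)
  have "hyp_sum \<theta> -` N' \<inter> space ?P \<in> null_sets ?P"
    using N' m by (simp add: null_sets_distr_iff)
  then have "N' \<in> null_sets (hyp_borel \<theta>)"
    unfolding hyp_borel_def by (simp add: null_sets_distr_iff)
  then have "AE y in hyp_borel \<theta>. y \<notin> N'" by (rule AE_not_in)
  then show ?thesis using N' by auto
qed

lemma null_hyp_lebesgue_if_AE:
  assumes "AE y in hyp_borel \<theta>. P y"
  shows "{y \<in> hyp \<theta>. \<not> P y} \<in> null_sets (hyp_lebesgue \<theta>)"
proof -
  let ?P = "\<Pi>\<^sub>M b\<in>hyp_basis \<theta>. (lborel :: real measure)"
  let ?R = "restrict_space borel (hyp \<theta>)"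
  have m: "hyp_sum \<theta> \<in> measurable ?P ?R"
    by (intro measurable_restrict_space2) (auto simp: hyp_sum_in_hyp)
  obtain N where N: "{y \<in> space (hyp_borel \<theta>). \<not> P y} \<subseteq> N" "N \<in> null_sets (hyp_borel \<theta>)"
    using AE_E[OF assms] by (metis null_setsI)
  then have [measurable]: "N \<in> sets borel" by (auto simp: null_sets_def)
  have "hyp_sum \<theta> -` N \<inter> space ?P \<in> null_sets ?P"
    using N(2) unfolding hyp_borel_def by (simp add: null_sets_distr_iff)
  also have "hyp_sum \<theta> -` N = hyp_sum \<theta> -` (N \<inter> hyp \<theta>)" by (auto simp: hyp_sum_in_hyp)
  finally have "N \<inter> hyp \<theta> \<in> null_sets (distr ?P ?R (hyp_sum \<theta>))"
    using m by (subst null_sets_distr_iff) (auto simp: sets_restrict_space_iff)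
  then show ?thesis
    unfolding hyp_lebesgue_eq null_sets_completion_iff2
    using N(1) by (auto intro!: bexI[where x = "N \<inter> hyp \<theta>"])
qed

section \<open>Smooth bump functions\<close>

lemma Ck_Suc_imp: "Ck (Suc n) f \<Longrightarrow> Ck n f"
proof (induction n arbitrary: f)
  case 0
  then show ?case by (auto intro: differentiable_imp_continuous_on)
next
  case (Suc n)
  then show ?case by auto
qed

lemma Ck_SucI:
  fixes f :: "'a::euclidean_space \<Rightarrow> real"
  assumes "\<And>x. (f has_derivative f' x) (at x)" and "\<And>b. b \<in> Basis \<Longrightarrow> Ck n (\<lambda>x. f' x b)"
  shows "Ck (Suc n) f"
proof -
  have "frechet_derivative f (at x) = f' x" for x
    using frechet_derivative_at[OF assms(1)] by simp
  with assms show ?thesis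
    by (auto simp: differentiable_on_def differentiable_def)
qed

lemma Ck_SucD:
  fixes f :: "'a::euclidean_space \<Rightarrow> real"
  assumes "Ck (Suc n) f"
  shows "(f has_derivative frechet_derivative f (at x)) (at x)"
    and "b \<in> Basis \<Longrightarrow> Ck n (\<lambda>x. frechet_derivative f (at x) b)"
  using assms frechet_derivative_works by (auto simp: differentiable_on_def)

lemma Ck_const: "Ck n (\<lambda>x::'a::euclidean_space. c)"
proof (induction n arbitrary: c)
  case (Suc n)
  show ?case by (rule Ck_SucI[where f' = "\<lambda>x h. 0"]) (auto intro: Suc)
qed simp

lemma Ck_add:
  fixes f g :: "'a::euclidean_space \<Rightarrow> real"
  shows "Ck n f \<Longrightarrow> Ck n g \<Longrightarrow> Ck n (\<lambda>x. f x + g x)"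
proof (induction n arbitrary: f g)
  case 0
  then show ?case by (auto intro: continuous_on_add)
next
  case (Suc n)
  note f = Ck_SucD[OF Suc.prems(1)] and g = Ck_SucD[OF Suc.prems(2)]
  show ?case
    by (rule Ck_SucI[OF has_derivative_add[OF f(1) g(1)]]) (intro Suc.IH f(2) g(2))
qed

lemma Ck_mult:
  fixes f g :: "'a::euclidean_space \<Rightarrow> real"
  shows "Ck n f \<Longrightarrow> Ck n g \<Longrightarrow> Ck n (\<lambda>x. f x * g x)"
proof (induction n arbitrary: f g)
  case 0
  then show ?case by (auto intro: continuous_on_mult)
next
  case (Suc n)
  note f = Ck_SucD[OF Suc.prems(1)] and g = Ck_SucD[OF Suc.prems(2)]
  show ?case
    by (rule Ck_SucI[OF has_derivative_mult[OF f(1) g(1)]])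
      (intro Ck_add Suc.IH f(2) g(2) Ck_Suc_imp[OF Suc.prems(1)] Ck_Suc_imp[OF Suc.prems(2)])
qed

lemma Ck_prod:
  fixes f :: "'i \<Rightarrow> 'a::euclidean_space \<Rightarrow> real"
  assumes "\<And>i. i \<in> I \<Longrightarrow> Ck n (f i)"
  shows "Ck n (\<lambda>x. \<Prod>i\<in>I. f i x)"
  using assms
proof (induction I rule: infinite_finite_induct)
  case (insert i I)
  have "Ck n (\<lambda>x. f i x * (\<Prod>i\<in>I. f i x))"
    by (intro Ck_mult insert) (auto intro: insert)
  then show ?case using insert.hyps by simp
qed (simp_all add: Ck_const)

lemma Ck_SucI_real:
  fixes f :: "real \<Rightarrow> real"
  assumes "\<And>x. (f has_real_derivative f' x) (at x)" and "Ck n f'"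
  shows "Ck (Suc n) f"
  by (rule Ck_SucI[OF assms(1)[unfolded has_field_derivative_def]]) (use assms(2) in simp)

text \<open>Smooth functions of several variables are built below from functions of one variable composed with
  linear functionals; this keeps all partial derivatives within the same class.\<close>

lemma Ck_compose_inner:
  fixes f :: "real \<Rightarrow> real" and e :: "'a::euclidean_space"
  shows "Ck n f \<Longrightarrow> Ck n (\<lambda>x. f (x \<bullet> e + c))"
proof (induction n arbitrary: f)
  case 0
  then show ?case by (auto intro!: continuous_on_compose2[of UNIV f] continuous_intros)
next
  case (Suc n)
  let ?f' = "\<lambda>t. frechet_derivative f (at t) 1"
  note f = Ck_SucD[OF Suc.prems]
  have "frechet_derivative f (at t) = (\<lambda>h. h * ?f' t)" for t
  proof -
    have "linear (frechet_derivative f (at t))"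
      using has_derivative_linear[OF f(1)] .
    have "frechet_derivative f (at t) h = h * ?f' t" for h
      using linear_scale[OF \<open>linear (frechet_derivative f (at t))\<close>, of h 1] by (metis mult.right_neutral real_scaleR_def)
    then show ?thesis by (rule ext)
  qed
  then have f': "(f has_derivative (\<lambda>h. h * ?f' t)) (at t)" for t
    using f(1)[of t] by simp
  have "((\<lambda>x. f (x \<bullet> e + c)) has_derivative (\<lambda>h. (h \<bullet> e) * ?f' (x \<bullet> e + c))) (at x)" for x
    by (rule has_derivative_compose[OF _ f']) (auto intro!: derivative_eq_intros)
  then show ?case
    by (rule Ck_SucI) (intro Ck_mult Ck_const Suc.IH f(2); simp)
qed

text \<open>For \<open>p = 1\<close> this is the classical flat function \<open>exp (- 1 / t)\<close>.  Admitting polynomials in \<open>1 / t\<close>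
  as factors makes the family closed under differentiation, hence smooth.\<close>

definition bump_part :: "real poly \<Rightarrow> real \<Rightarrow> real" where
  "bump_part p t = (if t \<le> 0 then 0 else poly p (inverse t) * exp (- inverse t))"

lemma tendsto_poly_exp_neg: "((\<lambda>x::real. poly p x * exp (- x)) \<longlongrightarrow> 0) at_top"
proof -
  have "((\<lambda>x::real. \<Sum>i\<le>degree p. coeff p i * (x ^ i / exp x)) \<longlongrightarrow> 0) at_top"
    by (rule tendsto_null_sum, rule tendsto_mult_right_zero, rule tendsto_power_div_exp_0)
  also have "(\<lambda>x::real. \<Sum>i\<le>degree p. coeff p i * (x ^ i / exp x)) = (\<lambda>x. poly p x * exp (- x))"
    by (simp add: poly_altdef sum_distrib_right sum_divide_distrib exp_minus field_simps)
  finally show ?thesis .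
qed

text \<open>Away from \<open>0\<close> this is the chain rule; at \<open>0\<close> the difference quotient is \<open>x * poly p x * exp (- x)\<close>
  with \<open>x = 1 / h\<close>, and the exponential wins.\<close>

lemma bump_part_derivative:
  "(bump_part p has_real_derivative bump_part ([:0, 0, 1:] * (p - pderiv p)) t) (at t)"
proof -
  consider "t > 0" | "t < 0" | "t = 0" by linarith
  then show ?thesis
  proof cases
    case 1
    have inv: "(inverse has_real_derivative - (inverse t * inverse t)) (at t)"
      using DERIV_inverse[of t UNIV] 1 by (simp add: power2_eq_square inverse_mult_distrib)
    have "((\<lambda>t. exp (- inverse t)) has_real_derivative exp (- inverse t) * (inverse t * inverse t)) (at t)"
      using DERIV_chain2[OF DERIV_exp DERIV_minus[OF inv]] by simp
    from DERIV_mult[OF DERIV_chain2[OF poly_DERIV[of p] inv] this]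
    have "((\<lambda>t. poly p (inverse t) * exp (- inverse t)) has_real_derivative
        bump_part ([:0, 0, 1:] * (p - pderiv p)) t) (at t)"
      using 1 by (simp add: bump_part_def algebra_simps)
    then show ?thesis
      by (rule has_field_derivative_transform_within_open[of _ _ _ "{0<..}"]) (use 1 in \<open>auto simp: bump_part_def\<close>)
  next
    case 2
    have "((\<lambda>t. 0) has_real_derivative bump_part ([:0, 0, 1:] * (p - pderiv p)) t) (at t)"
      using 2 by (auto simp: bump_part_def)
    then show ?thesis
      by (rule has_field_derivative_transform_within_open[of _ _ _ "{..<0}"]) (use 2 in \<open>auto simp: bump_part_def\<close>)
  next
    case 3
    have "((\<lambda>h. bump_part p h / h) \<longlongrightarrow> 0) (at 0)"
    proof (rule filterlim_split_at)
      have "((\<lambda>h. 0) \<longlongrightarrow> (0::real)) (at_left 0)" by simp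
      then show "((\<lambda>h. bump_part p h / h) \<longlongrightarrow> 0) (at_left 0)"
        by (rule Lim_transform_eventually) (auto simp: eventually_at_filter bump_part_def)
      have "((\<lambda>h::real. poly ([:0, 1:] * p) (inverse h) * exp (- inverse h)) \<longlongrightarrow> 0) (at_right 0)"
        by (rule filterlim_compose[OF tendsto_poly_exp_neg filterlim_inverse_at_top_right])
      then show "((\<lambda>h. bump_part p h / h) \<longlongrightarrow> 0) (at_right 0)"
        by (rule Lim_transform_eventually) (auto simp: eventually_at_filter bump_part_def divide_inverse)
    qed
    then show ?thesis
      by (simp add: 3 DERIV_def bump_part_def)
  qed
qed

lemma Ck_bump_part: "Ck n (bump_part p)"
proof (induction n arbitrary: p)
  case 0
  have "isCont (bump_part p) t" for t
    by (rule DERIV_isCont[OF bump_part_derivative])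
  then show ?case by (simp add: continuous_on_eq_continuous_at)
next
  case (Suc n)
  show ?case by (rule Ck_SucI_real[OF bump_part_derivative Suc])
qed

text \<open>Positive exactly inside \<open>]a,b[\<close> (for \<open>k > 0\<close>), with values in \<open>[0,1]\<close>, and converging to the
  indicator of that interval as \<open>k\<close> grows.\<close>

definition bump :: "nat \<Rightarrow> real \<Rightarrow> real \<Rightarrow> real \<Rightarrow> real" where
  "bump k a b t = bump_part 1 (real k * (t - a)) * bump_part 1 (real k * (b - t))"

lemma Ck_bump: "Ck n (bump k a b)"
proof -
  have "Ck n (\<lambda>t. bump_part 1 (t \<bullet> real k + (- real k * a)) * bump_part 1 (t \<bullet> (- real k) + real k * b))"
    by (intro Ck_mult Ck_compose_inner Ck_bump_part)
  then show ?thesis by (simp add: bump_def[abs_def] algebra_simps)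
qed

lemma bump_part_1_bounds: "0 \<le> bump_part 1 t" "bump_part 1 t \<le> 1"
  by (auto simp: bump_part_def)

lemma bump_bounds: "0 \<le> bump k a b t" "bump k a b t \<le> 1"
  unfolding bump_def using bump_part_1_bounds by (auto intro: mult_le_one)

lemma bump_eq_0: "\<not> (a < t \<and> t < b) \<Longrightarrow> bump k a b t = 0"
  by (auto simp: bump_def bump_part_def mult_le_0_iff not_less)

lemma bump_tendsto: "(\<lambda>k. bump k a b t) \<longlonglongrightarrow> indicator {a<..<b} t"
proof -
  have lim: "(\<lambda>k. bump_part 1 (real k * x)) \<longlonglongrightarrow> (if x > 0 then 1 else 0)" for x
  proof (cases "x > 0")
    case True
    have "(\<lambda>k. exp (- (inverse (real k) * inverse x))) \<longlonglongrightarrow> exp (- (0 * inverse x))"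
      by (intro tendsto_exp tendsto_minus tendsto_mult lim_inverse_n tendsto_const)
    then have "(\<lambda>k. exp (- inverse (real k * x))) \<longlonglongrightarrow> 1" by simp
    moreover have "\<forall>\<^sub>F k in sequentially. exp (- inverse (real k * x)) = bump_part 1 (real k * x)"
      using eventually_gt_at_top[of 0] by eventually_elim (use True in \<open>auto simp: bump_part_def mult_le_0_iff\<close>)
    ultimately show ?thesis using True by (auto intro: Lim_transform_eventually)
  next
    case False
    then show ?thesis by (simp add: bump_part_def mult_le_0_iff not_less)
  qed
  have "(\<lambda>k. bump k a b t) \<longlonglongrightarrow> (if t - a > 0 then 1 else 0) * (if b - t > 0 then 1 else (0::real))"
    unfolding bump_def by (intro tendsto_mult lim)
  also have "(if t - a > 0 then 1 else 0) * (if b - t > 0 then 1 else (0::real)) = indicator {a<..<b} t"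
    by (simp add: indicator_def)
  finally show ?thesis .
qed

lemma continuous_on_bump: "continuous_on A (bump k a b)"
  using Ck_bump[of 0 k a b] by (auto intro: continuous_on_subset)

text \<open>The primitive of the bump.  Integration starts to the left of \<open>a\<close> so that a single formula covers a
  neighbourhood of each point where the bump is not locally zero.\<close>

definition bump_int :: "nat \<Rightarrow> real \<Rightarrow> real \<Rightarrow> real \<Rightarrow> real" where
  "bump_int k a b t = integral {a - 1..t} (bump k a b)"

lemma bump_int_eq_0: "t \<le> a \<Longrightarrow> bump_int k a b t = 0"
  unfolding bump_int_def by (subst integral_cong[of _ _ "\<lambda>_. 0"]) (auto simp: bump_eq_0)

lemma bump_int_derivative: "(bump_int k a b has_real_derivative bump k a b t) (at t)"
proof (cases "t < a")
  case True
  have "((\<lambda>t. 0) has_real_derivative bump k a b t) (at t)"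
    using True by (simp add: bump_eq_0)
  then show ?thesis
    by (rule has_field_derivative_transform_within_open[of _ _ _ "{..<a}"]) (use True in \<open>auto simp: bump_int_eq_0\<close>)
next
  case False
  have "((\<lambda>u. integral {a - 1..u} (bump k a b)) has_real_derivative bump k a b t) (at t within {a - 1..t + 1})"
    by (rule integral_has_real_derivative) (use False in \<open>auto intro: continuous_on_bump\<close>)
  moreover have "at t within {a - 1..t + 1} = at t"
    using False by (intro at_within_interior) auto
  ultimately show ?thesis by (simp add: bump_int_def[abs_def])
qed

lemma Ck_bump_int: "Ck n (bump_int k a b)"
  by (rule Ck_Suc_imp, rule Ck_SucI_real[OF bump_int_derivative Ck_bump])

lemma bump_int_LBINT: "bump_int k a b t = (LBINT s. indicator {a - 1..t} s * bump k a b s)"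
proof -
  have "set_integrable lborel {a - 1..t} (bump k a b)"
    by (rule borel_integrable_atLeastAtMost') (rule continuous_on_bump)
  from set_borel_integral_eq_integral(2)[OF this] show ?thesis
    by (simp add: bump_int_def set_lebesgue_integral_def)
qed

lemma bump_int_const: "b \<le> t \<Longrightarrow> bump_int k a b t = bump_int k a b b"
  unfolding bump_int_LBINT by (intro Bochner_Integration.integral_cong) (auto simp: indicator_def bump_eq_0)

lemma bump_int_bounds:
  assumes "a \<le> b"
  shows "0 \<le> bump_int k a b t" "bump_int k a b t \<le> b - a"
proof -
  show "0 \<le> bump_int k a b t"
    unfolding bump_int_LBINT by (intro Bochner_Integration.integral_nonneg) (auto simp: bump_bounds)
  have "bump_int k a b t \<le> (LBINT s. indicator {a<..<b} s)"
    unfolding bump_int_LBINT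
  proof (rule integral_mono)
    show "integrable lborel (\<lambda>s. indicator {a - 1..t} s * bump k a b s)"
      using borel_integrable_atLeastAtMost'[OF continuous_on_bump] by (simp add: set_integrable_def)
    show "integrable lborel (indicator {a<..<b} :: real \<Rightarrow> real)"
      using assms by (intro integrable_real_indicator) auto
    show "indicator {a - 1..t} s * bump k a b s \<le> indicator {a<..<b} s" for s
      using bump_bounds[of k a b s] bump_eq_0[of a s b k] by (auto simp: indicator_def)
  qed
  then show "bump_int k a b t \<le> b - a" using assms by simp
qed

text \<open>The limit of \<open>bump_int\<close>: the primitive of the indicator of \<open>]a,b[\<close>.\<close>

definition ramp :: "real \<Rightarrow> real \<Rightarrow> real \<Rightarrow> real" where
  "ramp a b t = max 0 (min (t - a) (b - a))"

lemma ramp_eq_LBINT: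
  assumes "a \<le> b"
  shows "ramp a b t = (LBINT s. indicator {a - 1..t} s * indicator {a<..<b} s)"
proof -
  have "(LBINT s. indicator {a - 1..t} s * indicator {a<..<b} s) =
      measure lborel ({a - 1..t} \<inter> {a<..<b})"
    by (simp flip: indicator_inter_arith)
  also have "\<dots> = ramp a b t"
  proof -
    consider "t \<le> a" | "a < t" "t < b" | "b \<le> t" by linarith
    then show ?thesis
    proof cases
      case 1
      then have "{a - 1..t} \<inter> {a<..<b} = {}" by auto
      then show ?thesis using 1 by (simp only:) (simp add: ramp_def)
    next
      case 2
      then have "{a - 1..t} \<inter> {a<..<b} = {a<..t}" by auto
      then show ?thesis using 2 by (simp only:) (simp add: ramp_def)
    next
      case 3
      then have "{a - 1..t} \<inter> {a<..<b} = {a<..<b}" by auto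
      then show ?thesis using 3 assms by (simp only:) (simp add: ramp_def)
    qed
  qed
  finally show ?thesis by simp
qed

lemma bump_int_tendsto:
  assumes "a \<le> b"
  shows "(\<lambda>k. bump_int k a b t) \<longlonglongrightarrow> ramp a b t"
  unfolding bump_int_LBINT ramp_eq_LBINT[OF assms]
proof (rule integral_dominated_convergence)
  show "integrable lborel (indicator {a<..<b} :: real \<Rightarrow> real)"
    using assms by (intro integrable_real_indicator) auto
  show "(\<lambda>s. indicator {a - 1..t} s * bump k a b s) \<in> borel_measurable lborel" for k
    using borel_measurable_continuous_onI[OF continuous_on_bump[of UNIV k a b]] by simp
  show "AE s in lborel. (\<lambda>k. indicator {a - 1..t} s * bump k a b s)
      \<longlonglongrightarrow> indicator {a - 1..t} s * indicator {a<..<b} s"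
    by (intro AE_I2 tendsto_mult tendsto_const bump_tendsto)
  show "AE s in lborel. norm (indicator {a - 1..t} s * bump k a b s) \<le> indicator {a<..<b} s" for k
  proof (rule AE_I2)
    fix s show "norm (indicator {a - 1..t} s * bump k a b s) \<le> indicator {a<..<b} s"
      using bump_bounds[of k a b s] bump_eq_0[of a s b k] by (auto simp: indicator_def)
  qed
qed simp

section \<open>The weak derivative tested on tubes\<close>

text \<open>The gradient is given by a definite description; the vector of partial derivatives meets the
  description, and it is the only vector to do so by uniqueness of the derivative.\<close>

lemma inner_grad:
  fixes \<phi> :: "'a::euclidean_space \<Rightarrow> real"
  assumes "(\<phi> has_derivative D) (at x)"
  shows "\<theta> \<bullet> grad \<phi> x = D \<theta>"
proof -
  have lin: "linear D" using assms by (rule has_derivative_linear)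
  define d where "d = (\<Sum>i\<in>Basis. D i *\<^sub>R i)"
  have D: "D h = h \<bullet> d" for h
  proof -
    have "D h = D (\<Sum>i\<in>Basis. (h \<bullet> i) *\<^sub>R i)" by (simp add: euclidean_representation)
    also have "\<dots> = (\<Sum>i\<in>Basis. (h \<bullet> i) * D i)"
      using lin by (simp add: linear_sum linear_scale)
    also have "\<dots> = h \<bullet> d" by (simp add: d_def inner_sum_right mult.commute)
    finally show ?thesis .
  qed
  have "grad \<phi> x = d"
    unfolding grad_def
  proof (rule the_equality)
    have "D = (\<lambda>h. h \<bullet> d)" using D by (rule ext)
    then show g: "GDERIV \<phi> x :> d" using assms by (simp add: gderiv_def)
    fix d' assume "GDERIV \<phi> x :> d'"
    then have "(\<lambda>h. h \<bullet> d') = D"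
      using assms unfolding gderiv_def by (rule has_derivative_unique)
    then have "h \<bullet> d' = h \<bullet> d" for h using D by metis
    then show "d' = d" using vector_eq_ldot[of d' d] by simp
  qed
  then show ?thesis by (simp add: D)
qed

lemma proj_in_hyp: "norm \<theta> = 1 \<Longrightarrow> proj \<theta> x \<in> hyp \<theta>"
  by (simp add: proj_def hyp_def inner_diff_left norm_eq_1)

lemma proj_line: "norm \<theta> = 1 \<Longrightarrow> y \<in> hyp \<theta> \<Longrightarrow> proj \<theta> (s *\<^sub>R \<theta> + y) = y"
  by (simp add: proj_def hyp_def inner_add_left norm_eq_1)

lemma inner_line: "norm \<theta> = 1 \<Longrightarrow> y \<in> hyp \<theta> \<Longrightarrow> (s *\<^sub>R \<theta> + y) \<bullet> \<theta> = s"
  by (simp add: hyp_def inner_add_left norm_eq_1)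

lemma line_decomp: "(x \<bullet> \<theta>) *\<^sub>R \<theta> + proj \<theta> x = x"
  by (simp add: proj_def)

lemma proj_inner: "proj \<theta> x \<bullet> i = x \<bullet> proj \<theta> i"
  by (simp add: proj_def inner_diff_left inner_diff_right inner_commute)

lemma proj_shift: "norm \<theta> = 1 \<Longrightarrow> proj \<theta> (x + t *\<^sub>R \<theta>) = proj \<theta> x"
  by (simp add: proj_def inner_add_left norm_eq_1 algebra_simps)

lemma continuous_on_proj [continuous_intros]: "continuous_on A (proj \<theta>)"
  unfolding proj_def by (intro continuous_intros)

lemma borel_measurable_proj [measurable]: "proj \<theta> \<in> borel_measurable borel"
  by (intro borel_measurable_continuous_onI continuous_on_proj)

definition cutoff :: "nat \<Rightarrow> 'a::euclidean_space \<Rightarrow> 'a \<Rightarrow> 'a \<Rightarrow> real" where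
  "cutoff k l r y = (\<Prod>i\<in>Basis. bump k (l \<bullet> i) (r \<bullet> i) (y \<bullet> i))"

lemma cutoff_bounds: "0 \<le> cutoff k l r y" "cutoff k l r y \<le> 1"
  unfolding cutoff_def by (auto intro!: prod_nonneg prod_le_1 simp: bump_bounds)

lemma cutoff_eq_0: "y \<notin> box l r \<Longrightarrow> cutoff k l r y = 0"
  unfolding cutoff_def mem_box by (auto simp: prod_zero_iff intro: bump_eq_0)

lemma cutoff_tendsto: "(\<lambda>k. cutoff k l r y) \<longlonglongrightarrow> indicator (box l r) y"
proof -
  have "(\<lambda>k. cutoff k l r y) \<longlonglongrightarrow> (\<Prod>i\<in>Basis. indicator {l \<bullet> i<..<r \<bullet> i} (y \<bullet> i))"
    unfolding cutoff_def by (intro tendsto_prod bump_tendsto)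
  also have "(\<Prod>i\<in>Basis. indicator {l \<bullet> i<..<r \<bullet> i} (y \<bullet> i)) = (indicator (box l r) y :: real)"
    by (cases "y \<in> box l r") (force simp: mem_box indicator_def)+
  finally show ?thesis .
qed

lemma Ck_cutoff_proj: "Ck n (\<lambda>x. cutoff k l r (proj \<theta> x))"
proof -
  have "Ck n (\<lambda>x. \<Prod>i\<in>Basis. bump k (l \<bullet> i) (r \<bullet> i) (x \<bullet> proj \<theta> i + 0))"
    by (intro Ck_prod Ck_compose_inner Ck_bump)
  then show ?thesis by (simp add: cutoff_def proj_inner)
qed

text \<open>Each indicator carries the length of the other interval as its weight, so the integral of \<open>slope\<close> is
  zero, and its primitive \<open>hat\<close> vanishes to the right of both intervals as well as to the left.\<close>

definition slope :: "real \<Rightarrow> real \<Rightarrow> real \<Rightarrow> real \<Rightarrow> real \<Rightarrow> real" where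
  "slope p q p' q' t = (q' - p') * indicator {p<..<q} t - (q - p) * indicator {p'<..<q'} t"

definition hat :: "real \<Rightarrow> real \<Rightarrow> real \<Rightarrow> real \<Rightarrow> real \<Rightarrow> real" where
  "hat p q p' q' t = (q' - p') * ramp p q t - (q - p) * ramp p' q' t"

text \<open>The smooth counterparts of \<open>slope\<close> and \<open>hat\<close>.  The weights are the masses of the bumps rather than
  the lengths of the intervals: the support of \<open>smooth_hat\<close> is then compact for every \<open>k\<close>, not only in
  the limit.\<close>

definition smooth_slope :: "nat \<Rightarrow> real \<Rightarrow> real \<Rightarrow> real \<Rightarrow> real \<Rightarrow> real \<Rightarrow> real" where
  "smooth_slope k p q p' q' t =
     bump_int k p' q' q' * bump k p q t - bump_int k p q q * bump k p' q' t"

definition smooth_hat :: "nat \<Rightarrow> real \<Rightarrow> real \<Rightarrow> real \<Rightarrow> real \<Rightarrow> real \<Rightarrow> real" where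
  "smooth_hat k p q p' q' t =
     bump_int k p' q' q' * bump_int k p q t - bump_int k p q q * bump_int k p' q' t"

lemma smooth_hat_derivative:
  "(smooth_hat k p q p' q' has_real_derivative smooth_slope k p q p' q' t) (at t)"
  unfolding smooth_hat_def[abs_def] smooth_slope_def
  by (intro DERIV_diff DERIV_cmult bump_int_derivative)

lemma Ck_smooth_hat: "Ck n (smooth_hat k p q p' q')"
proof -
  have "Ck n (\<lambda>t. bump_int k p' q' q' * bump_int k p q t + (- bump_int k p q q) * bump_int k p' q' t)"
    by (intro Ck_add Ck_mult Ck_const Ck_bump_int)
  then show ?thesis by (simp add: smooth_hat_def[abs_def])
qed

lemma smooth_hat_eq_0:
  assumes "a \<le> p" "p \<le> q" "q \<le> b" "a \<le> p'" "p' \<le> q'" "q' \<le> b" "t \<notin> {a..b}"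
  shows "smooth_hat k p q p' q' t = 0"
proof (cases "t < a")
  case True
  then show ?thesis using assms by (simp add: smooth_hat_def bump_int_eq_0)
next
  case False
  then show ?thesis using assms by (simp add: smooth_hat_def bump_int_const[of q t] bump_int_const[of q' t])
qed

lemma abs_diff_mult_le:
  fixes m m' x x' M M' X X' :: real
  assumes "0 \<le> m" "m \<le> M" "0 \<le> m'" "m' \<le> M'" "0 \<le> x" "x \<le> X" "0 \<le> x'" "x' \<le> X'"
  shows "\<bar>m * x - m' * x'\<bar> \<le> M * X + M' * X'"
proof -
  have "m * x \<le> M * X" "m' * x' \<le> M' * X'" "0 \<le> m * x" "0 \<le> m' * x'"
    using assms by (auto intro: mult_mono)
  then show ?thesis by linarith
qed

lemma smooth_slope_hat_bounds:
  assumes "p \<le> q" "p' \<le> q'"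
  shows "\<bar>smooth_slope k p q p' q' t\<bar> \<le> (q' - p') + (q - p)"
    and "\<bar>smooth_hat k p q p' q' t\<bar> \<le> 2 * (q - p) * (q' - p')"
proof -
  have "\<bar>smooth_slope k p q p' q' t\<bar> \<le> (q' - p') * 1 + (q - p) * 1"
    unfolding smooth_slope_def
    by (intro abs_diff_mult_le bump_int_bounds bump_bounds assms)
  then show "\<bar>smooth_slope k p q p' q' t\<bar> \<le> (q' - p') + (q - p)" by simp
  have "\<bar>smooth_hat k p q p' q' t\<bar> \<le> (q' - p') * (q - p) + (q - p) * (q' - p')"
    unfolding smooth_hat_def by (intro abs_diff_mult_le bump_int_bounds assms)
  then show "\<bar>smooth_hat k p q p' q' t\<bar> \<le> 2 * (q - p) * (q' - p')" by (simp add: algebra_simps)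
qed

lemma smooth_slope_hat_tendsto:
  assumes "p \<le> q" "p' \<le> q'"
  shows "(\<lambda>k. smooth_slope k p q p' q' t) \<longlonglongrightarrow> slope p q p' q' t"
    and "(\<lambda>k. smooth_hat k p q p' q' t) \<longlonglongrightarrow> hat p q p' q' t"
proof -
  have m: "(\<lambda>k. bump_int k p q q) \<longlonglongrightarrow> q - p" "(\<lambda>k. bump_int k p' q' q') \<longlonglongrightarrow> q' - p'"
    using bump_int_tendsto[OF assms(1), of q] bump_int_tendsto[OF assms(2), of q'] assms
    by (simp_all add: ramp_def)
  show "(\<lambda>k. smooth_slope k p q p' q' t) \<longlonglongrightarrow> slope p q p' q' t"
    unfolding smooth_slope_def slope_def by (intro tendsto_diff tendsto_mult m bump_tendsto)
  show "(\<lambda>k. smooth_hat k p q p' q' t) \<longlonglongrightarrow> hat p q p' q' t"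
    unfolding smooth_hat_def hat_def by (intro tendsto_diff tendsto_mult m bump_int_tendsto assms)
qed

lemma compact_tube:
  fixes \<theta> :: "'a::euclidean_space"
  shows "compact {x. proj \<theta> x \<in> cbox l r \<and> x \<bullet> \<theta> \<in> {a..b}}" (is "compact ?T")
proof -
  have "?T = proj \<theta> -` cbox l r \<inter> (\<lambda>x. x \<bullet> \<theta>) -` {a..b}" by auto
  moreover have "closed (proj \<theta> -` cbox l r)"
    using continuous_on_proj[of UNIV \<theta>] by (intro closed_vimage) auto
  moreover have "closed ((\<lambda>x. x \<bullet> \<theta>) -` {a..b})"
    by (intro closed_vimage continuous_intros)
  ultimately have "closed ?T" by auto
  obtain B where B: "\<And>y. y \<in> cbox l r \<Longrightarrow> norm y \<le> B"
    using bounded_cbox[of l r] by (auto simp: bounded_iff)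
  have "norm x \<le> max \<bar>a\<bar> \<bar>b\<bar> * norm \<theta> + B" if "x \<in> ?T" for x
  proof -
    have "norm x = norm ((x \<bullet> \<theta>) *\<^sub>R \<theta> + proj \<theta> x)" by (simp add: line_decomp)
    also have "\<dots> \<le> \<bar>x \<bullet> \<theta>\<bar> * norm \<theta> + norm (proj \<theta> x)"
      by (rule order_trans[OF norm_triangle_ineq]) simp
    also have "\<dots> \<le> max \<bar>a\<bar> \<bar>b\<bar> * norm \<theta> + B"
      using that B by (intro add_mono mult_right_mono) auto
    finally show ?thesis .
  qed
  then have "bounded ?T" by (auto simp: bounded_iff)
  with \<open>closed ?T\<close> show ?thesis by (simp add: compact_eq_bounded_closed)
qed

text \<open>The factor \<open>cutoff\<close> depends only on \<open>proj \<theta> x\<close> and is constant in the direction \<open>\<theta>\<close>.  Hence the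
  derivative in that direction acts on \<open>smooth_hat\<close> alone.\<close>

lemma tube_test_fun:
  fixes \<theta> :: "'a::euclidean_space" and k :: nat
  assumes \<theta>: "norm \<theta> = 1"
    and ord: "a \<le> p" "p \<le> q" "q \<le> b" "a \<le> p'" "p' \<le> q'" "q' \<le> b"
    and tube: "{x. proj \<theta> x \<in> cbox l r \<and> x \<bullet> \<theta> \<in> {a..b}} \<subseteq> \<Omega>"
  defines "\<phi> \<equiv> \<lambda>x. cutoff k l r (proj \<theta> x) * smooth_hat k p q p' q' (x \<bullet> \<theta>)"
  shows "\<phi> \<in> test_fun \<Omega>"
    and "\<theta> \<bullet> grad \<phi> x = cutoff k l r (proj \<theta> x) * smooth_slope k p q p' q' (x \<bullet> \<theta>)"
proof -
  let ?T = "{x. proj \<theta> x \<in> cbox l r \<and> x \<bullet> \<theta> \<in> {a..b}}"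
  have "Ck n (\<lambda>x. cutoff k l r (proj \<theta> x) * smooth_hat k p q p' q' (x \<bullet> \<theta> + 0))" for n
    by (intro Ck_mult Ck_cutoff_proj Ck_compose_inner Ck_smooth_hat)
  then have Ck: "Ck n \<phi>" for n by (simp add: \<phi>_def)
  have "x \<in> ?T" if "\<phi> x \<noteq> 0" for x
  proof -
    have "proj \<theta> x \<in> box l r" using that cutoff_eq_0 by (auto simp: \<phi>_def)
    then have "proj \<theta> x \<in> cbox l r" using box_subset_cbox by blast
    moreover have "x \<bullet> \<theta> \<in> {a..b}" using that smooth_hat_eq_0[OF ord] unfolding \<phi>_def by (metis mult_zero_right)
    ultimately show ?thesis by simp
  qed
  then have "closure {x. \<phi> x \<noteq> 0} \<subseteq> ?T"
    using compact_tube[of \<theta> l r a b] by (intro closure_minimal) (auto intro: compact_imp_closed)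
  moreover from this have "compact (closure {x. \<phi> x \<noteq> 0})"
    using compact_tube[of \<theta> l r a b] by (meson bounded_subset closed_closure compact_eq_bounded_closed)
  ultimately show "\<phi> \<in> test_fun \<Omega>" using tube Ck by (auto simp: test_fun_def)
  have D: "(\<phi> has_derivative frechet_derivative \<phi> (at x)) (at x)"
    using Ck[of "Suc 0"] by (rule Ck_SucD)
  have line: "((\<lambda>t. x + t *\<^sub>R \<theta>) has_derivative (\<lambda>t. t *\<^sub>R \<theta>)) (at 0)"
    by (auto intro!: derivative_eq_intros)
  have "((\<lambda>t. \<phi> (x + t *\<^sub>R \<theta>)) has_derivative (\<lambda>t. frechet_derivative \<phi> (at x) (t *\<^sub>R \<theta>))) (at 0)"
    by (rule has_derivative_compose[OF line]) (use D in simp)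
  moreover have "((\<lambda>t. \<phi> (x + t *\<^sub>R \<theta>)) has_derivative
      (\<lambda>t. t * (cutoff k l r (proj \<theta> x) * smooth_slope k p q p' q' (x \<bullet> \<theta>)))) (at 0)"
  proof -
    have "\<phi> (x + t *\<^sub>R \<theta>) = cutoff k l r (proj \<theta> x) * smooth_hat k p q p' q' (x \<bullet> \<theta> + t)" for t
      using \<theta> by (simp add: \<phi>_def proj_shift inner_add_left norm_eq_1)
    moreover have "((\<lambda>t. cutoff k l r (proj \<theta> x) * smooth_hat k p q p' q' (x \<bullet> \<theta> + t)) has_real_derivative
        cutoff k l r (proj \<theta> x) * smooth_slope k p q p' q' (x \<bullet> \<theta> + 0)) (at 0)"
      using DERIV_shift[THEN iffD1, OF smooth_hat_derivative[of k p q p' q' "0 + x \<bullet> \<theta>"]]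
      by (intro DERIV_cmult) (simp add: add.commute)
    ultimately show ?thesis by (simp add: has_field_derivative_def mult_commute_abs)
  qed
  ultimately have "(\<lambda>t. frechet_derivative \<phi> (at x) (t *\<^sub>R \<theta>)) =
      (\<lambda>t. t * (cutoff k l r (proj \<theta> x) * smooth_slope k p q p' q' (x \<bullet> \<theta>)))"
    by (rule has_derivative_unique)
  from fun_cong[OF this, of 1] have "frechet_derivative \<phi> (at x) \<theta> =
      cutoff k l r (proj \<theta> x) * smooth_slope k p q p' q' (x \<bullet> \<theta>)" by simp
  then show "\<theta> \<bullet> grad \<phi> x = cutoff k l r (proj \<theta> x) * smooth_slope k p q p' q' (x \<bullet> \<theta>)"
    using inner_grad[OF D] by simp
qed

lemma borel_measurable_Ck: "Ck 0 f \<Longrightarrow> f \<in> borel_measurable borel"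
  by (simp add: borel_measurable_continuous_onI)

text \<open>The test functions above are bounded uniformly in \<open>k\<close>, and so are their derivatives along \<open>\<theta>\<close>; by
  dominated convergence the weak formulation extends to the limits, where the cross-section of the tube is
  an exact box.\<close>

lemma weak_deriv_tube:
  fixes \<theta> :: "'a::euclidean_space" and u du :: "'a \<Rightarrow> real"
  assumes \<theta>: "norm \<theta> = 1"
    and int: "integrable lborel u" "integrable lborel du"
    and weak: "\<And>\<phi>. \<phi> \<in> test_fun \<Omega> \<Longrightarrow>
      (LBINT x. u x * (\<theta> \<bullet> grad \<phi> x)) = - (LBINT x. du x * \<phi> x)"
    and ord: "a \<le> p" "p \<le> q" "q \<le> b" "a \<le> p'" "p' \<le> q'" "q' \<le> b"
    and tube: "{x. proj \<theta> x \<in> cbox l r \<and> x \<bullet> \<theta> \<in> {a..b}} \<subseteq> \<Omega>"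
  shows "(LBINT x. u x * (indicator (box l r) (proj \<theta> x) * slope p q p' q' (x \<bullet> \<theta>))) =
    - (LBINT x. du x * (indicator (box l r) (proj \<theta> x) * hat p q p' q' (x \<bullet> \<theta>)))"
proof -
  have [measurable]: "u \<in> borel_measurable borel" "du \<in> borel_measurable borel"
    using int by auto
  have [measurable]: "cutoff k l r \<in> borel_measurable borel" "bump k p q \<in> borel_measurable borel"
    "bump_int k p q \<in> borel_measurable borel" for k p q
    unfolding cutoff_def
    using borel_measurable_Ck[OF Ck_bump] borel_measurable_Ck[OF Ck_bump_int] by measurable
  have [measurable]: "smooth_slope k p q p' q' \<in> borel_measurable borel"
    "smooth_hat k p q p' q' \<in> borel_measurable borel" for k
    unfolding smooth_slope_def smooth_hat_def by measurable
  have [measurable]: "slope p q p' q' \<in> borel_measurable borel"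
    "hat p q p' q' \<in> borel_measurable borel"
    unfolding slope_def hat_def ramp_def by measurable
  have dom: "norm (w * (c * g)) \<le> C * norm w" if "0 \<le> c" "c \<le> 1" "\<bar>g\<bar> \<le> C" for w c g C :: real
  proof -
    have "\<bar>c\<bar> * \<bar>g\<bar> \<le> 1 * C" using that by (intro mult_mono) auto
    then have "\<bar>w\<bar> * (\<bar>c\<bar> * \<bar>g\<bar>) \<le> \<bar>w\<bar> * C" by (intro mult_left_mono) auto
    then show ?thesis by (simp add: abs_mult mult.commute)
  qed
  note pq = \<open>p \<le> q\<close> \<open>p' \<le> q'\<close>
  have 1: "(\<lambda>k. (LBINT x. u x * (cutoff k l r (proj \<theta> x) * smooth_slope k p q p' q' (x \<bullet> \<theta>)))) \<longlonglongrightarrow>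
      (LBINT x. u x * (indicator (box l r) (proj \<theta> x) * slope p q p' q' (x \<bullet> \<theta>)))"
  proof (rule integral_dominated_convergence)
    show "integrable lborel (\<lambda>x. ((q' - p') + (q - p)) * norm (u x))" using int by simp
    show "AE x in lborel. norm (u x * (cutoff k l r (proj \<theta> x) * smooth_slope k p q p' q' (x \<bullet> \<theta>)))
        \<le> ((q' - p') + (q - p)) * norm (u x)" for k
      by (intro AE_I2 dom cutoff_bounds smooth_slope_hat_bounds pq)
    show "AE x in lborel. (\<lambda>k. u x * (cutoff k l r (proj \<theta> x) * smooth_slope k p q p' q' (x \<bullet> \<theta>)))
        \<longlonglongrightarrow> u x * (indicator (box l r) (proj \<theta> x) * slope p q p' q' (x \<bullet> \<theta>))"
      by (intro AE_I2 tendsto_mult tendsto_const cutoff_tendsto smooth_slope_hat_tendsto pq)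
  qed measurable
  have 2: "(\<lambda>k. (LBINT x. du x * (cutoff k l r (proj \<theta> x) * smooth_hat k p q p' q' (x \<bullet> \<theta>)))) \<longlonglongrightarrow>
      (LBINT x. du x * (indicator (box l r) (proj \<theta> x) * hat p q p' q' (x \<bullet> \<theta>)))"
  proof (rule integral_dominated_convergence)
    show "integrable lborel (\<lambda>x. (2 * (q - p) * (q' - p')) * norm (du x))" using int by simp
    show "AE x in lborel. norm (du x * (cutoff k l r (proj \<theta> x) * smooth_hat k p q p' q' (x \<bullet> \<theta>)))
        \<le> (2 * (q - p) * (q' - p')) * norm (du x)" for k
      by (intro AE_I2 dom cutoff_bounds smooth_slope_hat_bounds pq)
    show "AE x in lborel. (\<lambda>k. du x * (cutoff k l r (proj \<theta> x) * smooth_hat k p q p' q' (x \<bullet> \<theta>)))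
        \<longlonglongrightarrow> du x * (indicator (box l r) (proj \<theta> x) * hat p q p' q' (x \<bullet> \<theta>))"
      by (intro AE_I2 tendsto_mult tendsto_const cutoff_tendsto smooth_slope_hat_tendsto pq)
  qed measurable
  have "(LBINT x. u x * (cutoff k l r (proj \<theta> x) * smooth_slope k p q p' q' (x \<bullet> \<theta>))) =
      - (LBINT x. du x * (cutoff k l r (proj \<theta> x) * smooth_hat k p q p' q' (x \<bullet> \<theta>)))" for k
    using weak[OF tube_test_fun(1)[OF \<theta> ord tube, of k]] tube_test_fun(2)[OF \<theta> ord tube, of k] by simp
  then have "(\<lambda>k. - (LBINT x. du x * (cutoff k l r (proj \<theta> x) * smooth_hat k p q p' q' (x \<bullet> \<theta>)))) \<longlonglongrightarrow>
      (LBINT x. u x * (indicator (box l r) (proj \<theta> x) * slope p q p' q' (x \<bullet> \<theta>)))"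
    using 1 by simp
  from LIMSEQ_unique[OF this tendsto_minus[OF 2]] show ?thesis .
qed

section \<open>Primitives of integrable functions on the line\<close>

lemma integrable_indicator_mult:
  fixes f :: "'a \<Rightarrow> real"
  assumes "integrable M f" "A \<in> sets M"
  shows "integrable M (\<lambda>x. indicator A x * f x)"
  using integrable_mult_indicator[OF assms(2,1)] by simp

text \<open>The boxes are stable under intersection and generate the Borel sets.  The sets over which the
  integral vanishes contain the boxes and, the integral over the whole space being a limit of integrals
  over boxes, are closed under complements and disjoint unions.  So the sets where \<open>k\<close> is positive or
  negative are among them.\<close>

lemma AE_zero_if_integral_boxes_zero:
  fixes k :: "'a::euclidean_space \<Rightarrow> real"
  assumes M [measurable_cong]: "sets M = sets borel" and int: "integrable M k"
    and zero: "\<And>l r. (\<integral>x. indicator (box l r) x * k x \<partial>M) = 0"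
  shows "AE x in M. k x = 0"
proof -
  have [measurable]: "k \<in> borel_measurable M" using int by simp
  have space: "space M = UNIV" using sets_eq_imp_space_eq[OF M] by simp
  let ?E = "range (\<lambda>(a, b). box a b :: 'a set)"
  let ?A = "\<lambda>n::nat. box (- (real n *\<^sub>R One)) (real n *\<^sub>R One) :: 'a set"
  have borel: "sets borel = sigma_sets UNIV ?E"
    by (subst borel_eq_box) simp
  have intA: "integrable M (\<lambda>x. indicator A x * k x)" if "A \<in> sets borel" for A
    using int that M by (intro integrable_indicator_mult) auto
  have total: "(\<integral>x. k x \<partial>M) = 0"
  proof -
    have "(\<lambda>n. \<integral>x. indicator (?A n) x * k x \<partial>M) \<longlonglongrightarrow> (\<integral>x. k x \<partial>M)"
    proof (rule integral_dominated_convergence)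
      show "integrable M (\<lambda>x. norm (k x))" using int by simp
      show "AE x in M. norm (indicator (?A n) x * k x) \<le> norm (k x)" for n
        by (auto simp: indicator_def)
      show "AE x in M. (\<lambda>n. indicator (?A n) x * k x) \<longlonglongrightarrow> k x"
      proof (rule AE_I2)
        fix x :: 'a
        obtain n where n: "x \<in> ?A n" using UN_box_eq_UNIV by blast
        have "\<forall>\<^sub>F m in sequentially. indicator (?A m) x * k x = k x"
          using eventually_ge_at_top[of n]
        proof eventually_elim
          case (elim m)
          have "x \<in> ?A m"
            unfolding mem_box
          proof
            fix i :: 'a assume i: "i \<in> Basis"
            then have "- real n < x \<bullet> i \<and> x \<bullet> i < real n"
              using n by (auto simp: mem_box)
            then show "- (real m *\<^sub>R One) \<bullet> i < x \<bullet> i \<and> x \<bullet> i < (real m *\<^sub>R One) \<bullet> i"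
              using elim i by simp
          qed
          then show ?case by simp
        qed
        then show "(\<lambda>n. indicator (?A n) x * k x) \<longlonglongrightarrow> k x" by (rule tendsto_eventually)
      qed
    qed measurable
    then show ?thesis unfolding zero by (simp add: LIMSEQ_const_iff)
  qed
  have sets_zero: "(\<integral>x. indicator A x * k x \<partial>M) = 0" if "A \<in> sets borel" for A
  proof -
    have "Int_stable ?E" by (auto simp: Int_stable_def box_Int_box)
    moreover have "?E \<subseteq> Pow UNIV" by auto
    moreover have "A \<in> sigma_sets UNIV ?E" using that borel by simp
    ultimately show ?thesis
    proof (induction rule: sigma_sets_induct_disjoint)
      case (basic A)
      then show ?case using zero by auto
    next
      case empty
      show ?case by simp
    next
      case (compl A)
      then have A: "A \<in> sets borel" using borel by simp
      have "(\<integral>x. indicator (UNIV - A) x * k x \<partial>M) = (\<integral>x. k x - indicator A x * k x \<partial>M)"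
        by (intro Bochner_Integration.integral_cong) (auto simp: indicator_def)
      also have "\<dots> = 0"
        using int intA[OF A] compl total by simp
      finally show ?case .
    next
      case (union A)
      have A: "A i \<in> sets borel" for i using union(2) borel by auto
      have "(\<lambda>i. \<integral>x. indicator (A i) x * k x \<partial>M) sums (\<integral>x. indicator (\<Union>i. A i) x * k x \<partial>M)"
      proof -
        have 1: "set_integrable M (\<Union>i. A i) k"
          unfolding set_integrable_def using intA[of "\<Union>i. A i"] A by simp
        have "(LINT x:(\<Union>i. A i)|M. k x) = (\<Sum>i. (LINT x:(A i)|M. k x))"
          using A M union(1) 1 by (intro lebesgue_integral_countable_add) (auto simp: disjoint_family_on_def)
        then show ?thesis unfolding set_lebesgue_integral_def using union(3) by simp
      qed
      then show ?case unfolding union(3) by (simp add: sums_iff)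
    qed
  qed
  have pos: "AE x in M. \<not> s * k x > 0" for s
  proof -
    define A where "A = {x. s * k x > 0}"
    have "A \<inter> space M \<in> sets M" unfolding A_def by measurable
    then have A: "A \<in> sets borel" using M space by simp
    then have [measurable]: "A \<in> sets M" using M by simp
    have "AE x in M. indicator A x * (s * k x) = 0"
    proof (subst integral_nonneg_eq_0_iff_AE[symmetric])
      have "integrable M (\<lambda>x. s * (indicator A x * k x))"
        using intA[OF A] by simp
      then show "integrable M (\<lambda>x. indicator A x * (s * k x))" by (simp add: ac_simps)
      show "AE x in M. 0 \<le> indicator A x * (s * k x)" by (auto simp: A_def indicator_def)
      show "(\<integral>x. indicator A x * (s * k x) \<partial>M) = 0"
        using sets_zero[OF A] by (simp add: mult.left_commute[of _ s])
    qed
    then show ?thesis by eventually_elim (auto simp: A_def indicator_def split: if_splits)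
  qed
  from pos[of 1] pos[of "-1"] show ?thesis by eventually_elim auto
qed

text \<open>An interval with arbitrary ends \<open>x\<close> and \<open>y\<close> is exhausted from inside by rational ones, so the
  previous lemma applies.\<close>

lemma AE_zero_if_integral_rat_intervals_zero:
  fixes k :: "real \<Rightarrow> real"
  assumes int: "integrable lborel k" and out: "\<And>t. t \<notin> {\<alpha><..<\<beta>} \<Longrightarrow> k t = 0"
    and zero: "\<And>p q. \<lbrakk>p \<in> \<rat>; q \<in> \<rat>; \<alpha> < p; p < q; q < \<beta>\<rbrakk> \<Longrightarrow>
      (LBINT t. indicator {p<..<q} t * k t) = 0"
  shows "AE t in lborel. k t = 0"
proof (rule AE_zero_if_integral_boxes_zero[OF _ int])
  fix l r :: real
  define x y where "x = max l \<alpha>" and "y = min r \<beta>"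
  have [measurable]: "k \<in> borel_measurable borel" using int by simp
  have "\<exists>p\<in>\<rat>. x < p \<and> p < x + inverse (real (Suc n))" for n
    using Rats_dense_in_real[of x "x + inverse (real (Suc n))"] by auto
  then obtain p where p: "\<And>n. p n \<in> \<rat>" "\<And>n. x < p n" "\<And>n. p n < x + inverse (real (Suc n))" by metis
  have "\<exists>q\<in>\<rat>. y - inverse (real (Suc n)) < q \<and> q < y" for n
    using Rats_dense_in_real[of "y - inverse (real (Suc n))" y] by auto
  then obtain q where q: "\<And>n. q n \<in> \<rat>" "\<And>n. q n < y" "\<And>n. y - inverse (real (Suc n)) < q n" by metis
  have "p \<longlonglongrightarrow> x"
  proof (rule tendsto_sandwich[of "\<lambda>_. x" p _ "\<lambda>n. x + inverse (real (Suc n))"])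
    show "(\<lambda>n. x + inverse (real (Suc n))) \<longlonglongrightarrow> x"
      using tendsto_add[OF tendsto_const LIMSEQ_inverse_real_of_nat, of x] by simp
  qed (use p(2,3) in \<open>auto intro!: always_eventually less_imp_le simp del: of_nat_Suc\<close>)
  have "q \<longlonglongrightarrow> y"
  proof (rule tendsto_sandwich[of "\<lambda>n. y - inverse (real (Suc n))" q _ "\<lambda>_. y"])
    show "(\<lambda>n. y - inverse (real (Suc n))) \<longlonglongrightarrow> y"
      using tendsto_diff[OF tendsto_const LIMSEQ_inverse_real_of_nat, of y] by simp
  qed (use q(2,3) in \<open>auto intro!: always_eventually less_imp_le simp del: of_nat_Suc\<close>)
  have "(\<lambda>n. (LBINT t. indicator {p n<..<q n} t * k t)) \<longlonglongrightarrow> (LBINT t. indicator (box l r) t * k t)"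
  proof (rule integral_dominated_convergence)
    show "integrable lborel (\<lambda>t. norm (k t))" using int by simp
    show "AE t in lborel. norm (indicator {p n<..<q n} t * k t) \<le> norm (k t)" for n
      by (auto simp: indicator_def)
    show "AE t in lborel. (\<lambda>n. indicator {p n<..<q n} t * k t) \<longlonglongrightarrow> indicator (box l r) t * k t"
    proof (rule AE_I2)
      fix t
      have "\<forall>\<^sub>F n in sequentially. indicator {p n<..<q n} t * k t = indicator (box l r) t * k t"
      proof (cases "x < t \<and> t < y")
        case True
        have "\<forall>\<^sub>F n in sequentially. p n < t" "\<forall>\<^sub>F n in sequentially. t < q n"
          using order_tendstoD(2)[OF \<open>p \<longlonglongrightarrow> x\<close>] order_tendstoD(1)[OF \<open>q \<longlonglongrightarrow> y\<close>] True by auto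
        then show ?thesis by eventually_elim (use True in \<open>auto simp: x_def y_def\<close>)
      next
        case False
        then have "t \<notin> {p n<..<q n}" for n using p(2)[of n] q(2)[of n] by auto
        moreover have "indicator (box l r) t * k t = 0"
          using False out[of t] by (auto simp: indicator_def x_def y_def)
        ultimately show ?thesis by simp
      qed
      then show "(\<lambda>n. indicator {p n<..<q n} t * k t) \<longlonglongrightarrow> indicator (box l r) t * k t"
        by (rule tendsto_eventually)
    qed
  qed measurable
  moreover have "(LBINT t. indicator {p n<..<q n} t * k t) = 0" for n
  proof (cases "p n < q n")
    case True
    then show ?thesis using p(1,2)[of n] q(1,2)[of n] by (intro zero) (auto simp: x_def y_def)
  qed simp
  ultimately show "(LBINT t. indicator (box l r) t * k t) = 0"
    by (simp add: LIMSEQ_const_iff)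
qed simp

text \<open>Absolute continuity on the closed interval, with derivative \<open>f\<close>, in integrated form.  The ends
  belong to the interval because traces are values there.\<close>

definition is_primitive :: "(real \<Rightarrow> real) \<Rightarrow> (real \<Rightarrow> real) \<Rightarrow> real \<Rightarrow> real \<Rightarrow> bool" where
  "is_primitive W f a b \<longleftrightarrow> (\<forall>t\<in>{a..b}. W t = W a + (LBINT s. indicator {a..t} s * f s))"

text \<open>In other words, \<open>u\<close> has an absolutely continuous representative on \<open>]a,b[\<close> with derivative \<open>f\<close> that
  extends continuously to the ends.\<close>

definition agrees_with_primitive :: "(real \<Rightarrow> real) \<Rightarrow> (real \<Rightarrow> real) \<Rightarrow> real \<Rightarrow> real \<Rightarrow> bool" where
  "agrees_with_primitive u f a b \<longleftrightarrow>
     (\<exists>W. is_primitive W f a b \<and> (AE s in lborel. s \<in> {a<..<b} \<longrightarrow> u s = W s))"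

lemma is_primitive_continuous:
  assumes "integrable lborel f" "is_primitive W f a b"
  shows "continuous_on {a..b} W"
proof -
  have int: "set_integrable lborel {a..t} f" for t
    using integrable_indicator_mult[OF assms(1), of "{a..t}"] by (simp add: set_integrable_def)
  have "continuous_on {a..b} (\<lambda>t. W a + integral {a..t} f)"
    by (intro continuous_intros indefinite_integral_continuous_1 set_borel_integral_eq_integral(1) int)
  moreover have "W a + integral {a..t} f = W t" if "t \<in> {a..b}" for t
    using bspec[OF assms(2)[unfolded is_primitive_def] that] set_borel_integral_eq_integral(2)[OF int[of t]]
    by (simp add: set_lebesgue_integral_def)
  ultimately show ?thesis by (rule continuous_on_eq)
qed

lemma lborel_integral_cong_except_two:
  fixes f g :: "real \<Rightarrow> real"
  assumes [measurable]: "f \<in> borel_measurable borel" "g \<in> borel_measurable borel"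
    and "\<And>t. t \<noteq> a \<Longrightarrow> t \<noteq> b \<Longrightarrow> f t = g t"
  shows "integral\<^sup>L lborel f = integral\<^sup>L lborel g"
proof (rule integral_cong_AE)
  show "AE t in lborel. f t = g t"
    using AE_lborel_singleton[of a] AE_lborel_singleton[of b] by eventually_elim (use assms in auto)
qed simp_all

text \<open>The product is the double integral of \<open>f s * g t\<close>; it is split into the parts \<open>s \<le> t\<close> and \<open>t < s\<close>,
  and the diagonal is negligible on each line.\<close>

lemma integral_mult_integral:
  fixes f g :: "real \<Rightarrow> real"
  assumes f: "integrable lborel f" and g: "integrable lborel g"
  shows "integrable lborel (\<lambda>t. (LBINT s. indicator {..t} s * f s) * g t)"
    and "(LBINT t. f t) * (LBINT t. g t) =
      (LBINT t. (LBINT s. indicator {..t} s * f s) * g t) +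
      (LBINT t. (LBINT s. indicator {..t} s * g s) * f t)"
proof -
  have [measurable]: "f \<in> borel_measurable borel" "g \<in> borel_measurable borel" using f g by auto
  have fg: "integrable (lborel \<Otimes>\<^sub>M lborel) (\<lambda>(s, t). f s * g t)"
  proof (rule lborel_pair.Fubini_integrable)
    show "integrable lborel (\<lambda>x. (LBINT y. norm (case (x, y) of (s, t) \<Rightarrow> f s * g t)))"
      using f g by (simp add: abs_mult)
    show "AE x in lborel. integrable lborel (\<lambda>y. case (x, y) of (s, t) \<Rightarrow> f s * g t)"
      using g by simp
  qed measurable
  have low: "integrable (lborel \<Otimes>\<^sub>M lborel) (\<lambda>(s, t). indicator {..t} s * (f s * g t))"
    by (rule Bochner_Integration.integrable_bound[OF fg]) (auto simp: split_beta' indicator_def)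
  have up: "integrable (lborel \<Otimes>\<^sub>M lborel) (\<lambda>(s, t). indicator {..<s} t * (f s * g t))"
    by (rule Bochner_Integration.integrable_bound[OF fg]) (auto simp: split_beta' indicator_def)
  have low_inner: "(LBINT s. indicator {..t} s * (f s * g t)) = (LBINT s. indicator {..t} s * f s) * g t" for t
    by (simp flip: mult.assoc)
  \<comment> \<open>The strict inequality is replaced by the weak one, which changes the integrand at one point.\<close>
  have up_inner: "(LBINT t. indicator {..<s} t * (f s * g t)) = (LBINT t. indicator {..s} t * g t) * f s" for s
  proof -
    have "(LBINT t. indicator {..<s} t * (f s * g t)) = (LBINT t. indicator {..<s} t * g t) * f s"
      by (simp flip: mult.assoc add: mult.commute[of "f s"]) 
    also have "(LBINT t. indicator {..<s} t * g t) = (LBINT t. indicator {..s} t * g t)"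
      by (rule lborel_integral_cong_except_two[of _ _ s s]) (auto simp: indicator_def)
    finally show ?thesis .
  qed
  show "integrable lborel (\<lambda>t. (LBINT s. indicator {..t} s * f s) * g t)"
    using lborel_pair.integrable_snd[OF low] by (simp add: low_inner)
  have "(LBINT t. f t) * (LBINT t. g t) = (LBINT s. (LBINT t. f s * g t))"
    by simp
  also have "\<dots> = (\<integral>z. (case z of (s, t) \<Rightarrow> f s * g t) \<partial>(lborel \<Otimes>\<^sub>M lborel))"
    using lborel_pair.integral_fst[OF fg] by simp
  also have "\<dots> = (\<integral>z. (case z of (s, t) \<Rightarrow> indicator {..t} s * (f s * g t)) +
      (case z of (s, t) \<Rightarrow> indicator {..<s} t * (f s * g t)) \<partial>(lborel \<Otimes>\<^sub>M lborel))"
    by (intro Bochner_Integration.integral_cong) (auto simp: indicator_def)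
  also have "\<dots> = (LBINT t. (LBINT s. indicator {..t} s * (f s * g t))) +
      (LBINT s. (LBINT t. indicator {..<s} t * (f s * g t)))"
    using low up lborel_pair.integral_snd[OF low] lborel_pair.integral_fst[OF up] by simp
  finally show "(LBINT t. f t) * (LBINT t. g t) =
      (LBINT t. (LBINT s. indicator {..t} s * f s) * g t) +
      (LBINT t. (LBINT s. indicator {..t} s * g s) * f t)"
    by (simp only: low_inner up_inner)
qed

text \<open>Integration by parts.  With \<open>W\<close> and \<open>Z\<close> written as their values at \<open>a\<close> plus indefinite integrals,
  the terms that contain a value at \<open>a\<close> are linear, and the remaining one is the preceding lemma for
  \<open>f\<close> and \<open>g\<close> cut off outside \<open>]a,b[\<close>.\<close>

lemma is_primitive_product:
  fixes f g W Z :: "real \<Rightarrow> real"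
  assumes f: "integrable lborel f" and g: "integrable lborel g"
    and W: "is_primitive W f a b" and Z: "is_primitive Z g a b" and "a \<le> b"
  shows "integrable lborel (\<lambda>t. indicator {a<..<b} t * (W t * g t + Z t * f t))" (is ?int)
    and "(LBINT t. indicator {a<..<b} t * (W t * g t + Z t * f t)) = W b * Z b - W a * Z a" (is ?eq)
proof -
  let ?F = "\<lambda>t. indicator {a<..<b} t * f t" and ?G = "\<lambda>t. indicator {a<..<b} t * g t"
  let ?V = "\<lambda>f t. (LBINT s. indicator {..t} s * (indicator {a<..<b} s * f s))"
  have F: "integrable lborel ?F" and G: "integrable lborel ?G"
    by (rule integrable_indicator_mult[OF f], simp) (rule integrable_indicator_mult[OF g], simp)
  have V: "(LBINT s. indicator {a..t} s * h s) = ?V h t"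
    if [measurable]: "h \<in> borel_measurable borel" and "t \<in> {a..b}" for h :: "real \<Rightarrow> real" and t
    using that(2) by (intro lborel_integral_cong_except_two[of _ _ a b]) (auto simp: indicator_def)
  have [measurable]: "f \<in> borel_measurable borel" "g \<in> borel_measurable borel" using f g by auto
  have W': "W t = W a + ?V f t" and Z': "Z t = Z a + ?V g t" if "t \<in> {a..b}" for t
    using bspec[OF W[unfolded is_primitive_def] that] bspec[OF Z[unfolded is_primitive_def] that]
      V[of f t] V[of g t] that by simp_all
  have total: "?V h b = (LBINT s. indicator {a<..<b} s * h s)" for h :: "real \<Rightarrow> real"
    by (intro Bochner_Integration.integral_cong) (auto simp: indicator_def)
  have eq: "indicator {a<..<b} t * (W t * g t + Z t * f t) =
      W a * ?G t + Z a * ?F t + (?V f t * ?G t + ?V g t * ?F t)" for t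
  proof (cases "t \<in> {a<..<b}")
    case True
    then have "t \<in> {a..b}" by simp
    from True show ?thesis unfolding W'[OF \<open>t \<in> {a..b}\<close>] Z'[OF \<open>t \<in> {a..b}\<close>]
      by (simp add: algebra_simps)
  qed simp
  note P = integral_mult_integral[OF F G] and Q = integral_mult_integral(1)[OF G F]
  show ?int unfolding eq
    using F G P(1) Q by simp
  have "(LBINT t. indicator {a<..<b} t * (W t * g t + Z t * f t)) =
      W a * (LBINT t. ?G t) + Z a * (LBINT t. ?F t) +
      ((LBINT t. ?V f t * ?G t) + (LBINT t. ?V g t * ?F t))"
    unfolding eq using F G P(1) Q by simp
  also have "\<dots> = W a * ?V g b + Z a * ?V f b + ?V f b * ?V g b"
    unfolding total P(2) by simp
  also have "\<dots> = W b * Z b - W a * Z a"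
  proof -
    have b: "b \<in> {a..b}" using \<open>a \<le> b\<close> by simp
    show ?thesis unfolding W'[OF b] Z'[OF b] by (simp only: algebra_simps)
  qed
  finally show ?eq .
qed

section \<open>The lemma of du Bois-Reymond on almost every line\<close>

lemma borel_measurable_ramp [measurable]: "ramp p q \<in> borel_measurable borel"
  unfolding ramp_def by measurable

lemma borel_measurable_slope [measurable]: "slope p q p' q' \<in> borel_measurable borel"
  unfolding slope_def by measurable

lemma borel_measurable_hat [measurable]: "hat p q p' q' \<in> borel_measurable borel"
  unfolding hat_def by measurable

lemma integrable_mult_slope:
  assumes "integrable M u" "t \<in> borel_measurable M"
  shows "integrable M (\<lambda>s. u s * slope p q p' q' (t s))"
proof (rule Bochner_Integration.integrable_bound[OF integrable_mult_right[OF assms(1), of "\<bar>q' - p'\<bar> + \<bar>q - p\<bar>"]])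
  show "(\<lambda>s. u s * slope p q p' q' (t s)) \<in> borel_measurable M"
    using assms by measurable
  have "\<bar>slope p q p' q' x\<bar> \<le> \<bar>q' - p'\<bar> + \<bar>q - p\<bar>" for x
    by (auto simp: slope_def indicator_def)
  then show "AE s in M. norm (u s * slope p q p' q' (t s)) \<le> norm ((\<bar>q' - p'\<bar> + \<bar>q - p\<bar>) * u s)"
    by (intro AE_I2) (simp add: abs_mult mult.commute[of _ "\<bar>u _\<bar>"] mult_left_mono)
qed

lemma integrable_mult_hat:
  assumes "integrable M u" "t \<in> borel_measurable M" "p \<le> q" "p' \<le> q'"
  shows "integrable M (\<lambda>s. u s * hat p q p' q' (t s))"
proof (rule Bochner_Integration.integrable_bound[OF integrable_mult_right[OF assms(1), of "2 * (q - p) * (q' - p')"]])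
  show "(\<lambda>s. u s * hat p q p' q' (t s)) \<in> borel_measurable M"
    using assms by measurable
  have "\<bar>hat p q p' q' x\<bar> \<le> (q' - p') * (q - p) + (q - p) * (q' - p')" for x
    unfolding hat_def using assms by (intro abs_diff_mult_le) (auto simp: ramp_def)
  then have "\<bar>hat p q p' q' x\<bar> \<le> \<bar>2 * (q - p) * (q' - p')\<bar>" for x
    by (rule order_trans) (simp add: algebra_simps)
  then have "norm (u s * hat p q p' q' (t s)) \<le> norm ((2 * (q - p) * (q' - p')) * u s)" for s
    unfolding real_norm_def abs_mult[of "u s"] abs_mult[of _ "u s"] mult.commute[of _ "\<bar>u s\<bar>"]
    by (intro mult_left_mono) auto
  then show "AE s in M. norm (u s * hat p q p' q' (t s)) \<le> norm ((2 * (q - p) * (q' - p')) * u s)"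
    by simp
qed

lemma is_primitive_ramp:
  assumes "\<alpha> < p" "p \<le> q"
  shows "is_primitive (ramp p q) (indicator {p<..<q}) \<alpha> \<beta>"
  unfolding is_primitive_def
proof
  fix t assume "t \<in> {\<alpha>..\<beta>}"
  have "ramp p q t = (LBINT s. indicator {p - 1..t} s * indicator {p<..<q} s)"
    by (rule ramp_eq_LBINT[OF assms(2)])
  also have "\<dots> = (LBINT s. indicator {\<alpha>..t} s * indicator {p<..<q} s)"
    using assms by (intro Bochner_Integration.integral_cong) (auto simp: indicator_def)
  finally show "ramp p q t = ramp p q \<alpha> + (LBINT s. indicator {\<alpha>..t} s * indicator {p<..<q} s)"
    using assms by (simp add: ramp_def)
qed

lemma is_primitive_integral:
  assumes "f \<in> borel_measurable borel"
  shows "is_primitive (\<lambda>t. c + (LBINT s. indicator {\<alpha>..t} s * f s)) f \<alpha> \<beta>"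
proof -
  have "(LBINT s. indicator {\<alpha>..\<alpha>} s * f s) = (\<integral>s. 0 \<partial>(lborel :: real measure))"
    using assms by (intro lborel_integral_cong_except_two[of _ _ \<alpha> \<alpha>]) (auto simp: indicator_def)
  then show ?thesis by (simp add: is_primitive_def)
qed

text \<open>Let \<open>V\<close> be a primitive of \<open>f\<close>.  Integration by parts of \<open>V\<close> against the ramps shows that \<open>V\<close> satisfies
  the same identity as \<open>u\<close>, so \<open>u - V\<close> is orthogonal to every rational \<open>slope\<close>.  This says that all means
  of \<open>u - V\<close> over rational intervals are equal, and \<open>u - V\<close> is constant almost everywhere.\<close>

lemma primitive_if_weak:
  fixes u f :: "real \<Rightarrow> real"
  assumes u: "integrable lborel u" and f: "integrable lborel f" and "\<alpha> < \<beta>"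
    and weak: "\<And>p q p' q'. \<lbrakk>p \<in> \<rat>; q \<in> \<rat>; p' \<in> \<rat>; q' \<in> \<rat>;
        \<alpha> < p; p < q; q < \<beta>; \<alpha> < p'; p' < q'; q' < \<beta>\<rbrakk> \<Longrightarrow>
      (LBINT s. u s * slope p q p' q' s) = - (LBINT s. f s * hat p q p' q' s)"
  shows "agrees_with_primitive u f \<alpha> \<beta>"
proof -
  have [measurable]: "u \<in> borel_measurable borel" "f \<in> borel_measurable borel" using u f by auto
  let ?I = "indicator {\<alpha><..<\<beta>} :: real \<Rightarrow> real"
  define V where "V t = (LBINT s. indicator {\<alpha>..t} s * f s)" for t
  have V: "is_primitive V f \<alpha> \<beta>"
    using is_primitive_integral[of f 0 \<alpha> \<beta>] by (simp add: V_def[abs_def])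
  have V0: "V \<alpha> = 0"
    using bspec[OF is_primitive_integral[of f 1 \<alpha> \<beta>, unfolded is_primitive_def], of \<alpha>] \<open>\<alpha> < \<beta>\<close>
    by (simp add: V_def)
  have IV: "integrable lborel (\<lambda>t. ?I t * V t)"
  proof -
    have "set_integrable lborel {\<alpha>..\<beta>} V"
      by (rule borel_integrable_atLeastAtMost'[OF is_primitive_continuous[OF f V]])
    then have "set_integrable lborel {\<alpha><..<\<beta>} V"
      by (rule set_integrable_subset) auto
    then show ?thesis by (simp add: set_integrable_def)
  qed
  define h where "h t = ?I t * (u t - V t)" for t
  have h: "integrable lborel h"
    using Bochner_Integration.integrable_diff[OF integrable_indicator_mult[OF u, of "{\<alpha><..<\<beta>}"] IV]
    by (simp add: h_def[abs_def] algebra_simps)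
  have h_slope: "(LBINT t. h t * slope p q p' q' t) = 0"
    if rat: "p \<in> \<rat>" "q \<in> \<rat>" "p' \<in> \<rat>" "q' \<in> \<rat>"
      and ord: "\<alpha> < p" "p < q" "q < \<beta>" "\<alpha> < p'" "p' < q'" "q' < \<beta>" for p q p' q'
  proof -
    \<comment> \<open>The integrand in the product rule for \<open>V\<close> and one ramp.  Since \<open>V\<close> vanishes at \<open>\<alpha>\<close>, only the
      value at \<open>\<beta>\<close> remains; the weights of the two ramps make these values cancel.\<close>
    let ?X = "\<lambda>p q t. ?I t * (V t * indicator {p<..<q} t + ramp p q t * f t)"
    have X: "integrable lborel (?X p q)" "(LBINT t. ?X p q t) = V \<beta> * (q - p)"
      if "\<alpha> < p" "p < q" "q < \<beta>" for p q
    proof -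
      have int: "integrable lborel (indicator {p<..<q} :: real \<Rightarrow> real)"
        using that by (intro integrable_real_indicator) auto
      note * = is_primitive_product[OF f int V is_primitive_ramp[OF that(1) less_imp_le[OF that(2)]] less_imp_le[OF \<open>\<alpha> < \<beta>\<close>]]
      show "integrable lborel (?X p q)" by (rule *(1))
      show "(LBINT t. ?X p q t) = V \<beta> * (q - p)"
        unfolding *(2) using that by (simp add: V0 ramp_def)
    qed
    have eq: "h t * slope p q p' q' t = u t * slope p q p' q' t + f t * hat p q p' q' t
        - ((q' - p') * ?X p q t - (q - p) * ?X p' q' t)" for t
    proof (cases "t \<in> {\<alpha><..<\<beta>}")
      case True
      then show ?thesis by (simp add: h_def slope_def hat_def algebra_simps)
    next
      case False
      then have "slope p q p' q' t = 0" using ord by (auto simp: slope_def indicator_def)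
      moreover have "hat p q p' q' t = 0"
        using False ord by (auto simp: hat_def ramp_def max_def min_def)
      ultimately show ?thesis using False by (simp add: h_def)
    qed
    show ?thesis
      unfolding eq using X[OF ord(1-3)] X[OF ord(4-6)] weak[OF rat ord]
        integrable_mult_slope[OF u, of "\<lambda>t. t" p q p' q'] integrable_mult_hat[OF f, of "\<lambda>t. t" p q p' q'] ord
      by simp
  qed
  obtain p' where p': "p' \<in> \<rat>" "\<alpha> < p'" "p' < \<beta>" using Rats_dense_in_real[OF \<open>\<alpha> < \<beta>\<close>] by auto
  obtain q' where q': "q' \<in> \<rat>" "p' < q'" "q' < \<beta>" using Rats_dense_in_real[OF p'(3)] by auto
  \<comment> \<open>The common mean, read off from one fixed reference interval.\<close>
  define c where "c = (LBINT t. indicator {p'<..<q'} t * h t) / (q' - p')"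
  define k where "k t = h t - c * ?I t" for t
  have I: "integrable lborel ?I" using \<open>\<alpha> < \<beta>\<close> by (intro integrable_real_indicator) auto
  have "AE t in lborel. k t = 0"
  proof (rule AE_zero_if_integral_rat_intervals_zero)
    show "integrable lborel k" unfolding k_def using h I by simp
    show "k t = 0" if "t \<notin> {\<alpha><..<\<beta>}" for t using that by (simp add: k_def h_def)
    fix p q assume pq: "p \<in> \<rat>" "q \<in> \<rat>" "\<alpha> < p" "p < q" "q < \<beta>"
    have ih: "integrable lborel (\<lambda>t. indicator {a<..<b} t * h t)" for a b :: real
      by (rule integrable_indicator_mult[OF h]) simp
    have "(LBINT t. h t * slope p q p' q' t) =
        (LBINT t. (q' - p') * (indicator {p<..<q} t * h t) - (q - p) * (indicator {p'<..<q'} t * h t))"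
      by (simp add: slope_def algebra_simps)
    also have "\<dots> = (q' - p') * (LBINT t. indicator {p<..<q} t * h t) - (q - p) * (LBINT t. indicator {p'<..<q'} t * h t)"
      using ih by simp
    finally have "(q' - p') * (LBINT t. indicator {p<..<q} t * h t) = (q - p) * (LBINT t. indicator {p'<..<q'} t * h t)"
      using h_slope[OF pq(1,2) p'(1) q'(1) pq(3,4,5) p'(2) q'(2,3)] by simp
    then have hc: "(LBINT t. indicator {p<..<q} t * h t) = c * (q - p)"
      using q'(2) by (simp add: c_def field_simps)
    have ind: "indicator {p<..<q} t * k t = indicator {p<..<q} t * h t - c * indicator {p<..<q} t" for t
      using pq by (auto simp: k_def indicator_def)
    show "(LBINT t. indicator {p<..<q} t * k t) = 0"
    proof -
      have "integrable lborel (indicator {p<..<q} :: real \<Rightarrow> real)"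
        using pq by (intro integrable_real_indicator) auto
      then show ?thesis unfolding ind using ih[of p q] pq hc by simp
    qed
  qed
  then have "AE s in lborel. s \<in> {\<alpha><..<\<beta>} \<longrightarrow> u s = c + V s"
    by eventually_elim (auto simp: k_def h_def)
  moreover have "is_primitive (\<lambda>s. c + V s) f \<alpha> \<beta>"
    unfolding V_def by (rule is_primitive_integral) simp
  ultimately show ?thesis unfolding agrees_with_primitive_def by blast
qed

text \<open>The complement is the sum of the closed set \<open>- \<Omega>\<close> and a compact segment, hence closed.\<close>

lemma open_forall_segment:
  fixes \<Omega> :: "'a::euclidean_space set"
  assumes "open \<Omega>"
  shows "open {x. \<forall>t\<in>{a..b}. x + t *\<^sub>R \<theta> \<in> \<Omega>}"
proof -
  have "compact ((\<lambda>t. - (t *\<^sub>R \<theta>)) ` {a..b})"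
    by (intro compact_continuous_image continuous_intros) auto
  moreover have "closed (- \<Omega>)" using assms by auto
  ultimately have "closed (\<Union>x\<in>- \<Omega>. \<Union>y\<in>(\<lambda>t. - (t *\<^sub>R \<theta>)) ` {a..b}. {x + y})"
    by (intro closed_compact_sums)
  moreover have "- {x. \<forall>t\<in>{a..b}. x + t *\<^sub>R \<theta> \<in> \<Omega>} = (\<Union>x\<in>- \<Omega>. \<Union>y\<in>(\<lambda>t. - (t *\<^sub>R \<theta>)) ` {a..b}. {x + y})"
    by (force simp: algebra_simps)
  ultimately have "closed (- {x. \<forall>t\<in>{a..b}. x + t *\<^sub>R \<theta> \<in> \<Omega>})" by (simp only:)
  then show ?thesis by (simp add: open_closed)
qed

lemma countable_rat_vectors: "countable {x::'a::euclidean_space. \<forall>i\<in>Basis. x \<bullet> i \<in> \<rat>}"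
proof -
  have "{x::'a. \<forall>i\<in>Basis. x \<bullet> i \<in> \<rat>} \<subseteq> (\<lambda>f. \<Sum>i\<in>Basis. f i *\<^sub>R i) ` (Basis \<rightarrow>\<^sub>E \<rat>)"
  proof
    fix x :: 'a assume "x \<in> {x. \<forall>i\<in>Basis. x \<bullet> i \<in> \<rat>}"
    then have "(\<lambda>i\<in>Basis. x \<bullet> i) \<in> Basis \<rightarrow>\<^sub>E \<rat>" by auto
    moreover have "x = (\<Sum>i\<in>Basis. (\<lambda>i\<in>Basis. x \<bullet> i) i *\<^sub>R i)"
      by (simp add: euclidean_representation)
    ultimately show "x \<in> (\<lambda>f. \<Sum>i\<in>Basis. f i *\<^sub>R i) ` (Basis \<rightarrow>\<^sub>E \<rat>)" by blast
  qed
  moreover have "countable ((Basis :: 'a set) \<rightarrow>\<^sub>E (\<rat> :: real set))"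
    by (intro countable_PiE countable_rat) auto
  ultimately show ?thesis by (meson countable_image countable_subset)
qed

text \<open>By Fubini, the identity for tubes says that the integral \<open>J\<close> over the line through \<open>y\<close>, as a function
  of \<open>y\<close>, has integral zero over every box inside \<open>box l r\<close>.\<close>

lemma AE_line_tube_identity:
  fixes \<theta> :: "'a::euclidean_space" and u du :: "'a \<Rightarrow> real"
  assumes \<theta>: "norm \<theta> = 1"
    and int: "integrable lborel u" "integrable lborel du"
    and weak: "\<And>\<phi>. \<phi> \<in> test_fun \<Omega> \<Longrightarrow>
      (LBINT x. u x * (\<theta> \<bullet> grad \<phi> x)) = - (LBINT x. du x * \<phi> x)"
    and ord: "a \<le> p" "p \<le> q" "q \<le> b" "a \<le> p'" "p' \<le> q'" "q' \<le> b"
    and tube: "{x. proj \<theta> x \<in> cbox l r \<and> x \<bullet> \<theta> \<in> {a..b}} \<subseteq> \<Omega>"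
  shows "AE y in hyp_borel \<theta>. y \<in> box l r \<longrightarrow>
    (LBINT s. u (s *\<^sub>R \<theta> + y) * slope p q p' q' s + du (s *\<^sub>R \<theta> + y) * hat p q p' q' s) = 0"
proof -
  have [measurable]: "u \<in> borel_measurable borel" "du \<in> borel_measurable borel" using int by auto
  define F where "F x = u x * slope p q p' q' (x \<bullet> \<theta>) + du x * hat p q p' q' (x \<bullet> \<theta>)" for x
  have intF: "integrable lborel F"
    unfolding F_def using int ord
    by (intro Bochner_Integration.integrable_add integrable_mult_slope integrable_mult_hat) auto
  have intBF: "integrable lborel (\<lambda>x. indicator (proj \<theta> -` A) x * F x)" if [measurable]: "A \<in> sets borel" for A
  proof (rule integrable_indicator_mult[OF intF])
    show "proj \<theta> -` A \<in> sets lborel"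
      using measurable_sets[OF borel_measurable_proj that] by simp
  qed
  define J where "J y = (LBINT s. F (s *\<^sub>R \<theta> + y))" for y
  note J = integral_lborel_lines(2)[OF \<theta> intF, folded J_def]
  have "AE y in hyp_borel \<theta>. indicator (box l r) y * J y = 0"
  proof (rule AE_zero_if_integral_boxes_zero)
    show "integrable (hyp_borel \<theta>) (\<lambda>y. indicator (box l r) y * J y)"
      by (rule integrable_indicator_mult[OF J]) simp
    fix l1 r1 :: 'a
    let ?l = "\<Sum>i\<in>Basis. max (l1 \<bullet> i) (l \<bullet> i) *\<^sub>R i" and ?r = "\<Sum>i\<in>Basis. min (r1 \<bullet> i) (r \<bullet> i) *\<^sub>R i"
    have box: "box l1 r1 \<inter> box l r = box ?l ?r" by (rule box_Int_box)
    have "cbox ?l ?r \<subseteq> cbox l r" by (auto simp: mem_box)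
    then have tube': "{x. proj \<theta> x \<in> cbox ?l ?r \<and> x \<bullet> \<theta> \<in> {a..b}} \<subseteq> \<Omega>" using tube by blast
    have "(\<integral>y. indicator (box l1 r1) y * (indicator (box l r) y * J y) \<partial>hyp_borel \<theta>) =
        (\<integral>y. indicator (box ?l ?r) y * J y \<partial>hyp_borel \<theta>)"
      unfolding box[symmetric] by (simp add: indicator_inter_arith mult.assoc)
    also have "\<dots> = (\<integral>y. (LBINT s. indicator (proj \<theta> -` box ?l ?r) (s *\<^sub>R \<theta> + y) * F (s *\<^sub>R \<theta> + y)) \<partial>hyp_borel \<theta>)"
    proof (rule integral_cong_AE)
      show "AE y in hyp_borel \<theta>. indicator (box ?l ?r) y * J y =
          (LBINT s. indicator (proj \<theta> -` box ?l ?r) (s *\<^sub>R \<theta> + y) * F (s *\<^sub>R \<theta> + y))"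
        using AE_hyp_borel_in_hyp
      proof eventually_elim
        case (elim y)
        have "indicator (proj \<theta> -` box ?l ?r) (s *\<^sub>R \<theta> + y) = (indicator (box ?l ?r) y :: real)" for s
          using proj_line[OF \<theta> elim] by (simp add: indicator_def)
        then show ?case by (simp add: J_def)
      qed
      show "(\<lambda>y. indicator (box ?l ?r) y * J y) \<in> borel_measurable (hyp_borel \<theta>)"
        using J by measurable
      show "(\<lambda>y. (LBINT s. indicator (proj \<theta> -` box ?l ?r) (s *\<^sub>R \<theta> + y) * F (s *\<^sub>R \<theta> + y)))
          \<in> borel_measurable (hyp_borel \<theta>)"
        using integral_lborel_lines(2)[OF \<theta> intBF[of "box ?l ?r"]] by simp
    qed
    also have "\<dots> = (LBINT x. indicator (proj \<theta> -` box ?l ?r) x * F x)"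
      using integral_lborel_lines(3)[OF \<theta> intBF[of "box ?l ?r"]] by simp
    also have "\<dots> = (LBINT x. u x * (indicator (box ?l ?r) (proj \<theta> x) * slope p q p' q' (x \<bullet> \<theta>))
        + du x * (indicator (box ?l ?r) (proj \<theta> x) * hat p q p' q' (x \<bullet> \<theta>)))"
      by (intro Bochner_Integration.integral_cong) (auto simp: F_def indicator_def)
    also have "\<dots> = 0"
    proof -
      have [measurable]: "proj \<theta> -` box ?l ?r \<in> sets borel"
        using measurable_sets[OF borel_measurable_proj, of "box ?l ?r" \<theta>] by simp
      have *: "integrable lborel (\<lambda>x. indicator (proj \<theta> -` box ?l ?r) x * (u x * slope p q p' q' (x \<bullet> \<theta>)))"
        "integrable lborel (\<lambda>x. indicator (proj \<theta> -` box ?l ?r) x * (du x * hat p q p' q' (x \<bullet> \<theta>)))"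
        using int ord
        by (intro integrable_indicator_mult integrable_mult_slope integrable_mult_hat; simp)+
      have "integrable lborel (\<lambda>x. u x * (indicator (box ?l ?r) (proj \<theta> x) * slope p q p' q' (x \<bullet> \<theta>)))"
        "integrable lborel (\<lambda>x. du x * (indicator (box ?l ?r) (proj \<theta> x) * hat p q p' q' (x \<bullet> \<theta>)))"
        using * by (simp_all add: indicator_vimage ac_simps)
      then show ?thesis
        using weak_deriv_tube[OF \<theta> int weak ord tube'] by simp
    qed
    finally show "(\<integral>y. indicator (box l1 r1) y * (indicator (box l r) y * J y) \<partial>hyp_borel \<theta>) = 0" .
  qed simp
  with AE_hyp_borel_in_hyp[of \<theta>] show ?thesis
  proof eventually_elim
    case (elim y)
    show ?case
    proof
      assume "y \<in> box l r"
      then have "J y = 0" using elim(2) by simp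
      then show "(LBINT s. u (s *\<^sub>R \<theta> + y) * slope p q p' q' s + du (s *\<^sub>R \<theta> + y) * hat p q p' q' s) = 0"
        by (simp add: J_def F_def inner_line[OF \<theta> elim(1)])
    qed
  qed
qed

text \<open>There are only countably many rational tubes, so one null set of lines serves all of them.  A
  compact piece of a line inside the open set \<open>\<Omega>\<close> lies in a rational tube inside \<open>\<Omega>\<close>; hence on the
  remaining lines the hypotheses of \<open>primitive_if_weak\<close> hold on every interval.\<close>

lemma AE_line_primitive:
  fixes \<theta> :: "'a::euclidean_space" and u du :: "'a \<Rightarrow> real"
  assumes \<theta>: "norm \<theta> = 1" and \<Omega>: "open \<Omega>"
    and int: "integrable lborel u" "integrable lborel du"
    and weak: "\<And>\<phi>. \<phi> \<in> test_fun \<Omega> \<Longrightarrow>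
      (LBINT x. u x * (\<theta> \<bullet> grad \<phi> x)) = - (LBINT x. du x * \<phi> x)"
  shows "AE y in hyp_borel \<theta>. \<forall>\<alpha> \<beta>. \<alpha> < \<beta> \<and> {\<alpha><..<\<beta>} \<subseteq> line_section \<Omega> \<theta> y \<longrightarrow>
    agrees_with_primitive (\<lambda>s. u (s *\<^sub>R \<theta> + y)) (\<lambda>s. du (s *\<^sub>R \<theta> + y)) \<alpha> \<beta>"
proof -
  \<comment> \<open>The rational data of tubes inside \<open>\<Omega>\<close>: a box of lines and a pair of intervals.\<close>
  define D :: "(('a \<times> 'a) \<times> ((real \<times> real) \<times> (real \<times> real))) set" where
    "D = (({x. \<forall>i\<in>Basis. x \<bullet> i \<in> \<rat>} \<times> {x. \<forall>i\<in>Basis. x \<bullet> i \<in> \<rat>}) \<times> ((\<rat> \<times> \<rat>) \<times> (\<rat> \<times> \<rat>)))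
      \<inter> {((l, r), ((p, q), (p', q'))). p < q \<and> p' < q' \<and>
          {x. proj \<theta> x \<in> cbox l r \<and> x \<bullet> \<theta> \<in> {min p p'..max q q'}} \<subseteq> \<Omega>}"
  have "countable D"
    unfolding D_def by (intro countable_Int1 countable_SIGMA countable_rat_vectors countable_rat)
  have "AE y in hyp_borel \<theta>. \<forall>d\<in>D. (case d of ((l, r), ((p, q), (p', q'))) \<Rightarrow> y \<in> box l r \<longrightarrow>
    (LBINT s. u (s *\<^sub>R \<theta> + y) * slope p q p' q' s + du (s *\<^sub>R \<theta> + y) * hat p q p' q' s) = 0)"
  proof (rule AE_ball_countable'[OF _ \<open>countable D\<close>])
    fix d assume "d \<in> D"
    then obtain l r p q p' q' where d: "d = ((l, r), ((p, q), (p', q')))" "p < q" "p' < q'"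
      "{x. proj \<theta> x \<in> cbox l r \<and> x \<bullet> \<theta> \<in> {min p p'..max q q'}} \<subseteq> \<Omega>"
      by (auto simp: D_def)
    show "AE y in hyp_borel \<theta>. (case d of ((l, r), ((p, q), (p', q'))) \<Rightarrow> y \<in> box l r \<longrightarrow>
      (LBINT s. u (s *\<^sub>R \<theta> + y) * slope p q p' q' s + du (s *\<^sub>R \<theta> + y) * hat p q p' q' s) = 0)"
      unfolding d(1) prod.case
      by (rule AE_line_tube_identity[OF \<theta> int weak _ _ _ _ _ _ d(4)]) (use d(2,3) in auto)
  qed
  with AE_hyp_borel_in_hyp[of \<theta>] integral_lborel_lines(1)[OF \<theta> int(1)] integral_lborel_lines(1)[OF \<theta> int(2)]
  show ?thesis
  proof eventually_elim
    case (elim y)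
    show ?case
    proof (intro allI impI, elim conjE)
      fix \<alpha> \<beta> :: real assume \<alpha>\<beta>: "\<alpha> < \<beta>" "{\<alpha><..<\<beta>} \<subseteq> line_section \<Omega> \<theta> y"
      show "agrees_with_primitive (\<lambda>s. u (s *\<^sub>R \<theta> + y)) (\<lambda>s. du (s *\<^sub>R \<theta> + y)) \<alpha> \<beta>"
      proof (rule primitive_if_weak[OF elim(2,3) \<alpha>\<beta>(1)])
        fix p q p' q' :: real
        assume rat: "p \<in> \<rat>" "q \<in> \<rat>" "p' \<in> \<rat>" "q' \<in> \<rat>"
          and ord: "\<alpha> < p" "p < q" "q < \<beta>" "\<alpha> < p'" "p' < q'" "q' < \<beta>"
        define a b where "a = min p p'" and "b = max q q'"
        have "y \<in> {x. \<forall>t\<in>{a..b}. x + t *\<^sub>R \<theta> \<in> \<Omega>}"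
        proof (intro CollectI ballI)
          fix t assume "t \<in> {a..b}"
          then have "t \<in> {\<alpha><..<\<beta>}" using ord by (auto simp: a_def b_def)
          then show "y + t *\<^sub>R \<theta> \<in> \<Omega>" using \<alpha>\<beta>(2) by (auto simp: line_section_def add.commute)
        qed
        then obtain e where e: "e > 0" "ball y e \<subseteq> {x. \<forall>t\<in>{a..b}. x + t *\<^sub>R \<theta> \<in> \<Omega>}"
          using open_forall_segment[OF \<Omega>] by (meson open_contains_ball)
        \<comment> \<open>Half the radius leaves room for the closed box.\<close>
        obtain l r where lr: "\<forall>i\<in>Basis. l \<bullet> i \<in> \<rat> \<and> r \<bullet> i \<in> \<rat>" "y \<in> box l r" "box l r \<subseteq> ball y (e / 2)"
          using rational_boxes[of "e / 2" y] e(1) by auto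
        have "cbox l r = closure (box l r)" using lr(2) by (intro closure_box[symmetric]) auto
        also have "\<dots> \<subseteq> closure (ball y (e / 2))" by (rule closure_mono[OF lr(3)])
        also have "\<dots> \<subseteq> ball y e" using e(1) by auto
        finally have sub: "cbox l r \<subseteq> {x. \<forall>t\<in>{a..b}. x + t *\<^sub>R \<theta> \<in> \<Omega>}" using e(2) by blast
        have "{x. proj \<theta> x \<in> cbox l r \<and> x \<bullet> \<theta> \<in> {min p p'..max q q'}} \<subseteq> \<Omega>"
        proof
          fix x assume "x \<in> {x. proj \<theta> x \<in> cbox l r \<and> x \<bullet> \<theta> \<in> {min p p'..max q q'}}"
          then have "proj \<theta> x + (x \<bullet> \<theta>) *\<^sub>R \<theta> \<in> \<Omega>" using sub by (auto simp: a_def b_def)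
          then show "x \<in> \<Omega>" by (simp add: proj_def)
        qed
        then have "((l, r), ((p, q), (p', q'))) \<in> D" using lr(1) rat ord by (simp add: D_def)
        from bspec[OF elim(4) this] lr(2)
        have "(LBINT s. u (s *\<^sub>R \<theta> + y) * slope p q p' q' s + du (s *\<^sub>R \<theta> + y) * hat p q p' q' s) = 0"
          by simp
        then show "(LBINT s. u (s *\<^sub>R \<theta> + y) * slope p q p' q' s) =
            - (LBINT s. du (s *\<^sub>R \<theta> + y) * hat p q p' q' s)"
          using integrable_mult_slope[OF elim(2), of "\<lambda>t. t" p q p' q'] integrable_mult_hat[OF elim(3), of "\<lambda>t. t" p q p' q'] ord
          by simp
      qed
    qed
  qed
qed

section \<open>Borel representatives\<close>

lemma integrable_lebesgue_on_iff:
  fixes f :: "'a::euclidean_space \<Rightarrow> real"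
  assumes [measurable]: "S \<in> sets borel" "f \<in> borel_measurable borel"
  shows "integrable (lebesgue_on S) f \<longleftrightarrow> integrable lborel (\<lambda>x. indicator S x * f x)"
  by (subst integrable_restrict_space) (simp_all add: integrable_completion)

lemma integral_lebesgue_on_eq:
  fixes f :: "'a::euclidean_space \<Rightarrow> real"
  assumes [measurable]: "S \<in> sets borel" "f \<in> borel_measurable borel"
  shows "integral\<^sup>L (lebesgue_on S) f = (LBINT x. indicator S x * f x)"
  by (subst integral_restrict_space) (simp_all add: integral_completion)

lemma AE_lebesgue_on_iff:
  assumes "S \<in> sets borel"
  shows "(AE x in lebesgue_on S. P x) \<longleftrightarrow> (AE x in lborel. x \<in> S \<longrightarrow> P x)"
  using assms by (subst AE_restrict_space_iff) (simp_all add: AE_completion_iff)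

lemma borel_representative:
  fixes f :: "'a::euclidean_space \<Rightarrow> real"
  assumes S [measurable]: "S \<in> sets borel" and f: "f \<in> borel_measurable (lebesgue_on S)"
  obtains g where "g \<in> borel_measurable borel" "\<And>x. x \<notin> S \<Longrightarrow> g x = 0"
    "AE x in lborel. x \<in> S \<longrightarrow> f x = g x"
proof -
  have "(\<lambda>x. indicator S x *\<^sub>R f x) \<in> borel_measurable lebesgue"
    using f S by (subst (asm) borel_measurable_restrict_space_iff) auto
  from completion_ex_borel_measurable_real[OF this] obtain g where
    g: "g \<in> borel_measurable lborel" "AE x in lborel. indicator S x *\<^sub>R f x = g x" by blast
  show ?thesis
  proof (rule that)
    show "(\<lambda>x. indicator S x * g x) \<in> borel_measurable borel" using g(1) by simp
    show "AE x in lborel. x \<in> S \<longrightarrow> f x = indicator S x * g x"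
      using g(2) by eventually_elim auto
  qed simp
qed

lemma borel_measurable_lebesgue_on:
  assumes "f \<in> borel_measurable borel"
  shows "f \<in> borel_measurable (lebesgue_on S)"
  using assms by (simp add: measurable_restrict_space1 measurable_completion)

lemma test_fun_continuous:
  assumes "\<phi> \<in> test_fun \<Omega>"
  shows "continuous_on UNIV \<phi>" "continuous_on UNIV (\<lambda>x. \<theta> \<bullet> grad \<phi> x)"
proof -
  have Ck: "Ck n \<phi>" for n using assms by (simp add: test_fun_def)
  show "continuous_on UNIV \<phi>" using Ck[of 0] by simp
  note D = Ck_SucD[OF Ck[of "Suc 0"]]
  have "\<theta> \<bullet> grad \<phi> x = (\<Sum>i\<in>Basis. (\<theta> \<bullet> i) * frechet_derivative \<phi> (at x) i)" for x
  proof -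
    have lin: "linear (frechet_derivative \<phi> (at x))" using D(1) by (rule has_derivative_linear)
    have "\<theta> \<bullet> grad \<phi> x = frechet_derivative \<phi> (at x) (\<Sum>i\<in>Basis. (\<theta> \<bullet> i) *\<^sub>R i)"
      using inner_grad[OF D(1)] by (simp add: euclidean_representation)
    then show ?thesis using lin by (simp add: linear_sum linear_scale)
  qed
  moreover have "continuous_on UNIV (\<lambda>x. \<Sum>i\<in>Basis. (\<theta> \<bullet> i) * frechet_derivative \<phi> (at x) i)"
    using D(2) by (intro continuous_on_sum continuous_on_mult continuous_on_const) simp
  ultimately show "continuous_on UNIV (\<lambda>x. \<theta> \<bullet> grad \<phi> x)" by simp
qed

text \<open>A Borel representative of an element of \<open>W_dir\<close> and of its derivative, extended by zero.  Integrals
  over \<open>\<Omega>\<close> become integrals over the whole space, where Fubini applies to functions and not just to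
  classes.\<close>

definition weak_pair ::
    "'a::euclidean_space set \<Rightarrow> 'a \<Rightarrow> ('a \<Rightarrow> real) \<Rightarrow> ('a \<Rightarrow> real) \<Rightarrow> bool" where
  "weak_pair \<Omega> \<theta> u du \<longleftrightarrow>
     u \<in> borel_measurable borel \<and> du \<in> borel_measurable borel \<and>
     (\<forall>x. x \<notin> \<Omega> \<longrightarrow> u x = 0 \<and> du x = 0) \<and>
     integrable lborel (\<lambda>x. (u x)\<^sup>2) \<and> integrable lborel (\<lambda>x. (du x)\<^sup>2) \<and>
     (\<forall>\<phi>\<in>test_fun \<Omega>. (LBINT x. u x * (\<theta> \<bullet> grad \<phi> x)) = - (LBINT x. du x * \<phi> x))"

lemma weak_pair_representatives:
  fixes \<Omega> :: "'a::euclidean_space set"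
  assumes \<Omega>: "open \<Omega>" and weak: "weak_dir_deriv \<Omega> \<theta> u du"
  shows "\<exists>u0 du0. weak_pair \<Omega> \<theta> u0 du0 \<and>
    (AE x in lborel. x \<in> \<Omega> \<longrightarrow> u x = u0 x) \<and> (AE x in lborel. x \<in> \<Omega> \<longrightarrow> du x = du0 x)"
proof -
  have [measurable]: "\<Omega> \<in> sets borel" using \<Omega> by simp
  have u: "u \<in> L2 \<Omega>" and du: "du \<in> L2 \<Omega>" using weak by (auto simp: weak_dir_deriv_def)
  then have [measurable]: "u \<in> borel_measurable (lebesgue_on \<Omega>)" "du \<in> borel_measurable (lebesgue_on \<Omega>)"
    by (auto simp: L2_def)
  obtain u0 where u0 [measurable]: "u0 \<in> borel_measurable borel" and u0_out: "\<And>x. x \<notin> \<Omega> \<Longrightarrow> u0 x = 0"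
    and u0_eq: "AE x in lborel. x \<in> \<Omega> \<longrightarrow> u x = u0 x"
    by (rule borel_representative[of \<Omega> u]) auto
  obtain du0 where du0 [measurable]: "du0 \<in> borel_measurable borel" and du0_out: "\<And>x. x \<notin> \<Omega> \<Longrightarrow> du0 x = 0"
    and du0_eq: "AE x in lborel. x \<in> \<Omega> \<longrightarrow> du x = du0 x"
    by (rule borel_representative[of \<Omega> du]) auto
  note [measurable] = borel_measurable_lebesgue_on[OF u0] borel_measurable_lebesgue_on[OF du0]
  have AE: "AE x in lebesgue_on \<Omega>. u x = u0 x" "AE x in lebesgue_on \<Omega>. du x = du0 x"
    using u0_eq du0_eq by (simp_all add: AE_lebesgue_on_iff)
  have sq: "integrable lborel (\<lambda>x. (w0 x)\<^sup>2)"
    if [measurable]: "w0 \<in> borel_measurable borel" and "w \<in> L2 \<Omega>" "\<And>x. x \<notin> \<Omega> \<Longrightarrow> w0 x = 0"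
      "AE x in lebesgue_on \<Omega>. w x = w0 x" for w w0 :: "'a \<Rightarrow> real"
  proof -
    note [measurable] = borel_measurable_lebesgue_on[OF that(1)]
    have [measurable]: "w \<in> borel_measurable (lebesgue_on \<Omega>)" using that(2) by (simp add: L2_def)
    have "integrable (lebesgue_on \<Omega>) (\<lambda>x. (w x)\<^sup>2)" using that(2) by (simp add: L2_def)
    then have "integrable (lebesgue_on \<Omega>) (\<lambda>x. (w0 x)\<^sup>2)"
      by (rule integrable_cong_AE_imp) (use that(4) in \<open>auto elim!: eventually_mono\<close>)
    then have "integrable lborel (\<lambda>x. indicator \<Omega> x * (w0 x)\<^sup>2)"
      by (subst (asm) integrable_lebesgue_on_iff) auto
    also have "(\<lambda>x. indicator \<Omega> x * (w0 x)\<^sup>2) = (\<lambda>x. (w0 x)\<^sup>2)"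
      using that(3) by (auto simp: fun_eq_iff indicator_def)
    finally show ?thesis .
  qed
  have eq: "(\<integral>x. w x * g x \<partial>lebesgue_on \<Omega>) = (LBINT x. w0 x * g x)"
    if [measurable]: "w0 \<in> borel_measurable borel" and "w \<in> borel_measurable (lebesgue_on \<Omega>)"
      "\<And>x. x \<notin> \<Omega> \<Longrightarrow> w0 x = 0" "AE x in lebesgue_on \<Omega>. w x = w0 x" "continuous_on UNIV g" for w w0 g :: "'a \<Rightarrow> real"
  proof -
    have [measurable]: "g \<in> borel_measurable borel" using that(5) by (rule borel_measurable_continuous_onI)
    have g: "g \<in> borel_measurable (lebesgue_on \<Omega>)" by (rule borel_measurable_lebesgue_on) measurable
    have "(\<integral>x. w x * g x \<partial>lebesgue_on \<Omega>) = (\<integral>x. w0 x * g x \<partial>lebesgue_on \<Omega>)"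
    proof (rule integral_cong_AE)
      show "(\<lambda>x. w x * g x) \<in> borel_measurable (lebesgue_on \<Omega>)"
        by (rule borel_measurable_times[OF that(2) g])
      show "(\<lambda>x. w0 x * g x) \<in> borel_measurable (lebesgue_on \<Omega>)"
        by (rule borel_measurable_times[OF borel_measurable_lebesgue_on[OF that(1)] g])
      show "AE x in lebesgue_on \<Omega>. w x * g x = w0 x * g x"
        using that(4) by eventually_elim simp
    qed
    also have "\<dots> = (LBINT x. indicator \<Omega> x * (w0 x * g x))"
      by (rule integral_lebesgue_on_eq) auto
    also have "\<dots> = (LBINT x. w0 x * g x)"
      by (intro Bochner_Integration.integral_cong) (use that(3) in \<open>auto simp: indicator_def\<close>)
    finally show ?thesis .
  qed
  have "(LBINT x. u0 x * (\<theta> \<bullet> grad \<phi> x)) = - (LBINT x. du0 x * \<phi> x)"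
    if \<phi>: "\<phi> \<in> test_fun \<Omega>" for \<phi>
  proof -
    note c = test_fun_continuous[OF \<phi>]
    have "(LBINT x. u0 x * (\<theta> \<bullet> grad \<phi> x)) = (\<integral>x. u x * (\<theta> \<bullet> grad \<phi> x) \<partial>lebesgue_on \<Omega>)"
      by (rule eq[symmetric]) (use AE u0_out c in auto)
    also have "\<dots> = - (\<integral>x. du x * \<phi> x \<partial>lebesgue_on \<Omega>)"
      using weak \<phi> by (auto simp: weak_dir_deriv_def)
    also have "(\<integral>x. du x * \<phi> x \<partial>lebesgue_on \<Omega>) = (LBINT x. du0 x * \<phi> x)"
      by (rule eq) (use AE du0_out c in auto)
    finally show ?thesis .
  qed
  then have "weak_pair \<Omega> \<theta> u0 du0"
    using u0 du0 u0_out du0_out sq[OF u0 u u0_out AE(1)] sq[OF du0 du du0_out AE(2)]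
    by (simp add: weak_pair_def)
  then show ?thesis using u0_eq du0_eq by blast
qed

lemma integrable_mult_if_squares:
  fixes u v :: "'a \<Rightarrow> real"
  assumes [measurable]: "u \<in> borel_measurable M" "v \<in> borel_measurable M"
    and "integrable M (\<lambda>x. (u x)\<^sup>2)" "integrable M (\<lambda>x. (v x)\<^sup>2)"
  shows "integrable M (\<lambda>x. u x * v x)"
proof (rule Bochner_Integration.integrable_bound)
  show "integrable M (\<lambda>x. (u x)\<^sup>2 + (v x)\<^sup>2)" using assms by simp
  show "AE x in M. norm (u x * v x) \<le> norm ((u x)\<^sup>2 + (v x)\<^sup>2)"
  proof (rule AE_I2)
    fix x
    have "0 \<le> (\<bar>u x\<bar> - \<bar>v x\<bar>)\<^sup>2" by simp
    then have "2 * (\<bar>u x\<bar> * \<bar>v x\<bar>) \<le> (u x)\<^sup>2 + (v x)\<^sup>2" by (simp add: power2_diff)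
    moreover have "0 \<le> \<bar>u x\<bar> * \<bar>v x\<bar>" by simp
    ultimately have "\<bar>u x\<bar> * \<bar>v x\<bar> \<le> (u x)\<^sup>2 + (v x)\<^sup>2" by linarith
    then show "norm (u x * v x) \<le> norm ((u x)\<^sup>2 + (v x)\<^sup>2)" by (simp add: abs_mult)
  qed
qed measurable

text \<open>The function is its own product with the indicator of \<open>S\<close>, which is square integrable because bounded
  sets have finite measure.\<close>

lemma integrable_if_square:
  fixes u :: "'a::euclidean_space \<Rightarrow> real"
  assumes [measurable]: "u \<in> borel_measurable borel" and S: "S \<in> sets borel" "bounded S"
    and out: "\<And>x. x \<notin> S \<Longrightarrow> u x = 0" and sq: "integrable lborel (\<lambda>x. (u x)\<^sup>2)"
  shows "integrable lborel u"
proof -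
  have "emeasure lborel S < \<infinity>"
    using S(2) by (rule emeasure_bounded_finite)
  then have "integrable lborel (indicator S :: 'a \<Rightarrow> real)"
    using S by (intro integrable_real_indicator) auto
  moreover have "(indicator S x)\<^sup>2 = (indicator S x :: real)" for x by (simp add: indicator_def)
  ultimately have "integrable lborel (\<lambda>x. u x * indicator S x)"
    using S sq by (intro integrable_mult_if_squares) auto
  also have "(\<lambda>x. u x * indicator S x) = u" using out by (auto simp: fun_eq_iff indicator_def)
  finally show ?thesis .
qed

lemma weak_pairD:
  assumes "weak_pair \<Omega> \<theta> u du"
  shows "u \<in> borel_measurable borel" "du \<in> borel_measurable borel"
    "x \<notin> \<Omega> \<Longrightarrow> u x = 0" "x \<notin> \<Omega> \<Longrightarrow> du x = 0"
    "integrable lborel (\<lambda>x. (u x)\<^sup>2)" "integrable lborel (\<lambda>x. (du x)\<^sup>2)"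
    "\<phi> \<in> test_fun \<Omega> \<Longrightarrow>
      (LBINT x. u x * (\<theta> \<bullet> grad \<phi> x)) = - (LBINT x. du x * \<phi> x)"
  using assms by (auto simp: weak_pair_def)

lemma weak_pair_integrable:
  assumes "open \<Omega>" "bounded \<Omega>" and pair: "weak_pair \<Omega> \<theta> u du"
  shows "integrable lborel u" "integrable lborel du"
  by (rule integrable_if_square[of _ \<Omega>]; use assms weak_pairD[OF pair] in simp)+

section \<open>Components of open subsets of the line\<close>

lemma open_interval_component:
  fixes \<omega> :: "real set"
  assumes "open \<omega>" "bounded \<omega>" "C \<in> components \<omega>"
  shows "C = {Inf C<..<Sup C}" and "Inf C < Sup C"
proof -
  have C: "open C" "connected C" "C \<noteq> {}" "C \<subseteq> \<omega>" "bounded C"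
    using assms by (auto intro: open_components in_components_connected dest: in_components_nonempty in_components_subset bounded_subset)
  have bdd: "bdd_above C" "bdd_below C" using C(5) by (auto intro: bounded_imp_bdd_above bounded_imp_bdd_below)
  have inside: "Inf C < x \<and> x < Sup C" if x: "x \<in> C" for x
  proof -
    obtain e where e: "e > 0" "ball x e \<subseteq> C" using C(1) x by (meson open_contains_ball)
    have "x - e / 2 \<in> C" "x + e / 2 \<in> C" using e by (auto simp: dist_real_def intro!: subsetD[OF e(2)])
    then have "Inf C \<le> x - e / 2" "x + e / 2 \<le> Sup C" using bdd by (auto intro: cInf_lower cSup_upper)
    then show ?thesis using e(1) by linarith
  qed
  moreover have "x \<in> C" if x: "Inf C < x" "x < Sup C" for x
  proof -
    obtain a where "a \<in> C" "a < x" using x(1) C(3) bdd by (auto simp: cInf_less_iff)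
    moreover obtain b where "b \<in> C" "x < b" using x(2) C(3) bdd by (auto simp: less_cSup_iff)
    ultimately show ?thesis using connectedD_interval[OF C(2), of a b x] by simp
  qed
  ultimately show "C = {Inf C<..<Sup C}" by auto
  show "Inf C < Sup C" using C(3) inside by fastforce
qed

text \<open>If an end belonged to \<open>\<omega>\<close>, adjoining it would give a larger connected subset.\<close>

lemma component_endpoints:
  fixes \<omega> :: "real set"
  assumes "{\<alpha><..<\<beta>} \<in> components \<omega>"
  shows "\<alpha> < \<beta>" "\<alpha> \<notin> \<omega>" "\<beta> \<notin> \<omega>" "{\<alpha><..<\<beta>} \<subseteq> \<omega>"
proof -
  show "\<alpha> < \<beta>" using in_components_nonempty[OF assms] by auto
  show sub: "{\<alpha><..<\<beta>} \<subseteq> \<omega>" by (rule in_components_subset[OF assms])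
  show "\<alpha> \<notin> \<omega>"
  proof
    assume "\<alpha> \<in> \<omega>"
    then have "{\<alpha>..<\<beta>} \<subseteq> \<omega>" using sub by (auto simp: less_le)
    moreover have "{\<alpha><..<\<beta>} \<inter> {\<alpha>..<\<beta>} = {\<alpha><..<\<beta>}" by auto
    ultimately have "{\<alpha>..<\<beta>} \<subseteq> {\<alpha><..<\<beta>}"
      using in_components_nonempty[OF assms] by (intro components_maximal[OF assms]) simp_all
    then show False using \<open>\<alpha> < \<beta>\<close> by auto
  qed
  show "\<beta> \<notin> \<omega>"
  proof
    assume "\<beta> \<in> \<omega>"
    then have "{\<alpha><..\<beta>} \<subseteq> \<omega>" using sub by (auto simp: less_le)
    moreover have "{\<alpha><..<\<beta>} \<inter> {\<alpha><..\<beta>} = {\<alpha><..<\<beta>}" by auto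
    ultimately have "{\<alpha><..\<beta>} \<subseteq> {\<alpha><..<\<beta>}"
      using in_components_nonempty[OF assms] by (intro components_maximal[OF assms]) simp_all
    then show False using \<open>\<alpha> < \<beta>\<close> by auto
  qed
qed

lemma interval_componentI:
  fixes \<omega> :: "real set"
  assumes "\<alpha> < \<beta>" "\<alpha> \<notin> \<omega>" "\<beta> \<notin> \<omega>" "{\<alpha><..<\<beta>} \<subseteq> \<omega>"
  shows "{\<alpha><..<\<beta>} \<in> components \<omega>"
  unfolding in_components_maximal
proof (intro conjI allI impI; (elim conjE)?)
  have mid: "(\<alpha> + \<beta>) / 2 \<in> {\<alpha><..<\<beta>}" using \<open>\<alpha> < \<beta>\<close> by auto
  show "{\<alpha><..<\<beta>} \<noteq> {}" using mid by blast
  fix D assume D: "{\<alpha><..<\<beta>} \<subseteq> D" "D \<subseteq> \<omega>" "connected D"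
  then have m: "(\<alpha> + \<beta>) / 2 \<in> D" using mid by blast
  have "x \<in> {\<alpha><..<\<beta>}" if "x \<in> D" for x
  proof (rule ccontr)
    assume "x \<notin> {\<alpha><..<\<beta>}"
    then consider "x \<le> \<alpha>" | "\<beta> \<le> x" by fastforce
    then show False
    proof cases
      case 1
      then have "\<alpha> \<in> D" using connectedD_interval[OF D(3) that m, of \<alpha>] mid by simp
      then show False using assms D by auto
    next
      case 2
      then have "\<beta> \<in> D" using connectedD_interval[OF D(3) m that, of \<beta>] mid by simp
      then show False using assms D by auto
    qed
  qed
  then show "D = {\<alpha><..<\<beta>}" using D(1) by blast
qed (use assms in auto)

text \<open>Components of an open set are open and disjoint, so there are countably many.  They are listed as a
  sequence of sets, padded with empty ones, to which countable additivity applies.\<close>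

lemma enumerate_components:
  fixes \<omega> :: "real set"
  assumes "open \<omega>"
  shows "\<exists>A :: nat \<Rightarrow> real set. disjoint_family A \<and> (\<Union>n. A n) = \<omega> \<and>
    (\<forall>n. A n \<noteq> {} \<longrightarrow> A n \<in> components \<omega>) \<and> (\<forall>n. A n \<in> sets borel)"
proof -
  have count: "countable (components \<omega>)" 
  proof (rule countable_disjoint_open_subsets)
    show "open C" if "C \<in> components \<omega>" for C by (rule open_components[OF assms that])
    show "pairwise disjnt (components \<omega>)"
      unfolding pairwise_def disjnt_def using components_nonoverlap[of _ \<omega>] by blast
  qed
  define A where "A n = (if n \<in> to_nat_on (components \<omega>) ` components \<omega>
    then from_nat_into (components \<omega>) n else {})" for n
  have A: "A (to_nat_on (components \<omega>) C) = C" if "C \<in> components \<omega>" for C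
    using that count by (simp add: A_def)
  have cases: "A n = {} \<or> (\<exists>C\<in>components \<omega>. n = to_nat_on (components \<omega>) C \<and> A n = C)" for n
    using count by (auto simp: A_def)
  show ?thesis
  proof (intro exI conjI allI impI)
    show "disjoint_family A"
      unfolding disjoint_family_on_def
    proof (intro ballI impI)
      fix m n :: nat assume "m \<noteq> n"
      then show "A m \<inter> A n = {}"
        using cases[of m] cases[of n] components_nonoverlap[of _ \<omega>] by blast
    qed
    show comp: "A n \<in> components \<omega>" if "A n \<noteq> {}" for n using cases[of n] that by auto
    show "(\<Union>n. A n) = \<omega>"
    proof
      show "(\<Union>n. A n) \<subseteq> \<omega>" using comp in_components_subset by blast
      show "\<omega> \<subseteq> (\<Union>n. A n)"
      proof
        fix x assume "x \<in> \<omega>"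
        then obtain C where "C \<in> components \<omega>" "x \<in> C" using Union_components[of \<omega>] by blast
        then show "x \<in> (\<Union>n. A n)" using A by blast
      qed
    qed
    show "A n \<in> sets borel" for n
      using comp[of n] assms open_components[of \<omega>] by (cases "A n = {}") auto
  qed
qed

lemma integral_zero_if_components:
  fixes \<omega> :: "real set" and h :: "real \<Rightarrow> real"
  assumes "open \<omega>" and int: "integrable lborel (\<lambda>s. indicator \<omega> s * h s)"
    and comp: "\<And>C. C \<in> components \<omega> \<Longrightarrow> (LBINT s. indicator C s * h s) = 0"
  shows "(LBINT s. indicator \<omega> s * h s) = 0"
proof -
  obtain A :: "nat \<Rightarrow> real set" where A: "disjoint_family A" "(\<Union>n. A n) = \<omega>"
    "\<And>n. A n \<noteq> {} \<Longrightarrow> A n \<in> components \<omega>" "\<And>n. A n \<in> sets borel"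
    using enumerate_components[OF assms(1)] by blast
  have "(LINT s:(\<Union>n. A n)|lborel. h s) = (\<Sum>n. (LINT s:(A n)|lborel. h s))"
    using A(1,4) int by (intro lebesgue_integral_countable_add)
      (auto simp: disjoint_family_on_def set_integrable_def A(2))
  moreover have "(LINT s:(A n)|lborel. h s) = 0" for n
    using comp[OF A(3), of n] by (cases "A n = {}") (simp_all add: set_lebesgue_integral_def)
  ultimately show ?thesis by (simp add: set_lebesgue_integral_def A(2))
qed

lemma nn_integral_le_if_components:
  fixes \<omega> :: "real set" and g h :: "real \<Rightarrow> ennreal"
  assumes "open \<omega>" and [measurable]: "g \<in> borel_measurable borel" "h \<in> borel_measurable borel"
    and comp: "\<And>C. C \<in> components \<omega> \<Longrightarrow>
      (\<integral>\<^sup>+s. g s * indicator C s \<partial>lborel) \<le> (\<integral>\<^sup>+s. h s * indicator C s \<partial>lborel)"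
  shows "(\<integral>\<^sup>+s. g s * indicator \<omega> s \<partial>lborel) \<le> (\<integral>\<^sup>+s. h s * indicator \<omega> s \<partial>lborel)"
proof -
  obtain A :: "nat \<Rightarrow> real set" where A: "disjoint_family A" "(\<Union>n. A n) = \<omega>"
    "\<And>n. A n \<noteq> {} \<Longrightarrow> A n \<in> components \<omega>" "\<And>n. A n \<in> sets borel"
    using enumerate_components[OF assms(1)] by blast
  have sum: "(\<integral>\<^sup>+s. f s * indicator \<omega> s \<partial>lborel) = (\<Sum>n. \<integral>\<^sup>+s. f s * indicator (A n) s \<partial>lborel)"
    if [measurable]: "f \<in> borel_measurable borel" for f :: "real \<Rightarrow> ennreal"
  proof -
    have "(\<Sum>n. emeasure (density lborel f) (A n)) = emeasure (density lborel f) (\<Union>n. A n)"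
      using A(1,4) by (intro suminf_emeasure) auto
    then show ?thesis using A(4) assms(1) by (simp add: emeasure_density A(2))
  qed
  show ?thesis
    unfolding sum[OF assms(2)] sum[OF assms(3)]
  proof (rule suminf_le)
    show "(\<integral>\<^sup>+s. g s * indicator (A n) s \<partial>lborel) \<le> (\<integral>\<^sup>+s. h s * indicator (A n) s \<partial>lborel)" for n
      using comp[OF A(3), of n] by (cases "A n = {}") simp_all
  qed auto
qed

section \<open>Existence and values of directional traces\<close>

lemma open_line_section: "open \<Omega> \<Longrightarrow> open (line_section \<Omega> \<theta> y)"
proof -
  assume "open \<Omega>"
  then have "open ((\<lambda>s. s *\<^sub>R \<theta> + y) -` \<Omega>)"
    by (intro open_vimage continuous_intros)
  then show ?thesis by (simp add: line_section_def vimage_def)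
qed

lemma bounded_line_section:
  assumes "norm \<theta> = 1" "bounded \<Omega>"
  shows "bounded (line_section \<Omega> \<theta> y)"
proof -
  obtain B where B: "\<And>x. x \<in> \<Omega> \<Longrightarrow> norm x \<le> B" using assms(2) by (auto simp: bounded_iff)
  have "norm s \<le> B + norm y" if "s \<in> line_section \<Omega> \<theta> y" for s
  proof -
    have "norm (s *\<^sub>R \<theta> + y) \<le> B" using that B by (auto simp: line_section_def)
    moreover have "norm (s *\<^sub>R \<theta>) \<le> norm (s *\<^sub>R \<theta> + y) + norm y"
      using norm_triangle_ineq4[of "s *\<^sub>R \<theta> + y" y] by simp
    ultimately show ?thesis using assms(1) by simp
  qed
  then show ?thesis by (auto simp: bounded_iff)
qed

lemma test_fun_is_primitive:
  fixes \<phi> :: "real \<Rightarrow> real"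
  assumes "\<phi> \<in> test_fun \<omega>"
  shows "is_primitive \<phi> (\<lambda>s. indicator {\<alpha>..\<beta>} s * (1 \<bullet> grad \<phi> s)) \<alpha> \<beta>"
  unfolding is_primitive_def
proof
  fix t assume t: "t \<in> {\<alpha>..\<beta>}"
  have Ck: "Ck (Suc 0) \<phi>" using assms unfolding test_fun_def by blast
  note D = Ck_SucD(1)[OF Ck]
  have deriv: "(\<phi> has_vector_derivative 1 \<bullet> grad \<phi> x) (at x)" for x
  proof -
    have lin: "linear (frechet_derivative \<phi> (at x))" using D by (rule has_derivative_linear)
    have "frechet_derivative \<phi> (at x) h = h *\<^sub>R (1 \<bullet> grad \<phi> x)" for h
      using linear_scale[OF lin, of h 1] inner_grad[OF D, of 1 x] by simp
    then have "frechet_derivative \<phi> (at x) = (\<lambda>h. h *\<^sub>R (1 \<bullet> grad \<phi> x))" by (rule ext)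
    then show ?thesis using D[of x] by (simp add: has_vector_derivative_def)
  qed
  have "(LBINT s. indicator {\<alpha>..t} s *\<^sub>R (1 \<bullet> grad \<phi> s)) = \<phi> t - \<phi> \<alpha>"
    using t deriv continuous_on_subset[OF test_fun_continuous(2)[OF assms, of 1]]
    by (intro integral_FTC_atLeastAtMost) (auto intro: has_vector_derivative_at_within)
  also have "(LBINT s. indicator {\<alpha>..t} s *\<^sub>R (1 \<bullet> grad \<phi> s)) =
      (LBINT s. indicator {\<alpha>..t} s * (indicator {\<alpha>..\<beta>} s * (1 \<bullet> grad \<phi> s)))"
    using t by (intro Bochner_Integration.integral_cong) (auto simp: indicator_def)
  finally show "\<phi> t = \<phi> \<alpha> + (LBINT s. indicator {\<alpha>..t} s * (indicator {\<alpha>..\<beta>} s * (1 \<bullet> grad \<phi> s)))"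
    by simp
qed

lemma integrable_indicator_mult_continuous:
  fixes u g :: "real \<Rightarrow> real"
  assumes u: "integrable lborel u" and "bounded \<omega>" "\<omega> \<in> sets borel" and g: "continuous_on UNIV g"
  shows "integrable lborel (\<lambda>s. indicator \<omega> s * (u s * g s))"
proof -
  have "compact (g ` closure \<omega>)"
    using g assms(2) by (intro compact_continuous_image) (auto intro: continuous_on_subset)
  then obtain B where B: "\<And>s. s \<in> closure \<omega> \<Longrightarrow> \<bar>g s\<bar> \<le> B"
    using compact_imp_bounded[of "g ` closure \<omega>"] by (auto simp: bounded_iff)
  have [measurable]: "g \<in> borel_measurable borel" using g by (rule borel_measurable_continuous_onI)
  have [measurable]: "u \<in> borel_measurable borel" using u by simp
  have bound: "norm (indicator \<omega> s * (u s * g s)) \<le> norm (B * u s)" for s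
  proof (cases "s \<in> \<omega>")
    case True
    then have "\<bar>g s\<bar> \<le> \<bar>B\<bar>" using B[OF subsetD[OF closure_subset True]] by simp
    then have "\<bar>g s\<bar> * \<bar>u s\<bar> \<le> \<bar>B\<bar> * \<bar>u s\<bar>" by (rule mult_right_mono) simp
    then show ?thesis using True by (simp add: abs_mult mult.commute)
  qed simp
  show ?thesis
    by (rule Bochner_Integration.integrable_bound[OF integrable_mult_right[OF u, of B]])
      (use assms(3) bound in auto)
qed

text \<open>A test function on \<open>\<omega>\<close> vanishes at the ends of each component, because the ends are outside \<open>\<omega>\<close>.
  The product rule therefore gives zero on each component, and the components are summed up.\<close>

lemma weak_deriv_if_primitives:
  fixes u f :: "real \<Rightarrow> real"
  assumes \<omega>: "open \<omega>" "bounded \<omega>"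
    and u: "integrable lborel u" "integrable lborel (\<lambda>s. (u s)\<^sup>2)"
    and f: "integrable lborel f" "integrable lborel (\<lambda>s. (f s)\<^sup>2)"
    and prim: "\<And>\<alpha> \<beta>. {\<alpha><..<\<beta>} \<in> components \<omega> \<Longrightarrow> agrees_with_primitive u f \<alpha> \<beta>"
  shows "weak_dir_deriv \<omega> 1 u f"
  unfolding weak_dir_deriv_def
proof (intro conjI ballI)
  have [measurable]: "\<omega> \<in> sets borel" using \<omega> by simp
  have m [measurable]: "u \<in> borel_measurable borel" "f \<in> borel_measurable borel" using u f by auto
  show "u \<in> L2 \<omega>" "f \<in> L2 \<omega>"
    using borel_measurable_lebesgue_on[OF m(1), of \<omega>] borel_measurable_lebesgue_on[OF m(2), of \<omega>]
      integrable_indicator_mult[OF u(2), of \<omega>] integrable_indicator_mult[OF f(2), of \<omega>]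
    by (auto simp: L2_def integrable_lebesgue_on_iff)
  fix \<phi> assume \<phi>: "\<phi> \<in> test_fun \<omega>"
  note cont = test_fun_continuous[OF \<phi>]
  have [measurable]: "\<phi> \<in> borel_measurable borel" "(\<lambda>s. 1 \<bullet> grad \<phi> s) \<in> borel_measurable borel"
    by (rule borel_measurable_continuous_onI[OF cont(1)], rule borel_measurable_continuous_onI[OF cont(2)])
  then have [measurable]: "grad \<phi> \<in> borel_measurable borel" by simp
  define h where "h s = u s * (1 \<bullet> grad \<phi> s) + f s * \<phi> s" for s
  have int: "integrable lborel (\<lambda>s. indicator \<omega> s * (u s * (1 \<bullet> grad \<phi> s)))"
    "integrable lborel (\<lambda>s. indicator \<omega> s * (f s * \<phi> s))"
    by (rule integrable_indicator_mult_continuous[OF u(1) \<omega>(2) _ cont(2)], simp)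
      (rule integrable_indicator_mult_continuous[OF f(1) \<omega>(2) _ cont(1)], simp)
  have "(LBINT s. indicator \<omega> s * h s) = 0"
  proof (rule integral_zero_if_components[OF \<omega>(1)])
    show "integrable lborel (\<lambda>s. indicator \<omega> s * h s)"
      using int by (simp add: h_def distrib_left)
    fix C assume "C \<in> components \<omega>"
    define \<alpha> \<beta> where "\<alpha> = Inf C" and "\<beta> = Sup C"
    have C: "C = {\<alpha><..<\<beta>}"
      unfolding \<alpha>_def \<beta>_def by (rule open_interval_component[OF \<omega> \<open>C \<in> components \<omega>\<close>])
    note comp = \<open>C \<in> components \<omega>\<close>[unfolded C]
    note ends = component_endpoints[OF comp]
    have "closure {s. \<phi> s \<noteq> 0} \<subseteq> \<omega>" using \<phi> by (simp add: test_fun_def)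
    then have "\<phi> s = 0" if "s \<notin> \<omega>" for s
      using that closure_subset[of "{s. \<phi> s \<noteq> 0}"] by blast
    then have \<phi>0: "\<phi> \<alpha> = 0" "\<phi> \<beta> = 0" using ends by auto
    obtain W where W: "is_primitive W f \<alpha> \<beta>" "AE s in lborel. s \<in> {\<alpha><..<\<beta>} \<longrightarrow> u s = W s"
      using prim[OF comp] unfolding agrees_with_primitive_def by blast
    have g: "integrable lborel (\<lambda>s. indicator {\<alpha>..\<beta>} s * (1 \<bullet> grad \<phi> s))"
      using borel_integrable_atLeastAtMost'[OF continuous_on_subset[OF cont(2)[of 1]], of \<alpha> \<beta>]
      by (simp add: set_integrable_def)
    note P = is_primitive_product[OF f(1) g W(1) test_fun_is_primitive[OF \<phi>] less_imp_le[OF ends(1)]]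
    have "(LBINT s. indicator C s * h s) =
        (LBINT s. indicator {\<alpha><..<\<beta>} s * (W s * (indicator {\<alpha>..\<beta>} s * (1 \<bullet> grad \<phi> s)) + \<phi> s * f s))"
    proof (rule integral_cong_AE)
      show "(\<lambda>s. indicator C s * h s) \<in> borel_measurable lborel"
        unfolding C h_def by measurable
      show "(\<lambda>s. indicator {\<alpha><..<\<beta>} s * (W s * (indicator {\<alpha>..\<beta>} s * (1 \<bullet> grad \<phi> s)) + \<phi> s * f s)) \<in> borel_measurable lborel"
        using P(1) by (rule borel_measurable_integrable)
      show "AE s in lborel. indicator C s * h s =
          indicator {\<alpha><..<\<beta>} s * (W s * (indicator {\<alpha>..\<beta>} s * (1 \<bullet> grad \<phi> s)) + \<phi> s * f s)"
        using W(2) by eventually_elim (auto simp: C h_def indicator_def)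
    qed
    also have "\<dots> = 0" unfolding P(2) by (simp add: \<phi>0)
    finally show "(LBINT s. indicator C s * h s) = 0" .
  qed
  also have "(LBINT s. indicator \<omega> s * h s) =
      (\<integral>s. u s * (1 \<bullet> grad \<phi> s) \<partial>lebesgue_on \<omega>) + (\<integral>s. f s * \<phi> s \<partial>lebesgue_on \<omega>)"
    using int by (simp add: integral_lebesgue_on_eq h_def distrib_left)
  finally show "(\<integral>s. u s * (1 \<bullet> grad \<phi> s) \<partial>lebesgue_on \<omega>) = - (\<integral>s. f s * \<phi> s \<partial>lebesgue_on \<omega>)"
    by simp
qed

text \<open>Otherwise the two functions would differ on an interval to the left of the end.\<close>

lemma continuous_AE_eq_right_endpoint:
  fixes v w :: "real \<Rightarrow> real"
  assumes "\<alpha> < \<beta>" "continuous_on {\<alpha><..\<beta>} v" "continuous_on {\<alpha><..\<beta>} w"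
    and AE: "AE s in lborel. s \<in> {\<alpha><..<\<beta>} \<longrightarrow> v s = w s"
  shows "v \<beta> = w \<beta>"
proof (rule ccontr)
  assume "v \<beta> \<noteq> w \<beta>"
  moreover have "continuous_on {\<alpha><..\<beta>} (\<lambda>s. v s - w s)" using assms by (intro continuous_intros)
  ultimately obtain d where d: "d > 0" "\<And>s. s \<in> {\<alpha><..\<beta>} \<Longrightarrow> dist s \<beta> < d \<Longrightarrow> v s - w s \<noteq> 0"
    using continuous_on_avoid[of "{\<alpha><..\<beta>}" "\<lambda>s. v s - w s" \<beta> 0] assms(1)
    by (auto simp: dist_commute)
  define \<gamma> where "\<gamma> = max \<alpha> (\<beta> - d)"
  have "\<gamma> < \<beta>" using assms(1) d(1) by (simp add: \<gamma>_def)
  have "AE s in lborel. s \<notin> {\<gamma><..<\<beta>}"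
    using AE
  proof eventually_elim
    case (elim s)
    show ?case
    proof
      assume s: "s \<in> {\<gamma><..<\<beta>}"
      then have "v s - w s \<noteq> 0" by (intro d(2)) (auto simp: \<gamma>_def dist_real_def)
      moreover have "v s = w s" using elim s by (auto simp: \<gamma>_def)
      ultimately show False by simp
    qed
  qed
  then have "emeasure lborel {\<gamma><..<\<beta>} = 0"
    by (subst (asm) AE_iff_measurable[of "{\<gamma><..<\<beta>}"]) auto
  then show False using \<open>\<gamma> < \<beta>\<close> by simp
qed

lemma component_unique_left:
  assumes "{\<alpha><..<\<beta>} \<in> components \<omega>" "{\<alpha>'<..<\<beta>} \<in> components (\<omega> :: real set)"
  shows "\<alpha> = \<alpha>'"
proof -
  have "\<alpha> < \<beta>" "\<alpha>' < \<beta>" using component_endpoints assms by auto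
  then have "(max \<alpha> \<alpha>' + \<beta>) / 2 \<in> {\<alpha><..<\<beta>} \<inter> {\<alpha>'<..<\<beta>}" by auto
  then have "{\<alpha><..<\<beta>} = {\<alpha>'<..<\<beta>}" using components_nonoverlap[OF assms] by blast
  then have "Inf {\<alpha><..<\<beta>} = Inf {\<alpha>'<..<\<beta>}" by simp
  then show ?thesis using \<open>\<alpha> < \<beta>\<close> \<open>\<alpha>' < \<beta>\<close> by simp
qed

text \<open>The representative \<open>u'\<close> in the definition of a trace agrees with \<open>u0\<close> almost everywhere on almost
  every line.  So the function \<open>w\<close> from that definition and any \<open>W\<close> as in the statement coincide up to the
  right end.\<close>

lemma AE_trace_value:
  fixes \<theta> :: "'a::euclidean_space"
  assumes \<theta>: "norm \<theta> = 1" and \<Omega>: "open \<Omega>"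
    and eq: "AE x in lborel. x \<in> \<Omega> \<longrightarrow> u x = u0 x" and g: "g \<in> dir_traces \<Omega> \<theta> u"
  shows "AE y in hyp_borel \<theta>. \<forall>\<alpha> \<beta> W. {\<alpha><..<\<beta>} \<in> line_intervals \<Omega> \<theta> y \<and>
    continuous_on {\<alpha><..\<beta>} W \<and> (AE s in lborel. s \<in> {\<alpha><..<\<beta>} \<longrightarrow> u0 (s *\<^sub>R \<theta> + y) = W s) \<longrightarrow>
    g (\<beta> *\<^sub>R \<theta> + y) = W \<beta>"
proof -
  obtain u' A where u': "AE x in lebesgue_on \<Omega>. u' x = u x"
    and A: "proj \<theta> ` \<Omega> - A \<in> null_sets (hyp_lebesgue \<theta>)"
    and tr: "\<And>y \<alpha> \<beta>. y \<in> A \<Longrightarrow> {\<alpha><..<\<beta>} \<in> line_intervals \<Omega> \<theta> y \<Longrightarrow>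
      \<exists>w. continuous_on {\<alpha><..\<beta>} w \<and> (AE s in lebesgue_on {\<alpha><..<\<beta>}. w s = u' (s *\<^sub>R \<theta> + y)) \<and>
          g (\<beta> *\<^sub>R \<theta> + y) = w \<beta>"
    using g unfolding dir_traces_def by blast
  have "AE x in lborel. x \<in> \<Omega> \<longrightarrow> u' x = u x" using u' \<Omega> by (simp add: AE_lebesgue_on_iff)
  with eq have "AE x in lborel. x \<in> \<Omega> \<longrightarrow> u' x = u0 x" by eventually_elim auto
  from AE_lborel_lines[OF \<theta> this] AE_not_null_hyp_lebesgue[OF A] AE_hyp_borel_in_hyp[of \<theta>] show ?thesis
  proof eventually_elim
    case (elim y)
    show ?case
    proof (intro allI impI, elim conjE)
      fix \<alpha> \<beta> W
      assume comp: "{\<alpha><..<\<beta>} \<in> line_intervals \<Omega> \<theta> y" and W: "continuous_on {\<alpha><..\<beta>} W"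
        "AE s in lborel. s \<in> {\<alpha><..<\<beta>} \<longrightarrow> u0 (s *\<^sub>R \<theta> + y) = W s"
      note ends = component_endpoints[OF comp[unfolded line_intervals_def]]
      have "(\<alpha> + \<beta>) / 2 \<in> {\<alpha><..<\<beta>}" using ends(1) by auto
      then have "((\<alpha> + \<beta>) / 2) *\<^sub>R \<theta> + y \<in> \<Omega>" using ends(4) unfolding line_section_def by blast
      then have "proj \<theta> (((\<alpha> + \<beta>) / 2) *\<^sub>R \<theta> + y) \<in> proj \<theta> ` \<Omega>" by (rule imageI)
      then have "y \<in> A" using proj_line[OF \<theta> elim(3)] elim(2) by simp
      obtain w where w: "continuous_on {\<alpha><..\<beta>} w" "g (\<beta> *\<^sub>R \<theta> + y) = w \<beta>"
        "AE s in lebesgue_on {\<alpha><..<\<beta>}. w s = u' (s *\<^sub>R \<theta> + y)"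
        using tr[OF \<open>y \<in> A\<close> comp] by blast
      have "AE s in lborel. s \<in> {\<alpha><..<\<beta>} \<longrightarrow> w s = u' (s *\<^sub>R \<theta> + y)"
        using w(3) by (simp add: AE_lebesgue_on_iff)
      with W(2) elim(1) have "AE s in lborel. s \<in> {\<alpha><..<\<beta>} \<longrightarrow> w s = W s"
      proof eventually_elim
        case (elim s)
        show ?case
        proof
          assume s: "s \<in> {\<alpha><..<\<beta>}"
          then have "s *\<^sub>R \<theta> + y \<in> \<Omega>" using ends(4) unfolding line_section_def by blast
          then show "w s = W s" using elim s by auto
        qed
      qed
      from continuous_AE_eq_right_endpoint[OF ends(1) w(1) W(1) this] show "g (\<beta> *\<^sub>R \<theta> + y) = W \<beta>"
        using w(2) by simp
    qed
  qed
qed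

text \<open>The trace at \<open>z\<close> is the value at \<open>z\<close> of the primitive on the component that ends there.  The lines on
  which such primitives exist also have sections in \<open>H1\<close>, by \<open>weak_deriv_if_primitives\<close>.\<close>

lemma dir_traces_nonempty:
  fixes \<theta> :: "'a::euclidean_space"
  assumes \<theta>: "norm \<theta> = 1" and \<Omega>: "open \<Omega>" "bounded \<Omega>" and weak: "weak_dir_deriv \<Omega> \<theta> u du"
  shows "dir_traces \<Omega> \<theta> u \<noteq> {}"
proof -
  obtain u0 du0 where pair: "weak_pair \<Omega> \<theta> u0 du0" and eq: "AE x in lborel. x \<in> \<Omega> \<longrightarrow> u x = u0 x"
    using weak_pair_representatives[OF \<Omega>(1) weak] by blast
  note int = weak_pair_integrable[OF \<Omega> pair] and sq = weak_pairD(5,6)[OF pair]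
  define good where "good y \<longleftrightarrow> integrable lborel (\<lambda>s. u0 (s *\<^sub>R \<theta> + y)) \<and>
    integrable lborel (\<lambda>s. du0 (s *\<^sub>R \<theta> + y)) \<and>
    integrable lborel (\<lambda>s. (u0 (s *\<^sub>R \<theta> + y))\<^sup>2) \<and> integrable lborel (\<lambda>s. (du0 (s *\<^sub>R \<theta> + y))\<^sup>2) \<and>
    (\<forall>\<alpha> \<beta>. \<alpha> < \<beta> \<and> {\<alpha><..<\<beta>} \<subseteq> line_section \<Omega> \<theta> y \<longrightarrow>
      agrees_with_primitive (\<lambda>s. u0 (s *\<^sub>R \<theta> + y)) (\<lambda>s. du0 (s *\<^sub>R \<theta> + y)) \<alpha> \<beta>)" for y
  have prim: "AE y in hyp_borel \<theta>. \<forall>\<alpha> \<beta>. \<alpha> < \<beta> \<and> {\<alpha><..<\<beta>} \<subseteq> line_section \<Omega> \<theta> y \<longrightarrow>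
      agrees_with_primitive (\<lambda>s. u0 (s *\<^sub>R \<theta> + y)) (\<lambda>s. du0 (s *\<^sub>R \<theta> + y)) \<alpha> \<beta>"
    by (rule AE_line_primitive[OF \<theta> \<Omega>(1) int weak_pairD(7)[OF pair]])
  have "AE y in hyp_borel \<theta>. good y"
    using integral_lborel_lines(1)[OF \<theta> int(1)] integral_lborel_lines(1)[OF \<theta> int(2)]
      integral_lborel_lines(1)[OF \<theta> sq(1)] integral_lborel_lines(1)[OF \<theta> sq(2)]
      prim
    unfolding good_def by eventually_elim blast
  from null_hyp_lebesgue_if_AE[OF this] have null: "{y \<in> hyp \<theta>. \<not> good y} \<in> null_sets (hyp_lebesgue \<theta>)" .
  define A where "A = {y \<in> proj \<theta> ` \<Omega>. good y}"
  have "proj \<theta> ` \<Omega> - A \<subseteq> {y \<in> hyp \<theta>. \<not> good y}" using proj_in_hyp[OF \<theta>] by (auto simp: A_def)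
  with null have null_A: "proj \<theta> ` \<Omega> - A \<in> null_sets (hyp_lebesgue \<theta>)"
    unfolding hyp_lebesgue_def by (rule null_sets_completion_subset[rotated])
  define W where "W y \<alpha> \<beta> = (SOME W. is_primitive W (\<lambda>s. du0 (s *\<^sub>R \<theta> + y)) \<alpha> \<beta> \<and>
      (AE s in lborel. s \<in> {\<alpha><..<\<beta>} \<longrightarrow> u0 (s *\<^sub>R \<theta> + y) = W s))" for y \<alpha> \<beta>
  have W: "is_primitive (W y \<alpha> \<beta>) (\<lambda>s. du0 (s *\<^sub>R \<theta> + y)) \<alpha> \<beta> \<and>
      (AE s in lborel. s \<in> {\<alpha><..<\<beta>} \<longrightarrow> u0 (s *\<^sub>R \<theta> + y) = W y \<alpha> \<beta> s)"
    if "good y" "{\<alpha><..<\<beta>} \<in> line_intervals \<Omega> \<theta> y" for y \<alpha> \<beta>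
  proof -
    have "agrees_with_primitive (\<lambda>s. u0 (s *\<^sub>R \<theta> + y)) (\<lambda>s. du0 (s *\<^sub>R \<theta> + y)) \<alpha> \<beta>"
      using that component_endpoints(1,4)[of \<alpha> \<beta> "line_section \<Omega> \<theta> y"]
      unfolding good_def line_intervals_def by blast
    then show ?thesis unfolding W_def agrees_with_primitive_def by (rule someI_ex)
  qed
  \<comment> \<open>A component is determined by its right end, so its left end can be recovered from \<open>z\<close>.\<close>
  define g where "g z = W (proj \<theta> z) (THE \<alpha>. {\<alpha><..<z \<bullet> \<theta>} \<in> line_intervals \<Omega> \<theta> (proj \<theta> z)) (z \<bullet> \<theta>) (z \<bullet> \<theta>)" for z
  have "g \<in> dir_traces \<Omega> \<theta> u"
    unfolding dir_traces_def
  proof (intro CollectI exI[where x = u0] exI[where x = A] conjI ballI allI impI)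
    show "AE x in lebesgue_on \<Omega>. u0 x = u x"
      using eq \<Omega> by (simp add: AE_lebesgue_on_iff eq_commute)
    show "A \<subseteq> proj \<theta> ` \<Omega>" by (auto simp: A_def)
    show "proj \<theta> ` \<Omega> - A \<in> null_sets (hyp_lebesgue \<theta>)" by (rule null_A)
    fix y assume "y \<in> A"
    then have y: "good y" "y \<in> hyp \<theta>" using proj_in_hyp[OF \<theta>] by (auto simp: A_def)
    have "weak_dir_deriv (line_section \<Omega> \<theta> y) 1 (\<lambda>s. u0 (s *\<^sub>R \<theta> + y)) (\<lambda>s. du0 (s *\<^sub>R \<theta> + y))"
    proof (rule weak_deriv_if_primitives[OF open_line_section[OF \<Omega>(1)] bounded_line_section[OF \<theta> \<Omega>(2)]])
      fix \<alpha> \<beta> assume "{\<alpha><..<\<beta>} \<in> components (line_section \<Omega> \<theta> y)"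
      then show "agrees_with_primitive (\<lambda>s. u0 (s *\<^sub>R \<theta> + y)) (\<lambda>s. du0 (s *\<^sub>R \<theta> + y)) \<alpha> \<beta>"
        using W[OF y(1)] unfolding line_intervals_def agrees_with_primitive_def by blast
    qed (use y(1) in \<open>auto simp: good_def\<close>)
    then show "(\<lambda>s. u0 (s *\<^sub>R \<theta> + y)) \<in> H1 (line_section \<Omega> \<theta> y)"
      unfolding H1_def W_dir_def weak_dir_deriv_def by blast
    fix \<alpha> \<beta> assume comp: "{\<alpha><..<\<beta>} \<in> line_intervals \<Omega> \<theta> y"
    have "continuous_on {\<alpha><..\<beta>} (W y \<alpha> \<beta>)"
      using is_primitive_continuous[of "\<lambda>s. du0 (s *\<^sub>R \<theta> + y)"] W[OF y(1) comp] y(1)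
      by (auto simp: good_def intro: continuous_on_subset[of "{\<alpha>..\<beta>}"])
    moreover have "AE s in lebesgue_on {\<alpha><..<\<beta>}. W y \<alpha> \<beta> s = u0 (s *\<^sub>R \<theta> + y)"
      using W[OF y(1) comp] by (simp add: AE_lebesgue_on_iff eq_commute)
    moreover have "g (\<beta> *\<^sub>R \<theta> + y) = W y \<alpha> \<beta> \<beta>"
    proof -
      have "(THE \<alpha>. {\<alpha><..<\<beta>} \<in> line_intervals \<Omega> \<theta> y) = \<alpha>"
        using comp component_unique_left unfolding line_intervals_def by (intro the_equality) auto
      then show ?thesis by (simp add: g_def proj_line[OF \<theta> y(2)] inner_line[OF \<theta> y(2)])
    qed
    ultimately show "\<exists>w. continuous_on {\<alpha><..\<beta>} w \<and>
        (AE s in lebesgue_on {\<alpha><..<\<beta>}. w s = u0 (s *\<^sub>R \<theta> + y)) \<and> g (\<beta> *\<^sub>R \<theta> + y) = w \<beta>" by blast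
  qed
  then show ?thesis by blast
qed

lemma weak_dir_deriv_uminus:
  assumes "weak_dir_deriv \<Omega> \<theta> u du"
  shows "weak_dir_deriv \<Omega> (- \<theta>) u (\<lambda>x. - du x)"
  using assms by (auto simp: weak_dir_deriv_def L2_def)

section \<open>The exit map and the directional measure\<close>

text \<open>A trace is determined only up to null sets; measurability of expressions in traces is inherited from
  Borel functions with which they agree almost everywhere.\<close>

lemma borel_measurable_completion_cong_AE:
  fixes f g :: "'a \<Rightarrow> real"
  assumes g: "g \<in> borel_measurable M" and AE: "AE x in M. f x = g x"
  shows "f \<in> borel_measurable (completion M)"
proof (rule measurableI)
  fix X :: "real set" assume X: "X \<in> sets borel"
  have g': "g -` X \<inter> space (completion M) \<in> sets (completion M)"
    by (rule measurable_sets[OF measurable_completion[OF g] X])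
  have "AE x in completion M. x \<in> g -` X \<inter> space (completion M) \<longleftrightarrow> x \<in> f -` X \<inter> space (completion M)"
    using AE_completion[OF AE] by eventually_elim auto
  from completion.in_sets_AE[OF this g'] show "f -` X \<inter> space (completion M) \<in> sets (completion M)"
    by auto
qed simp

lemma lies_on_component:
  assumes \<theta>: "norm \<theta> = 1" and \<Omega>: "open \<Omega>" "bounded \<Omega>" and x: "x \<in> \<Omega>"
  obtains \<alpha> \<beta> where "{\<alpha><..<\<beta>} \<in> line_intervals \<Omega> \<theta> (proj \<theta> x)" "x \<bullet> \<theta> \<in> {\<alpha><..<\<beta>}"
proof -
  let ?\<omega> = "line_section \<Omega> \<theta> (proj \<theta> x)"
  have "x \<bullet> \<theta> \<in> ?\<omega>" using x by (simp add: line_section_def line_decomp)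
  then obtain C where C: "C \<in> components ?\<omega>" "x \<bullet> \<theta> \<in> C" using Union_components[of ?\<omega>] by blast
  note open_interval_component(1)[OF open_line_section[OF \<Omega>(1)] bounded_line_section[OF \<theta> \<Omega>(2)] C(1)]
  then show ?thesis using C that[of "Inf C" "Sup C"] by (simp add: line_intervals_def)
qed

lemma exit_on_component:
  assumes comp: "{\<alpha><..<\<beta>} \<in> line_intervals \<Omega> \<theta> y" and s: "s \<in> {\<alpha><..<\<beta>}"
  shows "exit_time \<Omega> \<theta> (s *\<^sub>R \<theta> + y) = \<beta> - s" and "exit_point \<Omega> \<theta> (s *\<^sub>R \<theta> + y) = \<beta> *\<^sub>R \<theta> + y"
proof -
  note ends = component_endpoints[OF comp[unfolded line_intervals_def]]
  have mem: "s *\<^sub>R \<theta> + y + t *\<^sub>R \<theta> \<in> \<Omega> \<longleftrightarrow> s + t \<in> line_section \<Omega> \<theta> y" for t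
    by (simp add: line_section_def algebra_simps)
  have "{r. 0 \<le> r \<and> (\<forall>t\<in>{0..<r}. s *\<^sub>R \<theta> + y + t *\<^sub>R \<theta> \<in> \<Omega>)} = {0..\<beta> - s}"
  proof (intro set_eqI iffI)
    fix r assume r: "r \<in> {r. 0 \<le> r \<and> (\<forall>t\<in>{0..<r}. s *\<^sub>R \<theta> + y + t *\<^sub>R \<theta> \<in> \<Omega>)}"
    have "r \<le> \<beta> - s"
    proof (rule ccontr)
      assume "\<not> r \<le> \<beta> - s"
      then have "\<beta> - s \<in> {0..<r}" using s by auto
      then have "\<beta> \<in> line_section \<Omega> \<theta> y" using r mem[of "\<beta> - s"] by auto
      then show False using ends(3) by simp
    qed
    then show "r \<in> {0..\<beta> - s}" using r by auto
  next
    fix r assume r: "r \<in> {0..\<beta> - s}"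
    have "s + t \<in> line_section \<Omega> \<theta> y" if "t \<in> {0..<r}" for t
      using that r s by (intro subsetD[OF ends(4)]) auto
    then show "r \<in> {r. 0 \<le> r \<and> (\<forall>t\<in>{0..<r}. s *\<^sub>R \<theta> + y + t *\<^sub>R \<theta> \<in> \<Omega>)}"
      using r mem by auto
  qed
  then show eq: "exit_time \<Omega> \<theta> (s *\<^sub>R \<theta> + y) = \<beta> - s" using s by (simp add: exit_time_def)
  show "exit_point \<Omega> \<theta> (s *\<^sub>R \<theta> + y) = \<beta> *\<^sub>R \<theta> + y"
    unfolding exit_point_def eq by (simp add: algebra_simps)
qed

lemma exit_point_in_boundary:
  assumes \<theta>: "norm \<theta> = 1" and \<Omega>: "open \<Omega>" "bounded \<Omega>" and x: "x \<in> \<Omega>"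
  shows "exit_point \<Omega> \<theta> x \<in> closure \<Omega> - \<Omega>"
proof -
  obtain \<alpha> \<beta> where comp: "{\<alpha><..<\<beta>} \<in> line_intervals \<Omega> \<theta> (proj \<theta> x)" "x \<bullet> \<theta> \<in> {\<alpha><..<\<beta>}"
    by (rule lies_on_component[OF assms])
  note ends = component_endpoints[OF comp(1)[unfolded line_intervals_def]]
  have eq: "exit_point \<Omega> \<theta> x = \<beta> *\<^sub>R \<theta> + proj \<theta> x"
    using exit_on_component(2)[OF comp] by (simp add: line_decomp)
  have "(\<lambda>s. s *\<^sub>R \<theta> + proj \<theta> x) ` closure {\<alpha><..<\<beta>} \<subseteq> closure \<Omega>"
  proof (rule image_closure_subset)
    show "continuous_on (closure {\<alpha><..<\<beta>}) (\<lambda>s. s *\<^sub>R \<theta> + proj \<theta> x)" by (intro continuous_intros)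
    show "(\<lambda>s. s *\<^sub>R \<theta> + proj \<theta> x) ` {\<alpha><..<\<beta>} \<subseteq> closure \<Omega>"
      using ends(4) closure_subset[of \<Omega>] by (auto simp: line_section_def)
  qed simp
  moreover have "\<beta> \<in> closure {\<alpha><..<\<beta>}" using ends(1) by simp
  ultimately have "\<beta> *\<^sub>R \<theta> + proj \<theta> x \<in> closure \<Omega>" by blast
  moreover have "\<beta> *\<^sub>R \<theta> + proj \<theta> x \<notin> \<Omega>" using ends(3) by (simp add: line_section_def)
  ultimately show ?thesis by (simp add: eq)
qed

text \<open>The length of the part of \<open>\<Omega>\<close> directly behind \<open>z\<close> on its line.  At the right end of a component it
  equals \<open>opp_dist\<close>, but being a supremum over conditions on points of an open set it is easily seen to be
  Borel measurable.\<close>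

definition back_time :: "'a::euclidean_space set \<Rightarrow> 'a \<Rightarrow> 'a \<Rightarrow> real" where
  "back_time \<Omega> \<theta> z = Sup {r. 0 \<le> r \<and> (\<forall>t\<in>{0<..<r}. z - t *\<^sub>R \<theta> \<in> \<Omega>)}"

lemma bdd_above_back_times:
  assumes \<theta>: "norm \<theta> = 1" and \<Omega>: "bounded \<Omega>"
  shows "bdd_above {r. 0 \<le> r \<and> (\<forall>t\<in>{0<..<r}. z - t *\<^sub>R \<theta> \<in> \<Omega>)}" (is "bdd_above ?S")
proof -
  obtain B where B: "\<And>x. x \<in> \<Omega> \<Longrightarrow> norm x \<le> B" using \<Omega> by (auto simp: bounded_iff)
  have "r \<le> \<bar>B\<bar> + norm z" if "r \<in> ?S" for r
  proof (rule ccontr)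
    assume *: "\<not> r \<le> \<bar>B\<bar> + norm z"
    define t where "t = (r + (\<bar>B\<bar> + norm z)) / 2"
    have t: "t < r" "\<bar>B\<bar> + norm z < t" using * unfolding t_def by auto
    moreover have "0 \<le> \<bar>B\<bar> + norm z" by simp
    ultimately have "0 < t" by linarith
    have "norm (z - t *\<^sub>R \<theta>) \<le> B" using that t \<open>0 < t\<close> B by auto
    moreover have "norm (t *\<^sub>R \<theta>) \<le> norm (z - t *\<^sub>R \<theta>) + norm z"
      using norm_triangle_ineq4[of z "z - t *\<^sub>R \<theta>"] by simp
    ultimately show False using t \<open>0 < t\<close> \<theta> by simp
  qed
  then show ?thesis by (rule bdd_aboveI)
qed

lemma less_back_time_iff:
  assumes \<theta>: "norm \<theta> = 1" and \<Omega>: "bounded \<Omega>" and "0 \<le> a"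
  shows "a < back_time \<Omega> \<theta> z \<longleftrightarrow> (\<exists>r>a. \<forall>t\<in>{0<..<r}. z - t *\<^sub>R \<theta> \<in> \<Omega>)"
proof -
  let ?S = "{r. 0 \<le> r \<and> (\<forall>t\<in>{0<..<r}. z - t *\<^sub>R \<theta> \<in> \<Omega>)}"
  have "?S \<noteq> {}" by (auto intro!: exI[of _ 0])
  then have "a < back_time \<Omega> \<theta> z \<longleftrightarrow> (\<exists>r\<in>?S. a < r)"
    unfolding back_time_def using bdd_above_back_times[OF \<theta> \<Omega>] by (rule less_cSup_iff)
  also have "\<dots> \<longleftrightarrow> (\<exists>r>a. \<forall>t\<in>{0<..<r}. z - t *\<^sub>R \<theta> \<in> \<Omega>)"
  proof
    assume "\<exists>r>a. \<forall>t\<in>{0<..<r}. z - t *\<^sub>R \<theta> \<in> \<Omega>"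
    then obtain r where "a < r" "\<forall>t\<in>{0<..<r}. z - t *\<^sub>R \<theta> \<in> \<Omega>" by blast
    then show "\<exists>r\<in>?S. a < r" using \<open>0 \<le> a\<close> by (intro bexI[of _ r]) auto
  qed auto
  finally show ?thesis .
qed

lemma back_time_nonneg:
  assumes \<theta>: "norm \<theta> = 1" and \<Omega>: "bounded \<Omega>"
  shows "0 \<le> back_time \<Omega> \<theta> z"
  unfolding back_time_def by (rule cSup_upper[OF _ bdd_above_back_times[OF assms]]) simp

text \<open>The condition \<open>a < back_time \<Omega> \<theta> z\<close> asks for some \<open>n\<close> such that the points \<open>z - t *\<^sub>R \<theta>\<close> with
  \<open>0 < t \<le> a + 1 / (n + 1)\<close> are in \<open>\<Omega>\<close>.  Since \<open>z\<close> itself is usually not in \<open>\<Omega>\<close>, the range of \<open>t\<close> is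
  exhausted by the closed segments with \<open>t \<ge> 1 / (m + 1)\<close>, each of which gives an open condition.\<close>

lemma borel_measurable_back_time:
  assumes \<theta>: "norm \<theta> = 1" and \<Omega>: "open \<Omega>" "bounded \<Omega>"
  shows "back_time \<Omega> \<theta> \<in> borel_measurable borel"
  unfolding borel_measurable_iff_greater
proof
  fix a :: real
  show "{z \<in> space borel. a < back_time \<Omega> \<theta> z} \<in> sets borel"
  proof (cases "0 \<le> a")
    case True
    define U where "U m n = {z. \<forall>t\<in>{inverse (real (Suc m))..a + inverse (real (Suc n))}. z + t *\<^sub>R (- \<theta>) \<in> \<Omega>}" for m n
    have "open (U m n)" for m n unfolding U_def by (rule open_forall_segment[OF \<Omega>(1)])
    then have "(\<Union>n. \<Inter>m. U m n) \<in> sets borel" by (intro sets.countable_UN sets.countable_INT) auto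
    also have "(\<Union>n. \<Inter>m. U m n) = {z \<in> space borel. a < back_time \<Omega> \<theta> z}"
    proof (intro set_eqI iffI)
      fix z assume "z \<in> (\<Union>n. \<Inter>m. U m n)"
      then obtain n where n: "\<And>m. z \<in> U m n" by auto
      have "z - t *\<^sub>R \<theta> \<in> \<Omega>" if t: "t \<in> {0<..<a + inverse (real (Suc n))}" for t
      proof -
        obtain m where "inverse (real (Suc m)) < t" using t reals_Archimedean[of t] by auto
        then show ?thesis using n[of m] t by (auto simp: U_def)
      qed
      then have "\<exists>r>a. \<forall>t\<in>{0<..<r}. z - t *\<^sub>R \<theta> \<in> \<Omega>"
        by (intro exI[of _ "a + inverse (real (Suc n))"]) simp
      then show "z \<in> {z \<in> space borel. a < back_time \<Omega> \<theta> z}"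
        using less_back_time_iff[OF \<theta> \<Omega>(2) True, of z] by simp
    next
      fix z assume "z \<in> {z \<in> space borel. a < back_time \<Omega> \<theta> z}"
      then obtain r where r: "a < r" "\<forall>t\<in>{0<..<r}. z - t *\<^sub>R \<theta> \<in> \<Omega>"
        using less_back_time_iff[OF \<theta> \<Omega>(2) True, of z] by auto
      obtain n where n: "inverse (real (Suc n)) < r - a" using r(1) reals_Archimedean[of "r - a"] by auto
      have "z \<in> U m n" for m
      proof -
        have "t \<in> {0<..<r}" if "t \<in> {inverse (real (Suc m))..a + inverse (real (Suc n))}" for t
        proof -
          have "0 < inverse (real (Suc m))" by simp
          then have "0 < t" using that by (metis atLeastAtMost_iff less_le_trans)
          then show ?thesis using that n by (simp del: of_nat_Suc)
        qed
        then show ?thesis using r(2) by (auto simp: U_def simp del: of_nat_Suc)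
      qed
      then show "z \<in> (\<Union>n. \<Inter>m. U m n)" by blast
    qed
    finally show ?thesis .
  next
    case False
    then have "{z \<in> space borel. a < back_time \<Omega> \<theta> z} = UNIV"
      using less_le_trans[OF _ back_time_nonneg[OF \<theta> \<Omega>(2)], of a] by auto
    then show ?thesis by simp
  qed
qed

text \<open>For \<open>x\<close> in \<open>\<Omega>\<close>, the part of \<open>\<Omega>\<close> ahead of \<open>x\<close> is the part behind \<open>x\<close> for the direction \<open>- \<theta>\<close>.\<close>

lemma borel_measurable_exit_time:
  assumes \<theta>: "norm \<theta> = 1" and \<Omega>: "open \<Omega>" "bounded \<Omega>"
  shows "(\<lambda>x. indicator \<Omega> x * exit_time \<Omega> \<theta> x) \<in> borel_measurable borel"
proof -
  have "{r. 0 \<le> r \<and> (\<forall>t\<in>{0..<r}. x + t *\<^sub>R \<theta> \<in> \<Omega>)} =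
      {r. 0 \<le> r \<and> (\<forall>t\<in>{0<..<r}. x - t *\<^sub>R (- \<theta>) \<in> \<Omega>)}" if "x \<in> \<Omega>" for x
    using that by (auto simp: le_less)
  then have "(\<lambda>x. indicator \<Omega> x * exit_time \<Omega> \<theta> x) = (\<lambda>x. indicator \<Omega> x * back_time \<Omega> (- \<theta>) x)"
    unfolding exit_time_def back_time_def by (auto simp: indicator_def)
  moreover have "back_time \<Omega> (- \<theta>) \<in> borel_measurable borel"
    using \<theta> \<Omega> by (intro borel_measurable_back_time) simp_all
  ultimately show ?thesis using \<Omega>(1) by simp
qed

lemma back_time_on_component:
  assumes comp: "{\<alpha><..<\<beta>} \<in> line_intervals \<Omega> \<theta> y"
  shows "back_time \<Omega> \<theta> (\<beta> *\<^sub>R \<theta> + y) = \<beta> - \<alpha>"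
proof -
  note ends = component_endpoints[OF comp[unfolded line_intervals_def]]
  have mem: "\<beta> *\<^sub>R \<theta> + y - t *\<^sub>R \<theta> \<in> \<Omega> \<longleftrightarrow> \<beta> - t \<in> line_section \<Omega> \<theta> y" for t
    by (simp add: line_section_def algebra_simps)
  have "{r. 0 \<le> r \<and> (\<forall>t\<in>{0<..<r}. \<beta> *\<^sub>R \<theta> + y - t *\<^sub>R \<theta> \<in> \<Omega>)} = {0..\<beta> - \<alpha>}"
  proof (intro set_eqI iffI)
    fix r assume r: "r \<in> {r. 0 \<le> r \<and> (\<forall>t\<in>{0<..<r}. \<beta> *\<^sub>R \<theta> + y - t *\<^sub>R \<theta> \<in> \<Omega>)}"
    have "r \<le> \<beta> - \<alpha>"
    proof (rule ccontr)
      assume "\<not> r \<le> \<beta> - \<alpha>"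
      then have "\<beta> - \<alpha> \<in> {0<..<r}" using ends(1) by auto
      then have "\<alpha> \<in> line_section \<Omega> \<theta> y" using r mem[of "\<beta> - \<alpha>"] by auto
      then show False using ends(2) by simp
    qed
    then show "r \<in> {0..\<beta> - \<alpha>}" using r by auto
  next
    fix r assume r: "r \<in> {0..\<beta> - \<alpha>}"
    have "\<beta> - t \<in> line_section \<Omega> \<theta> y" if "t \<in> {0<..<r}" for t
      using that r by (intro subsetD[OF ends(4)]) auto
    then show "r \<in> {r. 0 \<le> r \<and> (\<forall>t\<in>{0<..<r}. \<beta> *\<^sub>R \<theta> + y - t *\<^sub>R \<theta> \<in> \<Omega>)}"
      using r mem by auto
  qed
  then show ?thesis using ends(1) by (simp add: back_time_def)
qed

text \<open>A point outside \<open>\<Omega>\<close> with a piece of \<open>\<Omega>\<close> directly behind it is the right end of a component.  The left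
  end is not in \<open>\<Omega>\<close>: by openness, the piece would otherwise be longer.\<close>

lemma component_at_exit:
  assumes \<theta>: "norm \<theta> = 1" and \<Omega>: "open \<Omega>" "bounded \<Omega>"
    and z: "z \<notin> \<Omega>" "0 < back_time \<Omega> \<theta> z"
  shows "{z \<bullet> \<theta> - back_time \<Omega> \<theta> z<..<z \<bullet> \<theta>} \<in> line_intervals \<Omega> \<theta> (proj \<theta> z)"
proof -
  let ?\<omega> = "line_section \<Omega> \<theta> (proj \<theta> z)" and ?l = "back_time \<Omega> \<theta> z"
  have mem: "z - t *\<^sub>R \<theta> \<in> \<Omega> \<longleftrightarrow> z \<bullet> \<theta> - t \<in> ?\<omega>" for t
  proof -
    have "(z \<bullet> \<theta> - t) *\<^sub>R \<theta> + proj \<theta> z = z - t *\<^sub>R \<theta>" by (simp add: proj_def algebra_simps)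
    then show ?thesis by (simp add: line_section_def)
  qed
  have inside: "z \<bullet> \<theta> - t \<in> ?\<omega>" if t: "0 < t" "t < ?l" for t
  proof -
    obtain r where "t < r" "\<forall>t\<in>{0<..<r}. z - t *\<^sub>R \<theta> \<in> \<Omega>"
      using less_back_time_iff[OF \<theta> \<Omega>(2), of t z] t by auto
    then show ?thesis using t mem by auto
  qed
  have "z \<bullet> \<theta> \<notin> ?\<omega>" using z(1) mem[of 0] by simp
  moreover have "z \<bullet> \<theta> - ?l \<notin> ?\<omega>"
  proof
    assume "z \<bullet> \<theta> - ?l \<in> ?\<omega>"
    then obtain e where e: "e > 0" "ball (z \<bullet> \<theta> - ?l) e \<subseteq> ?\<omega>"
      using open_line_section[OF \<Omega>(1)] by (meson open_contains_ball)
    have "z - t *\<^sub>R \<theta> \<in> \<Omega>" if "t \<in> {0<..<?l + e}" for t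
    proof (cases "t < ?l")
      case True
      then show ?thesis using inside that mem by auto
    next
      case False
      then have "z \<bullet> \<theta> - t \<in> ball (z \<bullet> \<theta> - ?l) e" using that by (auto simp: dist_real_def)
      then show ?thesis using e(2) mem by auto
    qed
    then have "\<exists>r>?l. \<forall>t\<in>{0<..<r}. z - t *\<^sub>R \<theta> \<in> \<Omega>" using e(1) by (intro exI[of _ "?l + e"]) auto
    then have "?l < ?l" using less_back_time_iff[OF \<theta> \<Omega>(2), of ?l z] z(2) by auto
    then show False by simp
  qed
  moreover have "{z \<bullet> \<theta> - ?l<..<z \<bullet> \<theta>} \<subseteq> ?\<omega>"
  proof
    fix s assume "s \<in> {z \<bullet> \<theta> - ?l<..<z \<bullet> \<theta>}"
    then show "s \<in> ?\<omega>" using inside[of "z \<bullet> \<theta> - s"] by auto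
  qed
  ultimately show ?thesis
    unfolding line_intervals_def using z(2) by (intro interval_componentI) auto
qed

lemma opposite_on_component:
  assumes \<theta>: "norm \<theta> = 1" and y: "y \<in> hyp \<theta>" and comp: "{\<alpha><..<\<beta>} \<in> line_intervals \<Omega> \<theta> y"
  shows "opposite \<Omega> \<theta> (\<beta> *\<^sub>R \<theta> + y) = \<alpha> *\<^sub>R \<theta> + y" and "opp_dist \<Omega> \<theta> (\<beta> *\<^sub>R \<theta> + y) = \<beta> - \<alpha>"
proof -
  have p: "proj \<theta> (\<beta> *\<^sub>R \<theta> + y) = y" by (rule proj_line[OF \<theta> y])
  have "\<theta> \<noteq> 0" using \<theta> by auto
  have "(THE \<alpha>'. \<exists>\<beta>'. {\<alpha>'<..<\<beta>'} \<in> line_intervals \<Omega> \<theta> y \<and> \<beta> *\<^sub>R \<theta> + y = y + \<beta>' *\<^sub>R \<theta>) = \<alpha>"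
  proof (rule the_equality)
    show "\<exists>\<beta>'. {\<alpha><..<\<beta>'} \<in> line_intervals \<Omega> \<theta> y \<and> \<beta> *\<^sub>R \<theta> + y = y + \<beta>' *\<^sub>R \<theta>"
      using comp by (intro exI[of _ \<beta>]) simp
    fix \<alpha>' assume "\<exists>\<beta>'. {\<alpha>'<..<\<beta>'} \<in> line_intervals \<Omega> \<theta> y \<and> \<beta> *\<^sub>R \<theta> + y = y + \<beta>' *\<^sub>R \<theta>"
    then have "{\<alpha>'<..<\<beta>} \<in> line_intervals \<Omega> \<theta> y" using \<open>\<theta> \<noteq> 0\<close> by auto
    then show "\<alpha>' = \<alpha>" using comp component_unique_left unfolding line_intervals_def by blast
  qed
  then show opp: "opposite \<Omega> \<theta> (\<beta> *\<^sub>R \<theta> + y) = \<alpha> *\<^sub>R \<theta> + y" by (simp add: opposite_def p)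
  have "\<alpha> < \<beta>" using component_endpoints(1) comp unfolding line_intervals_def by blast
  have "\<beta> *\<^sub>R \<theta> + y - (\<alpha> *\<^sub>R \<theta> + y) = (\<beta> - \<alpha>) *\<^sub>R \<theta>" by (simp add: algebra_simps)
  then show "opp_dist \<Omega> \<theta> (\<beta> *\<^sub>R \<theta> + y) = \<beta> - \<alpha>"
    using \<theta> \<open>\<alpha> < \<beta>\<close> by (simp add: opp_dist_def opp)
qed

section \<open>Means over the component behind an exit point\<close>

text \<open>At the right end of a component this is the mean of \<open>F\<close> over the component.  Unlike the integrand in
  the final formula, it is given by a Borel expression at every point of the space.\<close>

definition mean_behind :: "'a::euclidean_space set \<Rightarrow> 'a \<Rightarrow> ('a \<Rightarrow> real) \<Rightarrow> 'a \<Rightarrow> real" where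
  "mean_behind \<Omega> \<theta> F z =
     (LBINT t. indicator {0<..<back_time \<Omega> \<theta> z} t * F (z - t *\<^sub>R \<theta>)) / back_time \<Omega> \<theta> z"

lemma borel_measurable_mean_behind:
  fixes F :: "'a::euclidean_space \<Rightarrow> real"
  assumes \<theta>: "norm \<theta> = 1" and \<Omega>: "open \<Omega>" "bounded \<Omega>" and [measurable]: "F \<in> borel_measurable borel"
  shows "mean_behind \<Omega> \<theta> F \<in> borel_measurable borel"
proof -
  have [measurable]: "back_time \<Omega> \<theta> \<in> borel_measurable borel"
    by (rule borel_measurable_back_time[OF \<theta> \<Omega>])
  have "(\<lambda>(z, t). if 0 < t \<and> t < back_time \<Omega> \<theta> z then F (z - t *\<^sub>R \<theta>) else 0)
      \<in> borel_measurable (borel \<Otimes>\<^sub>M lborel)"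
    by measurable
  then have "(\<lambda>z. (LBINT t. (if 0 < t \<and> t < back_time \<Omega> \<theta> z then F (z - t *\<^sub>R \<theta>) else 0)))
      \<in> borel_measurable borel"
    by (rule lborel.borel_measurable_lebesgue_integral)
  also have "(\<lambda>z. (LBINT t. (if 0 < t \<and> t < back_time \<Omega> \<theta> z then F (z - t *\<^sub>R \<theta>) else 0))) =
      (\<lambda>z. (LBINT t. indicator {0<..<back_time \<Omega> \<theta> z} t * F (z - t *\<^sub>R \<theta>)))"
    by (intro ext Bochner_Integration.integral_cong) (auto simp: indicator_def)
  finally show ?thesis unfolding mean_behind_def by measurable
qed

lemma mean_behind_on_component:
  assumes comp: "{\<alpha><..<\<beta>} \<in> line_intervals \<Omega> \<theta> y"
  shows "mean_behind \<Omega> \<theta> F (\<beta> *\<^sub>R \<theta> + y) =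
    (LBINT s. indicator {\<alpha><..<\<beta>} s * F (s *\<^sub>R \<theta> + y)) / (\<beta> - \<alpha>)"
proof -
  have "(LBINT s. indicator {\<alpha><..<\<beta>} s * F (s *\<^sub>R \<theta> + y)) =
      (LBINT t. indicator {\<alpha><..<\<beta>} (\<beta> + - 1 * t) * F ((\<beta> + - 1 * t) *\<^sub>R \<theta> + y))"
    using lborel_integral_real_affine[of "- 1" "\<lambda>s. indicator {\<alpha><..<\<beta>} s * F (s *\<^sub>R \<theta> + y)" \<beta>] by simp
  also have "\<dots> = (LBINT t. indicator {0<..<\<beta> - \<alpha>} t * F (\<beta> *\<^sub>R \<theta> + y - t *\<^sub>R \<theta>))"
    by (intro Bochner_Integration.integral_cong) (auto simp: indicator_def algebra_simps)
  finally show ?thesis by (simp add: mean_behind_def back_time_on_component[OF comp])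
qed

text \<open>\<open>H\<close> is constant on each component of a line, equal to the mean of \<open>F\<close> there.  So \<open>H\<close> and \<open>F\<close> have the
  same integral over each component, and the integral of the absolute value does not increase; summing over
  the components and integrating over the lines gives both claims.\<close>

lemma integral_mean_behind:
  fixes F :: "'a::euclidean_space \<Rightarrow> real"
  assumes \<theta>: "norm \<theta> = 1" and \<Omega>: "open \<Omega>" "bounded \<Omega>"
    and F: "integrable lborel F" and out: "\<And>x. x \<notin> \<Omega> \<Longrightarrow> F x = 0"
  defines "H \<equiv> \<lambda>x. indicator \<Omega> x * mean_behind \<Omega> \<theta> F (exit_point \<Omega> \<theta> x)"
  shows "integrable lborel H" and "(LBINT x. H x) = (LBINT x. F x)"
proof -
  have [measurable]: "F \<in> borel_measurable borel" "\<Omega> \<in> sets borel" using F \<Omega> by auto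
  note [measurable] = borel_measurable_mean_behind[OF \<theta> \<Omega> \<open>F \<in> borel_measurable borel\<close>]
    borel_measurable_exit_time[OF \<theta> \<Omega>]
  have "(\<lambda>x. indicator \<Omega> x * mean_behind \<Omega> \<theta> F (x + (indicator \<Omega> x * exit_time \<Omega> \<theta> x) *\<^sub>R \<theta>)) \<in> borel_measurable borel"
    by measurable
  also have "(\<lambda>x. indicator \<Omega> x * mean_behind \<Omega> \<theta> F (x + (indicator \<Omega> x * exit_time \<Omega> \<theta> x) *\<^sub>R \<theta>)) = H"
    by (auto simp: H_def fun_eq_iff indicator_def exit_point_def)
  finally have H [measurable]: "H \<in> borel_measurable borel" .
  have line: "H (s *\<^sub>R \<theta> + y) = (LBINT s. indicator {\<alpha><..<\<beta>} s * F (s *\<^sub>R \<theta> + y)) / (\<beta> - \<alpha>)"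
    if comp: "{\<alpha><..<\<beta>} \<in> line_intervals \<Omega> \<theta> y" and s: "s \<in> {\<alpha><..<\<beta>}" for \<alpha> \<beta> s y
  proof -
    have "s *\<^sub>R \<theta> + y \<in> \<Omega>"
      using component_endpoints(4)[OF comp[unfolded line_intervals_def]] s by (auto simp: line_section_def)
    then show ?thesis
      using exit_on_component(2)[OF that] mean_behind_on_component[OF comp, of F] by (simp add: H_def)
  qed
  have C: "\<exists>\<alpha> \<beta>. C = {\<alpha><..<\<beta>} \<and> \<alpha> < \<beta> \<and> {\<alpha><..<\<beta>} \<in> line_intervals \<Omega> \<theta> y"
    if "C \<in> components (line_section \<Omega> \<theta> y)" for C y
    using open_interval_component[OF open_line_section[OF \<Omega>(1)] bounded_line_section[OF \<theta> \<Omega>(2)] that] that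
    by (intro exI[of _ "Inf C"] exI[of _ "Sup C"]) (simp add: line_intervals_def)
  have out': "indicator (line_section \<Omega> \<theta> y) s * K (s *\<^sub>R \<theta> + y) = K (s *\<^sub>R \<theta> + y)"
    if "\<And>x. x \<notin> \<Omega> \<Longrightarrow> K x = 0" for K :: "'a \<Rightarrow> real" and y s
    using that by (auto simp: line_section_def indicator_def)
  have H_out: "H x = 0" if "x \<notin> \<Omega>" for x using that by (simp add: H_def)
  have intH_line: "(LBINT s. indicator {\<alpha><..<\<beta>} s * H (s *\<^sub>R \<theta> + y)) =
      (LBINT s. indicator {\<alpha><..<\<beta>} s * F (s *\<^sub>R \<theta> + y))"
    if comp: "{\<alpha><..<\<beta>} \<in> line_intervals \<Omega> \<theta> y" "\<alpha> < \<beta>" for \<alpha> \<beta> y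
  proof -
    let ?c = "(LBINT s. indicator {\<alpha><..<\<beta>} s * F (s *\<^sub>R \<theta> + y)) / (\<beta> - \<alpha>)"
    have "(LBINT s. indicator {\<alpha><..<\<beta>} s * H (s *\<^sub>R \<theta> + y)) = (LBINT s. indicator {\<alpha><..<\<beta>} s * ?c)"
      using line[OF comp(1)] by (intro Bochner_Integration.integral_cong) (auto simp: indicator_def)
    also have "\<dots> = (\<beta> - \<alpha>) * ?c" using comp(2) by simp
    finally show ?thesis using comp(2) by simp
  qed
  have F_line: "AE y in hyp_borel \<theta>. integrable lborel (\<lambda>s. F (s *\<^sub>R \<theta> + y))"
    by (rule integral_lborel_lines(1)[OF \<theta> F])
  have "(\<integral>\<^sup>+x. ennreal \<bar>H x\<bar> \<partial>lborel) = (\<integral>\<^sup>+y. \<integral>\<^sup>+s. ennreal \<bar>H (s *\<^sub>R \<theta> + y)\<bar> \<partial>lborel \<partial>hyp_borel \<theta>)"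
    by (rule nn_integral_lborel_lines[OF \<theta>]) measurable
  also have "\<dots> \<le> (\<integral>\<^sup>+y. \<integral>\<^sup>+s. ennreal \<bar>F (s *\<^sub>R \<theta> + y)\<bar> \<partial>lborel \<partial>hyp_borel \<theta>)"
  proof (rule nn_integral_mono_AE)
    show "AE y in hyp_borel \<theta>. (\<integral>\<^sup>+s. ennreal \<bar>H (s *\<^sub>R \<theta> + y)\<bar> \<partial>lborel) \<le> (\<integral>\<^sup>+s. ennreal \<bar>F (s *\<^sub>R \<theta> + y)\<bar> \<partial>lborel)"
      using F_line
    proof eventually_elim
      case (elim y)
      have "(\<integral>\<^sup>+s. ennreal \<bar>H (s *\<^sub>R \<theta> + y)\<bar> * indicator (line_section \<Omega> \<theta> y) s \<partial>lborel) \<le>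
          (\<integral>\<^sup>+s. ennreal \<bar>F (s *\<^sub>R \<theta> + y)\<bar> * indicator (line_section \<Omega> \<theta> y) s \<partial>lborel)"
      proof (rule nn_integral_le_if_components[OF open_line_section[OF \<Omega>(1)]])
        fix C assume "C \<in> components (line_section \<Omega> \<theta> y)"
        then obtain \<alpha> \<beta> where \<alpha>\<beta>: "C = {\<alpha><..<\<beta>}" "\<alpha> < \<beta>" "{\<alpha><..<\<beta>} \<in> line_intervals \<Omega> \<theta> y"
          using C by blast
        let ?I = "(LBINT s. indicator {\<alpha><..<\<beta>} s * F (s *\<^sub>R \<theta> + y))"
        have "(\<integral>\<^sup>+s. ennreal \<bar>H (s *\<^sub>R \<theta> + y)\<bar> * indicator C s \<partial>lborel) =
            (\<integral>\<^sup>+s. ennreal \<bar>?I / (\<beta> - \<alpha>)\<bar> * indicator {\<alpha><..<\<beta>} s \<partial>lborel)"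
          using line[OF \<alpha>\<beta>(3)] by (intro nn_integral_cong) (auto simp: \<alpha>\<beta>(1) indicator_def)
        also have "\<dots> = ennreal \<bar>?I / (\<beta> - \<alpha>)\<bar> * ennreal (\<beta> - \<alpha>)"
          using \<alpha>\<beta>(2) by (simp add: nn_integral_cmult_indicator)
        also have "\<dots> = ennreal \<bar>?I\<bar>"
          using \<alpha>\<beta>(2) by (simp flip: ennreal_mult add: abs_divide)
        also have "\<dots> \<le> (\<integral>\<^sup>+s. ennreal (norm (indicator {\<alpha><..<\<beta>} s * F (s *\<^sub>R \<theta> + y))) \<partial>lborel)"
          using integral_norm_bound_ennreal[OF integrable_indicator_mult[OF elim, of "{\<alpha><..<\<beta>}"]] by simp
        also have "\<dots> = (\<integral>\<^sup>+s. ennreal \<bar>F (s *\<^sub>R \<theta> + y)\<bar> * indicator C s \<partial>lborel)"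
          by (intro nn_integral_cong) (auto simp: \<alpha>\<beta>(1) indicator_def)
        finally show "(\<integral>\<^sup>+s. ennreal \<bar>H (s *\<^sub>R \<theta> + y)\<bar> * indicator C s \<partial>lborel) \<le>
            (\<integral>\<^sup>+s. ennreal \<bar>F (s *\<^sub>R \<theta> + y)\<bar> * indicator C s \<partial>lborel)" .
      qed measurable
      moreover have "ennreal \<bar>K (s *\<^sub>R \<theta> + y)\<bar> * indicator (line_section \<Omega> \<theta> y) s = ennreal \<bar>K (s *\<^sub>R \<theta> + y)\<bar>"
        if "\<And>x. x \<notin> \<Omega> \<Longrightarrow> K x = 0" for K :: "'a \<Rightarrow> real" and s
        using that by (auto simp: line_section_def indicator_def)
      ultimately show ?case using H_out out by simp
    qed
  qed
  also have "\<dots> = (\<integral>\<^sup>+x. ennreal \<bar>F x\<bar> \<partial>lborel)"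
    by (rule nn_integral_lborel_lines[OF \<theta>, symmetric]) measurable
  also have "\<dots> < \<infinity>" using F by (simp add: integrable_iff_bounded)
  finally show intH: "integrable lborel H" using H by (simp add: integrable_iff_bounded)
  have "(LBINT x. H x) = (\<integral>y. (LBINT s. H (s *\<^sub>R \<theta> + y)) \<partial>hyp_borel \<theta>)"
    by (rule integral_lborel_lines(3)[OF \<theta> intH])
  also have "\<dots> = (\<integral>y. (LBINT s. F (s *\<^sub>R \<theta> + y)) \<partial>hyp_borel \<theta>)"
  proof (rule integral_cong_AE)
    show "(\<lambda>y. (LBINT s. H (s *\<^sub>R \<theta> + y))) \<in> borel_measurable (hyp_borel \<theta>)"
      using integral_lborel_lines(2)[OF \<theta> intH] by simp
    show "(\<lambda>y. (LBINT s. F (s *\<^sub>R \<theta> + y))) \<in> borel_measurable (hyp_borel \<theta>)"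
      using integral_lborel_lines(2)[OF \<theta> F] by simp
    show "AE y in hyp_borel \<theta>. (LBINT s. H (s *\<^sub>R \<theta> + y)) = (LBINT s. F (s *\<^sub>R \<theta> + y))"
      using F_line integral_lborel_lines(1)[OF \<theta> intH]
    proof eventually_elim
      case (elim y)
      let ?h = "\<lambda>s. H (s *\<^sub>R \<theta> + y) - F (s *\<^sub>R \<theta> + y)"
      have h: "indicator (line_section \<Omega> \<theta> y) s * ?h s = ?h s" for s
        using out'[of "\<lambda>x. H x - F x" y s] H_out out by simp
      have "(LBINT s. indicator (line_section \<Omega> \<theta> y) s * ?h s) = 0"
      proof (rule integral_zero_if_components[OF open_line_section[OF \<Omega>(1)]])
        show "integrable lborel (\<lambda>s. indicator (line_section \<Omega> \<theta> y) s * ?h s)"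
          unfolding h using elim by simp
        fix C assume "C \<in> components (line_section \<Omega> \<theta> y)"
        then obtain \<alpha> \<beta> where \<alpha>\<beta>: "C = {\<alpha><..<\<beta>}" "\<alpha> < \<beta>" "{\<alpha><..<\<beta>} \<in> line_intervals \<Omega> \<theta> y"
          using C by blast
        have "integrable lborel (\<lambda>s. indicator {\<alpha><..<\<beta>} s * H (s *\<^sub>R \<theta> + y))"
          "integrable lborel (\<lambda>s. indicator {\<alpha><..<\<beta>} s * F (s *\<^sub>R \<theta> + y))"
          using elim by (auto intro: integrable_indicator_mult)
        then show "(LBINT s. indicator C s * ?h s) = 0"
          using intH_line[OF \<alpha>\<beta>(3,2)] by (simp add: \<alpha>\<beta>(1) right_diff_distrib)
      qed
      then show ?case unfolding h using elim by simp
    qed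
  qed
  also have "\<dots> = (LBINT x. F x)"
    by (rule integral_lborel_lines(3)[OF \<theta> F, symmetric])
  finally show "(LBINT x. H x) = (LBINT x. F x)" .
qed

lemma measurable_exit_point:
  fixes \<theta> :: "'a::euclidean_space"
  assumes \<theta>: "norm \<theta> = 1" and \<Omega>: "open \<Omega>" "bounded \<Omega>"
  shows "exit_point \<Omega> \<theta> \<in> measurable (lebesgue_on \<Omega>) (restrict_space borel (closure \<Omega> - \<Omega>))"
proof (rule measurable_restrict_space2)
  show "exit_point \<Omega> \<theta> \<in> space (lebesgue_on \<Omega>) \<rightarrow> closure \<Omega> - \<Omega>"
    using exit_point_in_boundary[OF assms] by auto
  note [measurable] = borel_measurable_exit_time[OF assms]
  have "(\<lambda>x. x + (indicator \<Omega> x * exit_time \<Omega> \<theta> x) *\<^sub>R \<theta>) \<in> borel_measurable borel"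
    by measurable
  then have "(\<lambda>x. x + (indicator \<Omega> x * exit_time \<Omega> \<theta> x) *\<^sub>R \<theta>) \<in> borel_measurable (lebesgue_on \<Omega>)"
    by (simp add: measurable_restrict_space1 measurable_completion)
  then show "exit_point \<Omega> \<theta> \<in> borel_measurable (lebesgue_on \<Omega>)"
    by (rule measurable_cong[THEN iffD1, rotated]) (simp add: exit_point_def)
qed

text \<open>The lines on which \<open>P\<close> fails are covered by a Borel null set \<open>N\<close> of the hyperplane, and the cylinder
  over \<open>N\<close> is Lebesgue null.  Hence almost every point of \<open>\<Omega>\<close> exits in the Borel set \<open>S\<close> of boundary points
  with projection outside \<open>N\<close> and positive \<open>back_time\<close>, and every point of \<open>S\<close> is the right end of a
  component of a good line.\<close>

lemma AE_exit_distribution: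
  fixes \<theta> :: "'a::euclidean_space"
  assumes \<theta>: "norm \<theta> = 1" and \<Omega>: "open \<Omega>" "bounded \<Omega>"
    and P: "AE y in hyp_borel \<theta>. \<forall>\<alpha> \<beta>. {\<alpha><..<\<beta>} \<in> line_intervals \<Omega> \<theta> y \<longrightarrow> P (\<beta> *\<^sub>R \<theta> + y)"
  shows "AE z in distr (lebesgue_on \<Omega>) (restrict_space borel (closure \<Omega> - \<Omega>)) (exit_point \<Omega> \<theta>). P z"
proof -
  let ?R = "restrict_space borel (closure \<Omega> - \<Omega>)"
  obtain N where N: "{y \<in> space (hyp_borel \<theta>). \<not> (\<forall>\<alpha> \<beta>. {\<alpha><..<\<beta>} \<in> line_intervals \<Omega> \<theta> y \<longrightarrow> P (\<beta> *\<^sub>R \<theta> + y))} \<subseteq> N"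
    "emeasure (hyp_borel \<theta>) N = 0" "N \<in> sets (hyp_borel \<theta>)"
    using AE_E[OF P] by blast
  then have [measurable]: "N \<in> sets borel" by simp
  have [measurable]: "\<Omega> \<in> sets borel" using \<Omega> by simp
  define S where "S = {z \<in> closure \<Omega> - \<Omega>. proj \<theta> z \<notin> N \<and> 0 < back_time \<Omega> \<theta> z}"
  have S_borel: "S \<in> sets borel"
  proof -
    have "S = (closure \<Omega> - \<Omega>) \<inter> proj \<theta> -` (- N) \<inter> back_time \<Omega> \<theta> -` {0<..}" by (auto simp: S_def)
    moreover have "proj \<theta> -` (- N) \<in> sets borel" "back_time \<Omega> \<theta> -` {0<..} \<in> sets borel"
      using measurable_sets[OF borel_measurable_proj, of "- N" \<theta>]
        measurable_sets[OF borel_measurable_back_time[OF \<theta> \<Omega>], of "{0<..}"] by simp_all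
    moreover have "closure \<Omega> \<in> sets borel" by simp
    ultimately show ?thesis by simp
  qed
  have S_P: "P z" if "z \<in> S" for z
  proof -
    have z: "z \<notin> \<Omega>" "0 < back_time \<Omega> \<theta> z" "proj \<theta> z \<notin> N" using that by (auto simp: S_def)
    from component_at_exit[OF \<theta> \<Omega> z(1,2)] N(1) z(3) have "P ((z \<bullet> \<theta>) *\<^sub>R \<theta> + proj \<theta> z)" by auto
    then show ?thesis by (simp add: line_decomp)
  qed
  have "AE y in hyp_borel \<theta>. y \<notin> N" using null_setsI[OF N(2,3)] by (rule AE_not_in)
  then have "(\<integral>\<^sup>+x. indicator N (proj \<theta> x) \<partial>lborel) = 0"
  proof -
    have "(\<integral>\<^sup>+x. indicator N (proj \<theta> x) \<partial>lborel) =
        (\<integral>\<^sup>+y. \<integral>\<^sup>+s. indicator N (proj \<theta> (s *\<^sub>R \<theta> + y)) \<partial>lborel \<partial>hyp_borel \<theta>)"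
      by (rule nn_integral_lborel_lines[OF \<theta>]) measurable
    also have "\<dots> = (\<integral>\<^sup>+y. 0 \<partial>hyp_borel \<theta>)"
    proof (rule nn_integral_cong_AE)
      show "AE y in hyp_borel \<theta>. (\<integral>\<^sup>+s. indicator N (proj \<theta> (s *\<^sub>R \<theta> + y)) \<partial>lborel) = 0"
        using \<open>AE y in hyp_borel \<theta>. y \<notin> N\<close> AE_hyp_borel_in_hyp[of \<theta>]
        by eventually_elim (simp add: proj_line[OF \<theta>])
    qed
    finally show ?thesis by simp
  qed
  then have "AE x in lborel. (indicator N (proj \<theta> x) :: ennreal) = 0"
    by (subst (asm) nn_integral_0_iff_AE) measurable
  then have "AE x in lborel. x \<in> \<Omega> \<longrightarrow> exit_point \<Omega> \<theta> x \<in> S"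
  proof eventually_elim
    case (elim x)
    show ?case
    proof
      assume x: "x \<in> \<Omega>"
      obtain \<alpha> \<beta> where comp: "{\<alpha><..<\<beta>} \<in> line_intervals \<Omega> \<theta> (proj \<theta> x)" "x \<bullet> \<theta> \<in> {\<alpha><..<\<beta>}"
        by (rule lies_on_component[OF \<theta> \<Omega> x])
      have eq: "exit_point \<Omega> \<theta> x = \<beta> *\<^sub>R \<theta> + proj \<theta> x"
        using exit_on_component(2)[OF comp] by (simp add: line_decomp)
      have "proj \<theta> (exit_point \<Omega> \<theta> x) = proj \<theta> x"
        unfolding eq by (rule proj_line[OF \<theta> proj_in_hyp[OF \<theta>]])
      moreover have "back_time \<Omega> \<theta> (exit_point \<Omega> \<theta> x) = \<beta> - \<alpha>"
        unfolding eq by (rule back_time_on_component[OF comp(1)])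
      moreover have "proj \<theta> x \<notin> N" using elim by (simp add: indicator_def split: if_splits)
      ultimately show "exit_point \<Omega> \<theta> x \<in> S"
        using exit_point_in_boundary[OF \<theta> \<Omega> x] comp(2) by (simp add: S_def)
    qed
  qed
  then have "AE x in lebesgue_on \<Omega>. exit_point \<Omega> \<theta> x \<in> S" by (simp add: AE_lebesgue_on_iff)
  then have "AE z in distr (lebesgue_on \<Omega>) ?R (exit_point \<Omega> \<theta>). z \<in> S"
  proof (subst AE_distr_iff[OF measurable_exit_point[OF \<theta> \<Omega>]])
    have "{z \<in> space ?R. z \<in> S} = S" by (auto simp: S_def space_restrict_space)
    then show "{z \<in> space ?R. z \<in> S} \<in> sets ?R"
      using S_borel by (simp add: sets_restrict_space_iff) (auto simp: S_def)
  qed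
  then show ?thesis by eventually_elim (rule S_P)
qed

section \<open>The integration by parts formula\<close>

lemma AE_lborel_reflect:
  fixes P :: "real \<Rightarrow> bool"
  assumes "AE s in lborel. P s"
  shows "AE s in lborel. P (- s)"
proof -
  have "AE s in distr lborel borel uminus. P s" using assms by (subst lborel_distr_uminus)
  then show ?thesis by (rule AE_distrD[rotated]) simp
qed

text \<open>Parametrised by \<open>- \<theta>\<close>, the line is traversed backwards, and left ends become right ends.\<close>

lemma AE_trace_value_left:
  fixes \<theta> :: "'a::euclidean_space"
  assumes \<theta>: "norm \<theta> = 1" and \<Omega>: "open \<Omega>"
    and eq: "AE x in lborel. x \<in> \<Omega> \<longrightarrow> u x = u0 x" and h: "h \<in> dir_traces \<Omega> (- \<theta>) u"
  shows "AE y in hyp_borel \<theta>. \<forall>\<alpha> \<beta> W. {\<alpha><..<\<beta>} \<in> line_intervals \<Omega> \<theta> y \<and>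
    continuous_on {\<alpha>..<\<beta>} W \<and> (AE s in lborel. s \<in> {\<alpha><..<\<beta>} \<longrightarrow> u0 (s *\<^sub>R \<theta> + y) = W s) \<longrightarrow>
    h (\<alpha> *\<^sub>R \<theta> + y) = W \<alpha>"
proof -
  have "norm (- \<theta>) = 1" using \<theta> by simp
  from AE_trace_value[OF this \<Omega> eq h, unfolded hyp_borel_uminus] show ?thesis
  proof eventually_elim
    case (elim y)
    show ?case
    proof (intro allI impI, elim conjE)
      fix \<alpha> \<beta> W
      assume comp: "{\<alpha><..<\<beta>} \<in> line_intervals \<Omega> \<theta> y" and W: "continuous_on {\<alpha>..<\<beta>} W"
        "AE s in lborel. s \<in> {\<alpha><..<\<beta>} \<longrightarrow> u0 (s *\<^sub>R \<theta> + y) = W s"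
      note ends = component_endpoints[OF comp[unfolded line_intervals_def]]
      have mem: "s \<in> line_section \<Omega> (- \<theta>) y \<longleftrightarrow> - s \<in> line_section \<Omega> \<theta> y" for s
        by (simp add: line_section_def)
      have "{- \<beta><..<- \<alpha>} \<in> line_intervals \<Omega> (- \<theta>) y"
        unfolding line_intervals_def
      proof (rule interval_componentI)
        show "{- \<beta><..<- \<alpha>} \<subseteq> line_section \<Omega> (- \<theta>) y"
          using ends(4) unfolding subset_iff mem by auto
      qed (use ends in \<open>auto simp: mem\<close>)
      moreover have "continuous_on {- \<beta><..- \<alpha>} (\<lambda>s. W (- s))"
        by (rule continuous_on_compose2[OF W(1)]) (auto intro: continuous_intros)
      moreover have "AE s in lborel. s \<in> {- \<beta><..<- \<alpha>} \<longrightarrow> u0 (s *\<^sub>R (- \<theta>) + y) = W (- s)"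
        using AE_lborel_reflect[OF W(2)] by eventually_elim auto
      ultimately have "h ((- \<alpha>) *\<^sub>R (- \<theta>) + y) = W (- (- \<alpha>))" using elim by blast
      then show "h (\<alpha> *\<^sub>R \<theta> + y) = W \<alpha>" by simp
    qed
  qed
qed

text \<open>On almost every line \<open>u\<close> and \<open>v\<close> have primitives \<open>W\<close> and \<open>Z\<close>, and the four traces are their values at
  the two ends; this is the product rule for \<open>W\<close> and \<open>Z\<close>.\<close>

lemma AE_component_green:
  fixes \<theta> :: "'a::euclidean_space"
  assumes \<theta>: "norm \<theta> = 1" and \<Omega>: "open \<Omega>" "bounded \<Omega>"
    and u: "weak_pair \<Omega> \<theta> u0 du0" and v: "weak_pair \<Omega> \<theta> v0 dv0"
    and eq_u: "AE x in lborel. x \<in> \<Omega> \<longrightarrow> u x = u0 x" and eq_v: "AE x in lborel. x \<in> \<Omega> \<longrightarrow> v x = v0 x"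
    and g: "gu \<in> dir_traces \<Omega> \<theta> u" "gv \<in> dir_traces \<Omega> \<theta> v"
    and h: "hu \<in> dir_traces \<Omega> (- \<theta>) u" "hv \<in> dir_traces \<Omega> (- \<theta>) v"
  shows "AE y in hyp_borel \<theta>. \<forall>\<alpha> \<beta>. {\<alpha><..<\<beta>} \<in> line_intervals \<Omega> \<theta> y \<longrightarrow>
    (LBINT s. indicator {\<alpha><..<\<beta>} s * (u0 (s *\<^sub>R \<theta> + y) * dv0 (s *\<^sub>R \<theta> + y) + v0 (s *\<^sub>R \<theta> + y) * du0 (s *\<^sub>R \<theta> + y))) =
    gu (\<beta> *\<^sub>R \<theta> + y) * gv (\<beta> *\<^sub>R \<theta> + y) - hu (\<alpha> *\<^sub>R \<theta> + y) * hv (\<alpha> *\<^sub>R \<theta> + y)"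
proof -
  note int = weak_pair_integrable[OF \<Omega> u] weak_pair_integrable[OF \<Omega> v]
  have prim: "AE y in hyp_borel \<theta>. \<forall>\<alpha> \<beta>. \<alpha> < \<beta> \<and> {\<alpha><..<\<beta>} \<subseteq> line_section \<Omega> \<theta> y \<longrightarrow>
      agrees_with_primitive (\<lambda>s. u0 (s *\<^sub>R \<theta> + y)) (\<lambda>s. du0 (s *\<^sub>R \<theta> + y)) \<alpha> \<beta>"
    "AE y in hyp_borel \<theta>. \<forall>\<alpha> \<beta>. \<alpha> < \<beta> \<and> {\<alpha><..<\<beta>} \<subseteq> line_section \<Omega> \<theta> y \<longrightarrow>
      agrees_with_primitive (\<lambda>s. v0 (s *\<^sub>R \<theta> + y)) (\<lambda>s. dv0 (s *\<^sub>R \<theta> + y)) \<alpha> \<beta>"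
    by (rule AE_line_primitive[OF \<theta> \<Omega>(1) int(1,2) weak_pairD(7)[OF u]]
        AE_line_primitive[OF \<theta> \<Omega>(1) int(3,4) weak_pairD(7)[OF v]]; assumption)+
  note lines = integral_lborel_lines(1)[OF \<theta>]
  note tr = AE_trace_value[OF \<theta> \<Omega>(1) eq_u g(1)] AE_trace_value[OF \<theta> \<Omega>(1) eq_v g(2)]
    AE_trace_value_left[OF \<theta> \<Omega>(1) eq_u h(1)] AE_trace_value_left[OF \<theta> \<Omega>(1) eq_v h(2)]
  from prim tr lines[OF int(1)] lines[OF int(2)] lines[OF int(3)] lines[OF int(4)] show ?thesis
  proof eventually_elim
    case (elim y)
    note measurable_line = elim(7-10)[THEN borel_measurable_integrable]
    show ?case
    proof (intro allI impI)
      fix \<alpha> \<beta> assume comp: "{\<alpha><..<\<beta>} \<in> line_intervals \<Omega> \<theta> y"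
      note ends = component_endpoints[OF comp[unfolded line_intervals_def]]
      obtain W where W: "is_primitive W (\<lambda>s. du0 (s *\<^sub>R \<theta> + y)) \<alpha> \<beta>"
        "AE s in lborel. s \<in> {\<alpha><..<\<beta>} \<longrightarrow> u0 (s *\<^sub>R \<theta> + y) = W s"
        using elim(1) ends(1,4) unfolding agrees_with_primitive_def by blast
      obtain Z where Z: "is_primitive Z (\<lambda>s. dv0 (s *\<^sub>R \<theta> + y)) \<alpha> \<beta>"
        "AE s in lborel. s \<in> {\<alpha><..<\<beta>} \<longrightarrow> v0 (s *\<^sub>R \<theta> + y) = Z s"
        using elim(2) ends(1,4) unfolding agrees_with_primitive_def by blast
      have cont: "continuous_on {\<alpha><..\<beta>} W" "continuous_on {\<alpha>..<\<beta>} W"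
        "continuous_on {\<alpha><..\<beta>} Z" "continuous_on {\<alpha>..<\<beta>} Z"
        using is_primitive_continuous[OF elim(8) W(1)] is_primitive_continuous[OF elim(10) Z(1)]
        by (auto intro: continuous_on_subset)
      have vals: "gu (\<beta> *\<^sub>R \<theta> + y) = W \<beta>" "gv (\<beta> *\<^sub>R \<theta> + y) = Z \<beta>"
        "hu (\<alpha> *\<^sub>R \<theta> + y) = W \<alpha>" "hv (\<alpha> *\<^sub>R \<theta> + y) = Z \<alpha>"
        using elim(3)[rule_format, OF conjI[OF comp conjI[OF cont(1) W(2)]]]
          elim(4)[rule_format, OF conjI[OF comp conjI[OF cont(3) Z(2)]]]
          elim(5)[rule_format, OF conjI[OF comp conjI[OF cont(2) W(2)]]]
          elim(6)[rule_format, OF conjI[OF comp conjI[OF cont(4) Z(2)]]] by auto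
      note P = is_primitive_product[OF elim(8,10) W(1) Z(1) less_imp_le[OF ends(1)]]
      have "(LBINT s. indicator {\<alpha><..<\<beta>} s * (u0 (s *\<^sub>R \<theta> + y) * dv0 (s *\<^sub>R \<theta> + y) + v0 (s *\<^sub>R \<theta> + y) * du0 (s *\<^sub>R \<theta> + y))) =
          (LBINT s. indicator {\<alpha><..<\<beta>} s * (W s * dv0 (s *\<^sub>R \<theta> + y) + Z s * du0 (s *\<^sub>R \<theta> + y)))"
      proof (rule integral_cong_AE)
        show "(\<lambda>s. indicator {\<alpha><..<\<beta>} s * (u0 (s *\<^sub>R \<theta> + y) * dv0 (s *\<^sub>R \<theta> + y) + v0 (s *\<^sub>R \<theta> + y) * du0 (s *\<^sub>R \<theta> + y))) \<in> borel_measurable lborel"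
          using measurable_line by simp
        show "(\<lambda>s. indicator {\<alpha><..<\<beta>} s * (W s * dv0 (s *\<^sub>R \<theta> + y) + Z s * du0 (s *\<^sub>R \<theta> + y))) \<in> borel_measurable lborel"
          using P(1) by (rule borel_measurable_integrable)
        show "AE s in lborel. indicator {\<alpha><..<\<beta>} s * (u0 (s *\<^sub>R \<theta> + y) * dv0 (s *\<^sub>R \<theta> + y) + v0 (s *\<^sub>R \<theta> + y) * du0 (s *\<^sub>R \<theta> + y)) =
            indicator {\<alpha><..<\<beta>} s * (W s * dv0 (s *\<^sub>R \<theta> + y) + Z s * du0 (s *\<^sub>R \<theta> + y))"
          using W(2) Z(2) by eventually_elim (auto simp: indicator_def)
      qed
      then show "(LBINT s. indicator {\<alpha><..<\<beta>} s * (u0 (s *\<^sub>R \<theta> + y) * dv0 (s *\<^sub>R \<theta> + y) + v0 (s *\<^sub>R \<theta> + y) * du0 (s *\<^sub>R \<theta> + y))) =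
          gu (\<beta> *\<^sub>R \<theta> + y) * gv (\<beta> *\<^sub>R \<theta> + y) - hu (\<alpha> *\<^sub>R \<theta> + y) * hv (\<alpha> *\<^sub>R \<theta> + y)"
        unfolding P(2) vals by simp
    qed
  qed
qed

text \<open>The integrand \<open>G\<close> agrees with \<open>G0 = mean_behind \<Omega> \<theta> F\<close>, for \<open>F = u dv + v du\<close>, almost everywhere for the
  exit distribution.  Its integral is that of \<open>G0\<close> composed with the exit map over \<open>\<Omega>\<close>, hence that of \<open>F\<close>.\<close>

lemma green_formula_traces:
  fixes \<theta> :: "'a::euclidean_space" and u v du dv :: "'a \<Rightarrow> real"
  assumes \<theta>: "norm \<theta> = 1" and \<Omega>: "open \<Omega>" "bounded \<Omega>"
    and wu: "weak_dir_deriv \<Omega> \<theta> u du" and wv: "weak_dir_deriv \<Omega> \<theta> v dv"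
    and g: "gu \<in> dir_traces \<Omega> \<theta> u" "gv \<in> dir_traces \<Omega> \<theta> v"
    and h: "hu \<in> dir_traces \<Omega> (- \<theta>) u" "hv \<in> dir_traces \<Omega> (- \<theta>) v"
  defines "G \<equiv> \<lambda>z. (gu z * gv z - hu (opposite \<Omega> \<theta> z) * hv (opposite \<Omega> \<theta> z)) / opp_dist \<Omega> \<theta> z"
  shows "integrable (dir_measure \<Omega> \<theta>) G"
    and "(\<integral>x. u x * dv x + v x * du x \<partial>lebesgue_on \<Omega>) = (\<integral>z. G z \<partial>dir_measure \<Omega> \<theta>)"
proof -
  have [measurable]: "\<Omega> \<in> sets borel" using \<Omega> by simp
  obtain u0 du0 where u0: "weak_pair \<Omega> \<theta> u0 du0"
    and u_eq: "AE x in lborel. x \<in> \<Omega> \<longrightarrow> u x = u0 x" "AE x in lborel. x \<in> \<Omega> \<longrightarrow> du x = du0 x"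
    using weak_pair_representatives[OF \<Omega>(1) wu] by blast
  obtain v0 dv0 where v0: "weak_pair \<Omega> \<theta> v0 dv0"
    and v_eq: "AE x in lborel. x \<in> \<Omega> \<longrightarrow> v x = v0 x" "AE x in lborel. x \<in> \<Omega> \<longrightarrow> dv x = dv0 x"
    using weak_pair_representatives[OF \<Omega>(1) wv] by blast
  note up = weak_pairD[OF u0] and vp = weak_pairD[OF v0]
  define F where "F x = u0 x * dv0 x + v0 x * du0 x" for x
  have intF: "integrable lborel F"
    unfolding F_def using up(1,2,5,6) vp(1,2,5,6)
    by (intro Bochner_Integration.integrable_add integrable_mult_if_squares) simp_all
  then have F [measurable]: "F \<in> borel_measurable borel" by simp
  have F_out: "F x = 0" if "x \<notin> \<Omega>" for x using that up(3,4) vp(3,4) by (simp add: F_def)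
  define G0 where "G0 = mean_behind \<Omega> \<theta> F"
  have G0 [measurable]: "G0 \<in> borel_measurable borel"
    unfolding G0_def by (rule borel_measurable_mean_behind[OF \<theta> \<Omega> F])
  let ?R = "restrict_space borel (closure \<Omega> - \<Omega>)"
  let ?D = "distr (lebesgue_on \<Omega>) ?R (exit_point \<Omega> \<theta>)"
  have G0_R: "G0 \<in> borel_measurable ?R" by (rule measurable_restrict_space1[OF G0])
  have green: "AE y in hyp_borel \<theta>. \<forall>\<alpha> \<beta>. {\<alpha><..<\<beta>} \<in> line_intervals \<Omega> \<theta> y \<longrightarrow>
    (LBINT s. indicator {\<alpha><..<\<beta>} s * (u0 (s *\<^sub>R \<theta> + y) * dv0 (s *\<^sub>R \<theta> + y) + v0 (s *\<^sub>R \<theta> + y) * du0 (s *\<^sub>R \<theta> + y))) =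
    gu (\<beta> *\<^sub>R \<theta> + y) * gv (\<beta> *\<^sub>R \<theta> + y) - hu (\<alpha> *\<^sub>R \<theta> + y) * hv (\<alpha> *\<^sub>R \<theta> + y)"
    by (rule AE_component_green[OF \<theta> \<Omega> u0 v0 u_eq(1) v_eq(1) g h])
  have AE_G: "AE z in ?D. G z = G0 z"
  proof (rule AE_exit_distribution[OF \<theta> \<Omega>])
    show "AE y in hyp_borel \<theta>. \<forall>\<alpha> \<beta>. {\<alpha><..<\<beta>} \<in> line_intervals \<Omega> \<theta> y \<longrightarrow>
        G (\<beta> *\<^sub>R \<theta> + y) = G0 (\<beta> *\<^sub>R \<theta> + y)"
      using green AE_hyp_borel_in_hyp[of \<theta>]
    proof eventually_elim
      case (elim y)
      show ?case
      proof (intro allI impI)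
        fix \<alpha> \<beta> assume comp: "{\<alpha><..<\<beta>} \<in> line_intervals \<Omega> \<theta> y"
        show "G (\<beta> *\<^sub>R \<theta> + y) = G0 (\<beta> *\<^sub>R \<theta> + y)"
          using elim(1)[rule_format, OF comp] opposite_on_component[OF \<theta> elim(2) comp]
            mean_behind_on_component[OF comp, of F]
          by (simp add: G_def G0_def F_def)
      qed
    qed
  qed
  have G: "G \<in> borel_measurable (completion ?D)"
    using G0_R AE_G by (intro borel_measurable_completion_cong_AE[of G0]) auto
  note H = integral_mean_behind[OF \<theta> \<Omega> intF F_out, folded G0_def]
  have int_exit: "integrable (lebesgue_on \<Omega>) (\<lambda>x. G0 (exit_point \<Omega> \<theta> x))"
  proof -
    have "integrable lebesgue (\<lambda>x. indicator \<Omega> x * G0 (exit_point \<Omega> \<theta> x))"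
      using H(1) by (subst integrable_completion) auto
    then show ?thesis by (subst integrable_restrict_space) auto
  qed
  then have int_D: "integrable ?D G0"
    by (subst integrable_distr_eq[OF measurable_exit_point[OF \<theta> \<Omega>] G0_R])
  then have int_cD: "integrable (completion ?D) G0" using G0_R by (subst integrable_completion) auto
  show "integrable (dir_measure \<Omega> \<theta>) G"
    unfolding dir_measure_def
    by (rule integrable_cong_AE_imp[OF int_cD G]) (use AE_completion[OF AE_G] in \<open>auto simp: eq_commute\<close>)
  have "(\<integral>z. G z \<partial>dir_measure \<Omega> \<theta>) = (\<integral>z. G0 z \<partial>completion ?D)"
    unfolding dir_measure_def
    by (rule integral_cong_AE[OF G _ AE_completion[OF AE_G]]) (use int_cD in auto)
  also have "\<dots> = (\<integral>z. G0 z \<partial>?D)" using G0_R by (subst integral_completion) auto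
  also have "\<dots> = (\<integral>x. G0 (exit_point \<Omega> \<theta> x) \<partial>lebesgue_on \<Omega>)"
    by (rule integral_distr[OF measurable_exit_point[OF \<theta> \<Omega>] G0_R])
  also have "\<dots> = (\<integral>x. indicator \<Omega> x * G0 (exit_point \<Omega> \<theta> x) \<partial>lebesgue)"
    by (subst integral_restrict_space) auto
  also have "\<dots> = (LBINT x. indicator \<Omega> x * G0 (exit_point \<Omega> \<theta> x))"
    using H(1) by (subst integral_completion) auto
  also have "\<dots> = (LBINT x. F x)" by (rule H(2))
  also have "\<dots> = (LBINT x. indicator \<Omega> x * F x)"
    using F_out by (intro Bochner_Integration.integral_cong) (auto simp: indicator_def)
  also have "\<dots> = (\<integral>x. F x \<partial>lebesgue_on \<Omega>)"
    by (rule integral_lebesgue_on_eq[symmetric]) measurable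
  also have "\<dots> = (\<integral>x. u x * dv x + v x * du x \<partial>lebesgue_on \<Omega>)"
  proof (rule integral_cong_AE)
    show "F \<in> borel_measurable (lebesgue_on \<Omega>)" by (rule borel_measurable_lebesgue_on[OF F])
    have "u \<in> borel_measurable (lebesgue_on \<Omega>)" "du \<in> borel_measurable (lebesgue_on \<Omega>)"
      "v \<in> borel_measurable (lebesgue_on \<Omega>)" "dv \<in> borel_measurable (lebesgue_on \<Omega>)"
      using wu wv by (auto simp: weak_dir_deriv_def L2_def)
    then show "(\<lambda>x. u x * dv x + v x * du x) \<in> borel_measurable (lebesgue_on \<Omega>)"
      by (intro borel_measurable_add borel_measurable_times)
    have "AE x in lborel. x \<in> \<Omega> \<longrightarrow> F x = u x * dv x + v x * du x"
      using u_eq v_eq by eventually_elim (auto simp: F_def)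
    then show "AE x in lebesgue_on \<Omega>. F x = u x * dv x + v x * du x" by (simp add: AE_lebesgue_on_iff)
  qed
  finally show "(\<integral>x. u x * dv x + v x * du x \<partial>lebesgue_on \<Omega>) = (\<integral>z. G z \<partial>dir_measure \<Omega> \<theta>)" by simp
qed

theorem theorem2p9:
  fixes \<Omega> :: "'a::euclidean_space set" and \<theta> :: 'a and u v du dv :: "'a \<Rightarrow> real"
  assumes "open \<Omega>" and "bounded \<Omega>" and "\<theta> \<in> sphere 0 1"
    and "u \<in> W_dir \<Omega> \<theta>" and "v \<in> W_dir \<Omega> \<theta>"
    and "weak_dir_deriv \<Omega> \<theta> u du" and "weak_dir_deriv \<Omega> \<theta> v dv"
  shows "(\<forall>w\<in>{u, v}. \<forall>\<sigma>\<in>{\<theta>, -\<theta>}. dir_traces \<Omega> \<sigma> w \<noteq> {}) \<and>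
    (\<forall>gu\<in>dir_traces \<Omega> \<theta> u. \<forall>gv\<in>dir_traces \<Omega> \<theta> v.
     \<forall>hu\<in>dir_traces \<Omega> (-\<theta>) u. \<forall>hv\<in>dir_traces \<Omega> (-\<theta>) v.
       integrable (dir_measure \<Omega> \<theta>) (\<lambda>z.
         (gu z * gv z - hu (opposite \<Omega> \<theta> z) * hv (opposite \<Omega> \<theta> z)) / opp_dist \<Omega> \<theta> z) \<and>
       (LINT x|lebesgue_on \<Omega>. u x * dv x + v x * du x) =
       (LINT z|dir_measure \<Omega> \<theta>.
         (gu z * gv z - hu (opposite \<Omega> \<theta> z) * hv (opposite \<Omega> \<theta> z)) / opp_dist \<Omega> \<theta> z))"
proof (intro conjI ballI)
  have \<theta>: "norm \<theta> = 1" "norm (- \<theta>) = 1" using assms(3) by auto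
  note \<Omega> = assms(1,2)
  show "dir_traces \<Omega> \<sigma> w \<noteq> {}" if "w \<in> {u, v}" "\<sigma> \<in> {\<theta>, -\<theta>}" for w \<sigma>
    using that dir_traces_nonempty[OF \<theta>(1) \<Omega> assms(6)] dir_traces_nonempty[OF \<theta>(1) \<Omega> assms(7)]
      dir_traces_nonempty[OF \<theta>(2) \<Omega> weak_dir_deriv_uminus[OF assms(6)]]
      dir_traces_nonempty[OF \<theta>(2) \<Omega> weak_dir_deriv_uminus[OF assms(7)]]
    by auto
  fix gu gv hu hv
  assume "gu \<in> dir_traces \<Omega> \<theta> u" "gv \<in> dir_traces \<Omega> \<theta> v"
    "hu \<in> dir_traces \<Omega> (-\<theta>) u" "hv \<in> dir_traces \<Omega> (-\<theta>) v"
  note green = green_formula_traces[OF \<theta>(1) \<Omega> assms(6,7) this]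
  show "integrable (dir_measure \<Omega> \<theta>) (\<lambda>z.
      (gu z * gv z - hu (opposite \<Omega> \<theta> z) * hv (opposite \<Omega> \<theta> z)) / opp_dist \<Omega> \<theta> z)"
    by (rule green(1))
  show "(LINT x|lebesgue_on \<Omega>. u x * dv x + v x * du x) =
      (LINT z|dir_measure \<Omega> \<theta>.
        (gu z * gv z - hu (opposite \<Omega> \<theta> z) * hv (opposite \<Omega> \<theta> z)) / opp_dist \<Omega> \<theta> z)"
    by (rule green(2))
qed

end
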